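(* Let $K$ be a Knaster continuum, and let $\{\kappa_1,\kappa_2,\ldots\}$ be any countable set of composants of $K$. Then there exists an embedding $\Omega \colon K \to \mathbb{R}^2$ such that for every $n \in \mathbb{N}$, $\Omega(\kappa_n)$ is a fully accessible composant of $\Omega(K)$.
   Context: $I=[0,1]$; a map is a continuous function. A continuum is a compact, connected metric space. For maps $f_i \colon I \to I$, $i \ge 1$, the inverse limit is $\varprojlim\langle I,f_i\rangle = \{\langle x_1,x_2,\ldots\rangle \in \prod_{i\ge 1} I : f_i(x_{i+1}) = x_i \text{ for all } i \ge 1\}$ with the subspace topology from the product topology. A Knaster continuum is a continuum homeomorphic to an inverse limit $\varprojlim\langle I,f_i\rangle$ where each bonding map $f_i \colon I \to I$ is an open map which is not a homeomorphism. The composant of a point $x$ in a continuum $X$ is the union of all proper subcontinua of $X$ which contain $x$. For a continuum $X \subset \mathbb{R}^2$, a point $x \in X$ is accessible if there is an arc $A \subset \mathbb{R}^2$ (a space homeomorphic to $[0,1]$) such that $A \cap X = \{x\}$. A composant of $X \subset \mathbb{R}^2$ is fully accessible if each of its points is an accessible point of $X$. *)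

theory Defs
  imports "HOL-Analysis.Analysis"
begin

text \<open>
  Spaces are represented as values of type \<^typ>\<open>'a topology\<close>. The underlying metric is never
  used, so ``metric space'' is read as ``metrizable space''.
\<close>

definition continuum :: "'a topology \<Rightarrow> bool" where
  "continuum X \<longleftrightarrow> compact_space X \<and> connected_space X \<and> metrizable_space X"

abbreviation unit_interval :: "real topology" where
  "unit_interval \<equiv> top_of_set {0..1}"

text \<open>Sequences are indexed from \<open>0\<close> rather than from \<open>1\<close>.\<close>

definition interval_inverse_limit :: "(nat \<Rightarrow> real \<Rightarrow> real) \<Rightarrow> (nat \<Rightarrow> real) topology" where
  "interval_inverse_limit f =
     subtopology (product_topology (\<lambda>i. unit_interval) UNIV) {x. \<forall>i. f i (x (Suc i)) = x i}"

definition Knaster_continuum :: "'a topology \<Rightarrow> bool" where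
  "Knaster_continuum X \<longleftrightarrow>
     continuum X \<and>
     (\<exists>f :: nat \<Rightarrow> real \<Rightarrow> real.
        (\<forall>i. continuous_map unit_interval unit_interval (f i) \<and>
             open_map unit_interval unit_interval (f i) \<and>
             \<not> homeomorphic_map unit_interval unit_interval (f i)) \<and>
        X homeomorphic_space interval_inverse_limit f)"

definition composant_of :: "'a topology \<Rightarrow> 'a \<Rightarrow> 'a set" where
  "composant_of X x =
     \<Union> {C. C \<subset> topspace X \<and> continuum (subtopology X C) \<and> x \<in> C}"

definition is_composant :: "'a topology \<Rightarrow> 'a set \<Rightarrow> bool" where
  "is_composant X \<kappa> \<longleftrightarrow> (\<exists>x\<in>topspace X. \<kappa> = composant_of X x)"

definition accessible_point :: "(real^2) set \<Rightarrow> real^2 \<Rightarrow> bool" where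
  "accessible_point X x \<longleftrightarrow> (\<exists>A. A homeomorphic {0..1::real} \<and> A \<inter> X = {x})"

definition fully_accessible_composant :: "(real^2) set \<Rightarrow> (real^2) set \<Rightarrow> bool" where
  "fully_accessible_composant X \<kappa> \<longleftrightarrow>
     is_composant (top_of_set X) \<kappa> \<and> (\<forall>x\<in>\<kappa>. accessible_point X x)"

end

theory Submission
  imports Defs
begin

text \<open>
  Up to a change of coordinates, a Knaster continuum consists of the sequences \<open>x\<^sub>0, x\<^sub>1, \<dots>\<close> in
  \<open>[0,1]\<close> with \<open>x\<^sub>m = tri (N\<^sub>m * x\<^sub>m\<^sub>+\<^sub>1)\<close>, where \<open>tri\<close> is the distance to the nearest even integer;
  the bonding maps are thus tent maps with \<open>N\<^sub>m\<close> laps (\<open>Knaster_tent_coordinates\<close>). Let the itinerary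
  of a point record the lap \<open>g m\<close> in which \<open>x\<^sub>m\<^sub>+\<^sub>1\<close> lies. The points with a given itinerary form an arc
  that \<open>x\<^sub>0\<close> parametrizes, and such arcs meet only at their ends: at \<open>x\<^sub>0 = 0\<close> and at \<open>x\<^sub>0 = 1\<close> each
  itinerary has a partner, which differs from it in at most one digit (\<open>two_codes\<close>). Hence the
  continuum is a Cantor set of arcs whose left ends are matched in pairs and whose right ends are
  matched in pairs.

  Such a space can be drawn in the plane once every itinerary has a real height for which no two
  pairs of either matching are linked, that is, never \<open>a < c < b < d\<close> for pairs \<open>{a, b}\<close> and \<open>{c, d}\<close>:
  draw the arcs as horizontal segments at their heights and join partners by nested wedges. If a
  height is isolated from one side among all heights, then every point of its arc can be reached by a
  short straight segment (\<open>draw_access\<close>). All points of a composant have eventually equal itineraries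
  (\<open>composant_close\<close>, \<open>close_codes_agree\<close>), so a countable family of composants involves only
  countably many itineraries, and it remains to find unlinked heights for which each of these is
  isolated from one side.

  The heights are refined level by level. If each level were drawn inside a thin strip around the
  previous one, only two laps could lie along the sides of the strip, which would expose at most two
  composants. Therefore level \<open>m\<close> is drawn instead as a star: several copies of \<open>[0,1]\<close>, its
  legs, glued at \<open>0\<close>. The legs of the star of level \<open>m + 1\<close> appear in the star of level \<open>m\<close> as
  strands that all walk through its legs in the same order. Each strand \<open>s\<close> has a lane of its own. The
  lane begins with a base, which runs beside the bases of the other strands through all legs, from the
  last one down to leg \<open>0\<close>; there it turns round into a finger, which runs outside of all bases back
  up to leg \<open>s\<close>. When the common walk makes its excursion to leg \<open>s\<close>, strand \<open>s\<close> makes it along its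
  finger, where nothing in that leg lies below it (\<open>rank_target\<close>), while the other strands make it
  along their bases. Within a lane, time is a transverse coordinate, so no two turns cross
  (\<open>inner_turns_unlinked\<close>, \<open>outer_turns_unlinked\<close>).

  The excursion to leg \<open>s\<close> has to take place while the walk is on the lap that the composant number
  \<open>s\<close> prescribes. So the prescribed laps have to be far apart and traversed in the same direction at
  all levels. Distinct composants move apart without bound along the continuum, so composing long
  blocks of bonding maps achieves both (\<open>block_choice\<close>, \<open>isolating_system\<close>). The composant of the end
  point \<open>0\<close> needs no finger, since its lap \<open>0\<close> is always the topmost one.
\<close>

section \<open>Tent maps\<close>

text \<open>
  The distance to the nearest even integer: on \<open>[0, n]\<close> a zigzag with \<open>n\<close> laps that starts at \<open>0\<close>.
\<close>
definition tri :: "real \<Rightarrow> real" where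
  "tri u = \<bar>u - 2 * of_int \<lfloor>(u + 1) / 2\<rfloor>\<bar>"

lemma tri_nearest: obtains k :: int where "tri u = \<bar>u - 2 * of_int k\<bar>" "\<bar>u - 2 * of_int k\<bar> \<le> 1"
proof
  show "tri u = \<bar>u - 2 * of_int \<lfloor>(u + 1) / 2\<rfloor>\<bar>" by (simp add: tri_def)
  have "of_int \<lfloor>(u + 1) / 2\<rfloor> \<le> (u + 1) / 2" "(u + 1) / 2 < of_int \<lfloor>(u + 1) / 2\<rfloor> + 1" by linarith+
  then show "\<bar>u - 2 * of_int \<lfloor>(u + 1) / 2\<rfloor>\<bar> \<le> 1" by (simp add: abs_le_iff field_simps)
qed

lemma tri_unique:
  assumes "\<bar>u - 2 * of_int k\<bar> \<le> 1" shows "tri u = \<bar>u - 2 * of_int k\<bar>"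
proof -
  obtain j where j: "tri u = \<bar>u - 2 * of_int j\<bar>" "\<bar>u - 2 * of_int j\<bar> \<le> 1" by (rule tri_nearest)
  consider "j = k" | "j + 1 \<le> k" | "k + 1 \<le> j" by linarith
  then show ?thesis
  proof cases
    case 2
    then have "real_of_int j + 1 \<le> of_int k" by linarith
    then show ?thesis using assms j by linarith
  next
    case 3
    then have "real_of_int k + 1 \<le> of_int j" by linarith
    then show ?thesis using assms j by linarith
  qed (use j in simp)
qed

lemma tri_bounds: "0 \<le> tri u" "tri u \<le> 1"
proof -
  obtain k where "tri u = \<bar>u - 2 * of_int k\<bar>" "\<bar>u - 2 * of_int k\<bar> \<le> 1" by (rule tri_nearest)
  then show "0 \<le> tri u" "tri u \<le> 1" by auto
qed

lemma tri_le: "tri u \<le> \<bar>u - 2 * of_int k\<bar>"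
proof (cases "\<bar>u - 2 * of_int k\<bar> \<le> 1")
  case True
  then show ?thesis using tri_unique by simp
next
  case False
  then show ?thesis using tri_bounds(2)[of u] by linarith
qed

lemma tri_lipschitz: "\<bar>tri u - tri v\<bar> \<le> \<bar>u - v\<bar>"
proof -
  obtain k where "tri u = \<bar>u - 2 * of_int k\<bar>" by (rule tri_nearest)
  moreover obtain j where "tri v = \<bar>v - 2 * of_int j\<bar>" by (rule tri_nearest)
  ultimately show ?thesis using tri_le[of u j] tri_le[of v k] by linarith
qed

text \<open>
  Composing tent maps multiplies their numbers of laps, because \<open>tri u\<close> and \<open>u\<close> agree up to sign and
  an even integer.
\<close>
lemma tri_mult: "tri (real m * tri u) = tri (real m * u)"
proof -
  obtain k where k: "tri u = \<bar>u - 2 * of_int k\<bar>" by (rule tri_nearest)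
  obtain j where j: "tri (real m * u) = \<bar>real m * u - 2 * of_int j\<bar>" "\<bar>real m * u - 2 * of_int j\<bar> \<le> 1"
    by (rule tri_nearest)
  show ?thesis
  proof (cases "2 * of_int k \<le> u")
    case True
    then have t: "tri u = u - 2 * of_int k" using k by simp
    have "real m * tri u - 2 * of_int (j - int m * k) = real m * u - 2 * of_int j"
      unfolding t by (simp add: algebra_simps)
    then show ?thesis using tri_unique[of "real m * tri u" "j - int m * k"] j by simp
  next
    case False
    then have t: "tri u = 2 * of_int k - u" using k by simp
    have "real m * tri u - 2 * of_int (int m * k - j) = - (real m * u - 2 * of_int j)"
      unfolding t by (simp add: algebra_simps)
    then show ?thesis using tri_unique[of "real m * tri u" "int m * k - j"] j by simp
  qed
qed

lemma tri_lap:
  assumes "real l \<le> u" "u \<le> real l + 1"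
  shows "tri u = (if even l then u - real l else 1 - (u - real l))"
proof (cases "even l")
  case True
  then obtain k where "l = 2 * k" by (rule evenE)
  then show ?thesis using tri_unique[of u "int k"] assms by simp
next
  case False
  then obtain k where "l = 2 * k + 1" by (rule oddE)
  then show ?thesis using tri_unique[of u "int k + 1"] assms by simp
qed

lemma tri_id: "0 \<le> u \<Longrightarrow> u \<le> 1 \<Longrightarrow> tri u = u"
  using tri_lap[of 0 u] by simp

lemma tri_shift: "tri (u + 2) = tri u"
proof -
  obtain k where "tri u = \<bar>u - 2 * of_int k\<bar>" "\<bar>u - 2 * of_int k\<bar> \<le> 1" by (rule tri_nearest)
  then show ?thesis using tri_unique[of "u + 2" "k + 1"] by simp
qed

lemma tri_int: "tri (real k) \<in> {0, 1}"
  using tri_lap[of k "real k"] by simp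

section \<open>Open self-maps of the interval\<close>

definition open_self_map :: "(real \<Rightarrow> real) \<Rightarrow> bool" where
  "open_self_map g \<longleftrightarrow> continuous_map unit_interval unit_interval g \<and> open_map unit_interval unit_interval g"

lemma open_self_mapD:
  assumes "open_self_map g"
  shows "continuous_on {0..1} g" "\<And>x. 0 \<le> x \<Longrightarrow> x \<le> 1 \<Longrightarrow> 0 \<le> g x \<and> g x \<le> 1"
    "\<And>U. open U \<Longrightarrow> openin unit_interval (g ` ({0..1} \<inter> U))"
  using assms unfolding open_self_map_def open_map_def
  by (auto simp: Pi_iff openin_open_Int)

lemma reflection_homeo: "homeomorphic_map unit_interval unit_interval (\<lambda>x::real. 1 - x)"
  by (rule homeomorphic_maps_imp_map[where g = "\<lambda>x. 1 - x"])
     (auto simp: homeomorphic_maps_def intro!: continuous_intros)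

lemma open_self_map_homeo_comp:
  assumes "open_self_map g" "homeomorphic_map unit_interval unit_interval h"
  shows "open_self_map (g \<circ> h)" "open_self_map (h \<circ> g)"
  using assms unfolding open_self_map_def
  by (metis continuous_map_compose homeomorphic_imp_continuous_map homeomorphic_imp_open_map open_map_compose)+

lemma open_self_map_near:
  assumes g: "open_self_map g" and c: "0 \<le> c" "c \<le> 1" and r: "0 < r"
  obtains e where "0 < e" "\<And>y. 0 \<le> y \<Longrightarrow> y \<le> 1 \<Longrightarrow> \<bar>y - g c\<bar> < e \<Longrightarrow> \<exists>x. 0 \<le> x \<and> x \<le> 1 \<and> \<bar>x - c\<bar> < r \<and> g x = y"
proof -
  have "openin unit_interval (g ` ({0..1} \<inter> ball c r))" using open_self_mapD(3)[OF g] by simp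
  moreover have "g c \<in> g ` ({0..1} \<inter> ball c r)" using c r by auto
  ultimately obtain e where "0 < e" "ball (g c) e \<inter> {0..1} \<subseteq> g ` ({0..1} \<inter> ball c r)"
    unfolding openin_contains_ball by blast
  then show ?thesis by (intro that[of e]) (force simp: dist_real_def abs_minus_commute subset_iff image_iff)+
qed

text \<open>
  Otherwise the image of a neighbourhood of \<open>c\<close> would contain \<open>g c < 1\<close> but nothing above it, and so
  would not be open. End points of the interval are included.
\<close>
lemma local_max_is_1:
  assumes g: "open_self_map g" and c: "0 \<le> c" "c \<le> 1" and r: "0 < r"
    and m: "\<And>x. 0 \<le> x \<Longrightarrow> x \<le> 1 \<Longrightarrow> \<bar>x - c\<bar> < r \<Longrightarrow> g x \<le> g c"
  shows "g c = 1"
proof (rule ccontr)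
  assume "g c \<noteq> 1"
  then have lt: "0 \<le> g c" "g c < 1" using open_self_mapD(2)[OF g c] by auto
  obtain e where e: "0 < e" "\<And>y. 0 \<le> y \<Longrightarrow> y \<le> 1 \<Longrightarrow> \<bar>y - g c\<bar> < e \<Longrightarrow> \<exists>x. 0 \<le> x \<and> x \<le> 1 \<and> \<bar>x - c\<bar> < r \<and> g x = y"
    using open_self_map_near[OF g c r] by blast
  \<comment> \<open>a value slightly above \<open>g c\<close>, which has to be attained near \<open>c\<close>\<close>
  define y where "y = g c + min e (1 - g c) / 2"
  have "0 \<le> y" "y \<le> 1" "\<bar>y - g c\<bar> < e" "g c < y" using e(1) lt by (auto simp: y_def min_def field_simps)
  then show False using e(2)[of y] m by force
qed

lemma local_min_is_0:
  assumes g: "open_self_map g" and c: "0 \<le> c" "c \<le> 1" and r: "0 < r"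
    and m: "\<And>x. 0 \<le> x \<Longrightarrow> x \<le> 1 \<Longrightarrow> \<bar>x - c\<bar> < r \<Longrightarrow> g c \<le> g x"
  shows "g c = 0"
proof -
  have "open_self_map ((\<lambda>x. 1 - x) \<circ> g)" using open_self_map_homeo_comp(2)[OF g reflection_homeo] .
  from local_max_is_1[OF this c r] m show ?thesis by simp
qed

text \<open>
  Some value on \<open>[x, y]\<close> differs from the common end value, since \<open>g\<close> cannot be constant there; so an
  extremum lies in the interior.
\<close>
lemma turning_values:
  assumes g: "open_self_map g" and xy: "0 \<le> x" "x < y" "y \<le> 1" "g x = g y"
  shows "\<exists>z. x < z \<and> z < y \<and> g z \<in> {0, 1} - {g x}"
proof -
  have cont: "continuous_on {x..y} g" using continuous_on_subset[OF open_self_mapD(1)[OF g]] xy by auto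
  obtain p where p: "p \<in> {x..y}" "\<And>z. z \<in> {x..y} \<Longrightarrow> g z \<le> g p"
    using continuous_attains_sup[OF compact_Icc _ cont] xy by (metis atLeastAtMost_iff less_imp_le order_refl empty_iff)
  obtain q where q: "q \<in> {x..y}" "\<And>z. z \<in> {x..y} \<Longrightarrow> g q \<le> g z"
    using continuous_attains_inf[OF compact_Icc _ cont] xy by (metis atLeastAtMost_iff less_imp_le order_refl empty_iff)
  have mx: "g c = 1" if c: "x < c" "c < y" "g c = g p" for c
  proof (rule local_max_is_1[OF g, of c "min (c - x) (y - c)"])
    show "g z \<le> g c" if "\<bar>z - c\<bar> < min (c - x) (y - c)" for z
      using p(2)[of z] that c by (auto simp: abs_less_iff)
  qed (use c xy in auto)
  have mn: "g c = 0" if c: "x < c" "c < y" "g c = g q" for c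
  proof (rule local_min_is_0[OF g, of c "min (c - x) (y - c)"])
    show "g c \<le> g z" if "\<bar>z - c\<bar> < min (c - x) (y - c)" for z
      using q(2)[of z] that c by (auto simp: abs_less_iff)
  qed (use c xy in auto)
  consider "g x < g p" | "g q < g x" | "g p = g x" "g q = g x"
    using p q xy by fastforce
  then show ?thesis
  proof cases
    case 1
    then have "x < p" "p < y" using p(1) xy by (auto simp: le_less)
    then show ?thesis using mx[of p] 1 by (intro exI[of _ p]) auto
  next
    case 2
    then have "x < q" "q < y" using q(1) xy by (auto simp: le_less)
    then show ?thesis using mn[of q] 2 by (intro exI[of _ q]) auto
  next
    case 3
    define c where "c = (x + y) / 2"
    have c: "x < c" "c < y" using xy by (auto simp: c_def)
    then have "g c = g p" "g c = g q" using p(2)[of c] q(2)[of c] 3 by auto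
    then show ?thesis using mx[OF c] mn[OF c] by simp
  qed
qed

text \<open>
  By the two lemmas on local extrema, \<open>g\<close> can change its direction only at these points.
\<close>
definition turning :: "(real \<Rightarrow> real) \<Rightarrow> real set" where
  "turning g = {x \<in> {0..1}. g x \<in> {0, 1}}"

lemma gap_neq:
  assumes "open_self_map g" "0 \<le> x" "x < y" "y \<le> 1" "\<And>z. x < z \<Longrightarrow> z < y \<Longrightarrow> z \<notin> turning g"
  shows "g x \<noteq> g y"
  using turning_values[OF assms(1-4)] assms(2-5) unfolding turning_def by fastforce

text \<open>
  Uniform continuity separates turning points: between two that are close to each other, the map
  would have to reach the opposite end of \<open>[0,1]\<close>.
\<close>
lemma finite_turning:
  assumes g: "open_self_map g" shows "finite (turning g)"
proof -
  have "uniformly_continuous_on {0..1} g"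
    using compact_uniformly_continuous[OF open_self_mapD(1)[OF g]] by simp
  then obtain d where d: "0 < d" "\<And>x y. x \<in> {0..1} \<Longrightarrow> y \<in> {0..1} \<Longrightarrow> dist x y < d \<Longrightarrow> dist (g x) (g y) < 1"
    unfolding uniformly_continuous_on_def by (metis zero_less_one)
  have apart: "d \<le> y - x" if xy: "x \<in> turning g" "y \<in> turning g" "x < y" for x y
  proof (rule ccontr)
    assume "\<not> ?thesis"
    then have close: "\<bar>g z - g w\<bar> < 1" if "x \<le> z" "z \<le> y" "x \<le> w" "w \<le> y" for z w
      using d(2)[of z w] that xy by (auto simp: dist_real_def turning_def)
    have "g x = g y" using close[of x y] xy by (auto simp: turning_def)
    then obtain z where "x < z" "z < y" "g z \<in> {0, 1} - {g x}"
      using turning_values[OF g, of x y] xy by (auto simp: turning_def)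
    then show False using close[of x z] xy by (auto simp: turning_def)
  qed
  have "\<not> x islimpt turning g" for x
  proof
    assume "x islimpt turning g"
    then have "infinite (turning g \<inter> ball x (d / 2))" using d(1) by (simp add: islimpt_eq_infinite_ball)
    then obtain y z where "y \<in> turning g \<inter> ball x (d / 2)" "z \<in> turning g \<inter> ball x (d / 2)" "y < z"
      by (metis finite.emptyI finite.insertI finite_subset insertI1 linorder_neqE subsetI)
    then have "\<bar>x - y\<bar> < d / 2" "\<bar>x - z\<bar> < d / 2" "d \<le> z - y"
      using apart[of y z] by (auto simp: dist_real_def)
    then show False by linarith
  qed
  then have "finite ({0..1} \<inter> turning g)" by (intro finite_not_islimpt_in_compact) auto
  moreover have "{0..1} \<inter> turning g = turning g" by (auto simp: turning_def)
  ultimately show ?thesis by simp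
qed

text \<open>
  Near \<open>1\<close> the map is monotone, because turning points are finite in number; hence \<open>1\<close> is a local
  extremum.
\<close>
lemma endpoint_turning:
  assumes g: "open_self_map g" shows "g 1 \<in> {0, 1}" "g 0 \<in> {0, 1}"
proof -
  have *: "g 1 \<in> {0, 1}" if g: "open_self_map g" for g
  proof -
    define z where "z = Max (insert 0 (turning g - {1}))"
    have fin: "finite (insert 0 (turning g - {1}))" using finite_turning[OF g] by simp
    have "z \<in> insert 0 (turning g - {1})" unfolding z_def by (rule Max_in) (use fin in auto)
    then have z: "0 \<le> z" "z < 1" by (auto simp: turning_def)
    have zmax: "w \<notin> turning g" if "z < w" "w < 1" for w
      using Max_ge[OF fin, of w] that by (auto simp: z_def)
    have inj: "inj_on g {z..1}"
    proof (rule inj_onI, rule ccontr)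
      fix x y assume *: "x \<in> {z..1}" "y \<in> {z..1}" "g x = g y" "x \<noteq> y"
      have "g u \<noteq> g v" if "z \<le> u" "u < v" "v \<le> 1" for u v
        using gap_neq[OF g, of u v] zmax that z by auto
      then show False using * by (metis atLeastAtMost_iff linorder_neqE)
    qed
    have mono: "(g z < g x \<and> g x < g 1) \<or> (g 1 < g x \<and> g x < g z)" if "z < x" "x < 1" for x
      using continuous_inj_imp_mono[OF that _ inj] continuous_on_subset[OF open_self_mapD(1)[OF g]] z by auto
    show ?thesis
    proof (cases "g z < g 1")
      case True
      have "g x \<le> g 1" if "0 \<le> x" "x \<le> 1" "\<bar>x - 1\<bar> < 1 - z" for x
        using mono[of x] that True by (cases "x = 1") auto
      then show ?thesis using local_max_is_1[OF g, of 1 "1 - z"] z by simp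
    next
      case False
      have "g 1 \<le> g x" if "0 \<le> x" "x \<le> 1" "\<bar>x - 1\<bar> < 1 - z" for x
        using mono[of x] that False by (cases "x = 1") auto
      then show ?thesis using local_min_is_0[OF g, of 1 "1 - z"] z by simp
    qed
  qed
  show "g 1 \<in> {0, 1}" using *[OF g] .
  show "g 0 \<in> {0, 1}" using *[OF open_self_map_homeo_comp(1)[OF g reflection_homeo]] by simp
qed

lemma lap_monotone:
  assumes g: "open_self_map g" and ab: "0 \<le> a" "a < b" "b \<le> 1"
    and gap: "\<And>z. a < z \<Longrightarrow> z < b \<Longrightarrow> z \<notin> turning g" and xy: "a \<le> x" "x < y" "y \<le> b"
  shows "\<bar>g x - g a\<bar> < \<bar>g y - g a\<bar>"
proof -
  have neq: "g u \<noteq> g v" if "a \<le> u" "u < v" "v \<le> b" for u v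
    using gap_neq[OF g, of u v] gap that ab by auto
  have inj: "inj_on g {a..y}"
    using neq xy by (intro inj_onI) (metis atLeastAtMost_iff linorder_neqE order_trans)
  show ?thesis
  proof (cases "x = a")
    case True
    then show ?thesis using neq[of a y] xy by simp
  next
    case False
    then have "(g a < g x \<and> g x < g y) \<or> (g y < g x \<and> g x < g a)"
      using continuous_inj_imp_mono[of a x y g] inj xy ab continuous_on_subset[OF open_self_mapD(1)[OF g], of "{a..y}"]
      by auto
    then show ?thesis by auto
  qed
qed

text \<open>
  The laps of \<open>g\<close> are unrolled from right to left: on each lap \<open>\<bar>g x - g a\<bar>\<close> increases from \<open>0\<close> to
  \<open>1\<close>. The summand \<open>g a\<close> is \<open>0\<close> or \<open>1\<close> and sets the phase of the zigzag.
\<close>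
lemma unfold_from:
  assumes g: "open_self_map g"
  shows "a \<in> turning g \<Longrightarrow> card {z \<in> turning g. a < z} = n \<Longrightarrow>
    \<exists>h. continuous_on {a..1} h \<and> (\<forall>x y. a \<le> x \<and> x < y \<and> y \<le> 1 \<longrightarrow> h x < h y) \<and> h a = 0 \<and> h 1 = real n \<and>
        (\<forall>x. a \<le> x \<and> x \<le> 1 \<longrightarrow> g x = tri (h x + g a))"
proof (induction n arbitrary: a)
  case 0
  have "finite {z \<in> turning g. a < z}" using finite_turning[OF g] by simp
  then have "{z \<in> turning g. a < z} = {}" using 0 by simp
  moreover have "1 \<in> turning g" using endpoint_turning[OF g] by (simp add: turning_def)
  ultimately have "a = 1" using 0(1) by (fastforce simp: turning_def)
  then show ?case using 0(1) by (intro exI[of _ "\<lambda>_. 0"]) (auto simp: turning_def tri_id)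
next
  case (Suc n)
  have fin: "finite {z \<in> turning g. a < z}" using finite_turning[OF g] by simp
  then have ne: "{z \<in> turning g. a < z} \<noteq> {}" using Suc.prems by force
  \<comment> \<open>the end of the first lap\<close>
  define b where "b = Min {z \<in> turning g. a < z}"
  have b: "b \<in> turning g" "a < b" using Min_in[OF fin ne] by (auto simp: b_def)
  have gap: "z \<notin> turning g" if "a < z" "z < b" for z
    using Min_le[OF fin, of z] that by (auto simp: b_def)
  have ab: "0 \<le> a" "b \<le> 1" "g a \<in> {0, 1}" "g b \<in> {0, 1}" using b Suc.prems(1) by (auto simp: turning_def)
  have "{z \<in> turning g. a < z} = insert b {z \<in> turning g. b < z}"
    using b gap by (intro set_eqI) (simp, metis less_trans linorder_neqE)
  then have "card {z \<in> turning g. b < z} = n" using Suc.prems(2) fin by simp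
  then obtain k where k: "continuous_on {b..1} k" "\<And>x y. b \<le> x \<and> x < y \<and> y \<le> 1 \<Longrightarrow> k x < k y"
      "k b = 0" "k 1 = real n" "\<And>x. b \<le> x \<and> x \<le> 1 \<Longrightarrow> g x = tri (k x + g b)"
    using Suc.IH[OF b(1)] by blast
  have mono: "\<bar>g x - g a\<bar> < \<bar>g y - g a\<bar>" if "a \<le> x" "x < y" "y \<le> b" for x y
    using lap_monotone[OF g ab(1) b(2) ab(2) gap that] .
  have gb: "g b = 1 - g a" using mono[of a b] b ab by auto
  define h where "h x = (if x \<le> b then \<bar>g x - g a\<bar> else 1 + k x)" for x
  have hb: "h b = 1" using gb ab by (auto simp: h_def)
  have cont: "continuous_on {a..1} h"
  proof -
    have "continuous_on ({a..b} \<union> {b..1}) (\<lambda>x. if x \<le> b then \<bar>g x - g a\<bar> else 1 + k x)"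
      using k(1,3) gb ab continuous_on_subset[OF open_self_mapD(1)[OF g], of "{a..b}"]
      by (intro continuous_on_If) (auto intro!: continuous_intros)
    then show ?thesis using b ab by (simp add: h_def[abs_def] ivl_disj_un_two_touch)
  qed
  have inc: "h x < h y" if "a \<le> x \<and> x < y \<and> y \<le> 1" for x y
  proof -
    have lo: "h x < h y" if "a \<le> x" "x < y" "y \<le> b" for x y using mono[OF that] that by (simp add: h_def)
    have hi: "h x < h y" if "b \<le> x" "x < y" "y \<le> 1" for x y
      using k(2)[of x y] k(3) hb that by (cases "x = b") (auto simp: h_def)
    consider "y \<le> b" | "b \<le> x" | "x < b" "b < y" by linarith
    then show ?thesis
    proof cases
      case 3
      then have "h x < h b" "h b < h y" using lo[of x b] hi[of b y] that b ab by auto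
      then show ?thesis by simp
    qed (use lo hi that in auto)
  qed
  have val: "g x = tri (h x + g a)" if x: "a \<le> x \<and> x \<le> 1" for x
  proof -
    have gx: "0 \<le> g x" "g x \<le> 1" using open_self_mapD(2)[OF g] x ab by auto
    consider "x \<le> b" "g a = 0" | "x \<le> b" "g a = 1" | "b < x" "g a = 0" | "b < x" "g a = 1" using ab by fastforce
    then show ?thesis
    proof cases
      case 1
      then show ?thesis using gx tri_id by (simp add: h_def)
    next
      case 2
      then show ?thesis using gx tri_lap[of 1 "h x + g a"] by (simp add: h_def)
    next
      case 3
      then show ?thesis using k(5)[of x] gb x by (simp add: h_def add.commute)
    next
      case 4
      then show ?thesis using k(5)[of x] gb x tri_shift[of "k x"] by (simp add: h_def add.commute)
    qed
  qed
  have "h a = 0" "h 1 = real (Suc n)" using b ab k(3,4) gb by (auto simp: h_def)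
  then show ?case using cont inc val by blast
qed

lemma increasing_homeo:
  fixes h :: "real \<Rightarrow> real"
  assumes "continuous_on {0..1} h" "\<And>x y. 0 \<le> x \<Longrightarrow> x < y \<Longrightarrow> y \<le> 1 \<Longrightarrow> h x < h y" "h 0 = 0" "h 1 = 1"
  shows "homeomorphic_map unit_interval unit_interval h"
proof -
  have le: "h x \<le> h y" if "0 \<le> x" "x \<le> y" "y \<le> 1" for x y using assms(2)[of x y] that by (cases "x = y") auto
  have inj: "inj_on h {0..1}"
    by (intro inj_onI) (metis assms(2) atLeastAtMost_iff less_irrefl linorder_neqE)
  have im: "h ` {0..1} = {0..1}"
  proof
    show "h ` {0..1} \<subseteq> {0..1}" using le[of 0] le[of _ 1] assms(3,4) by fastforce
    show "{0..1} \<subseteq> h ` {0..1}"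
    proof
      fix y :: real assume "y \<in> {0..1}"
      then show "y \<in> h ` {0..1}" using IVT'[of h 0 y 1] assms by force
    qed
  qed
  show ?thesis
  proof (rule continuous_imp_homeomorphic_map)
    show "continuous_map unit_interval unit_interval h" using assms(1) im by (auto simp: Pi_iff)
    show "compact_space unit_interval" by (simp add: compact_space_subtopology compactin_euclidean_iff)
    show "Hausdorff_space unit_interval" by (simp add: Hausdorff_space_subtopology)
  qed (use inj im in auto)
qed

lemma open_self_map_unfold:
  assumes g: "open_self_map g" and e: "e \<in> {0, 1}" "g e = 0"
  obtains n h where "1 \<le> n" "homeomorphic_map unit_interval unit_interval h" "h e = 0"
    "\<And>x. 0 \<le> x \<Longrightarrow> x \<le> 1 \<Longrightarrow> g x = tri (real n * h x)"
proof -
  have *: "\<exists>n h. 1 \<le> n \<and> homeomorphic_map unit_interval unit_interval h \<and> h 0 = 0 \<and>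
      (\<forall>x. 0 \<le> x \<and> x \<le> 1 \<longrightarrow> g x = tri (real n * h x))" if g: "open_self_map g" "g 0 = 0" for g
  proof -
    define n where "n = card {z \<in> turning g. 0 < z}"
    have "0 \<in> turning g" using g by (simp add: turning_def)
    then obtain h where h: "continuous_on {0..1} h" "\<And>x y. 0 \<le> x \<and> x < y \<and> y \<le> 1 \<Longrightarrow> h x < h y" "h 0 = 0"
        "h 1 = real n" "\<And>x. 0 \<le> x \<and> x \<le> 1 \<Longrightarrow> g x = tri (h x + g 0)"
      using unfold_from[OF g(1), of 0 n] n_def by blast
    have n: "0 < real n" using h(2)[of 0 1] h(3,4) by simp
    have "homeomorphic_map unit_interval unit_interval (\<lambda>x. h x / real n)"
      using h n by (intro increasing_homeo) (auto intro!: continuous_intros divide_strict_right_mono)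
    then show ?thesis using n h(3,5) g(2) by (intro exI[of _ n] exI[of _ "\<lambda>x. h x / real n"]) auto
  qed
  show ?thesis
  proof (cases "e = 0")
    case True
    then show ?thesis using *[OF g] e that by blast
  next
    case False
    define r :: "real \<Rightarrow> real" where "r x = 1 - x" for x
    have r: "homeomorphic_map unit_interval unit_interval r" using reflection_homeo by (simp add: r_def[abs_def])
    have "open_self_map (g \<circ> r)" "(g \<circ> r) 0 = 0"
      using open_self_map_homeo_comp(1)[OF g r] e False by (auto simp: r_def)
    then obtain n h where nh: "1 \<le> n" "homeomorphic_map unit_interval unit_interval h" "h 0 = 0"
      "\<And>x. 0 \<le> x \<and> x \<le> 1 \<Longrightarrow> (g \<circ> r) x = tri (real n * h x)" using * by blast
    have "g x = tri (real n * (h \<circ> r) x)" if "0 \<le> x" "x \<le> 1" for x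
      using nh(4)[of "r x"] that by (simp add: r_def)
    moreover have "homeomorphic_map unit_interval unit_interval (h \<circ> r)"
      using homeomorphic_map_compose[OF r nh(2)] .
    moreover have "(h \<circ> r) e = 0" using e False nh(3) by (simp add: r_def)
    ultimately show ?thesis using that nh(1) by blast
  qed
qed

text \<open>
  One step of the conjugation to tent maps. With a single lap, \<open>f\<close> would be a composition of
  homeomorphisms.
\<close>
lemma tent_conjugation:
  assumes f: "open_self_map f" "\<not> homeomorphic_map unit_interval unit_interval f"
    and p: "homeomorphic_map unit_interval unit_interval p" and e: "e \<in> {0, 1}" "p (f e) = 0"
  obtains n q where "2 \<le> n" "homeomorphic_map unit_interval unit_interval q" "q e = 0"
    "\<And>x. 0 \<le> x \<Longrightarrow> x \<le> 1 \<Longrightarrow> p (f x) = tri (real n * q x)"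
proof -
  have "open_self_map (p \<circ> f)" using open_self_map_homeo_comp(2)[OF f(1) p] .
  then obtain n q where nq: "1 \<le> n" "homeomorphic_map unit_interval unit_interval q" "q e = 0"
    "\<And>x. 0 \<le> x \<Longrightarrow> x \<le> 1 \<Longrightarrow> (p \<circ> f) x = tri (real n * q x)"
    using open_self_map_unfold[of "p \<circ> f" e] e by auto
  have "n \<noteq> 1"
  proof
    assume n: "n = 1"
    obtain p' where p': "homeomorphic_maps unit_interval unit_interval p p'"
      using p homeomorphic_map_maps by blast
    have qI: "q x \<in> {0..1}" if "x \<in> {0..1}" for x
      using homeomorphic_imp_continuous_map[OF nq(2)] that by (auto simp: Pi_iff)
    have "f x = (p' \<circ> q) x" if x: "x \<in> {0..1}" for x
    proof -
      have "p (f x) = q x" using nq(4)[of x] n x qI[OF x] tri_id by simp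
      moreover have "p' (p (f x)) = f x"
        using p' open_self_mapD(2)[OF f(1), of x] x by (simp add: homeomorphic_maps_def)
      ultimately show ?thesis by simp
    qed
    then have eq: "(p' \<circ> q) x = f x" if "x \<in> topspace unit_interval" for x using that by simp
    have "homeomorphic_map unit_interval unit_interval p'" using p' homeomorphic_maps_map by blast
    then have "homeomorphic_map unit_interval unit_interval (p' \<circ> q)"
      by (rule homeomorphic_map_compose[OF nq(2)])
    then have "homeomorphic_map unit_interval unit_interval f" using eq by (rule homeomorphic_map_eq)
    then show False using f(2) by blast
  qed
  then show ?thesis using that[of n q] nq by simp
qed

section \<open>Tent coordinates of a Knaster continuum\<close>

text \<open>
  The composite of \<open>f i, \<dots>, f (i + k - 1)\<close>.
\<close>
primrec descend :: "(nat \<Rightarrow> real \<Rightarrow> real) \<Rightarrow> nat \<Rightarrow> nat \<Rightarrow> real \<Rightarrow> real" where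
  "descend f i 0 x = x"
| "descend f i (Suc k) x = f i (descend f (Suc i) k x)"

lemma descend_add: "descend f i (j + k) x = descend f i j (descend f (i + j) k x)"
  by (induction j arbitrary: i) auto

text \<open>
  A thread of end points fixes at each level which end of the interval becomes \<open>0\<close>, so that every tent
  map starts with an increasing lap. It exists because the images of \<open>{0, 1}\<close> at a fixed level form a
  decreasing sequence of nonempty finite sets.
\<close>
lemma endpoint_thread:
  assumes f: "\<And>i. open_self_map (f i)"
  obtains e :: "nat \<Rightarrow> real" where "\<And>i. e i \<in> {0, 1}" "\<And>i. f i (e (Suc i)) = e i"
proof -
  define A where "A i k = descend f i k ` {0, 1}" for i k
  have in01: "descend f i k x \<in> {0, 1}" if "x \<in> {0, 1}" for i k x
  proof (induction k arbitrary: i)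
    case (Suc k)
    then have "descend f (Suc i) k x = 0 \<or> descend f (Suc i) k x = 1" by blast
    then show ?case using endpoint_turning[OF f[of i]] by auto
  qed (use that in simp)
  have anti: "A i K \<subseteq> A i k" if "k \<le> K" for i k K
  proof
    fix a assume "a \<in> A i K"
    then obtain c where c: "c \<in> {0, 1}" "a = descend f i K c" by (auto simp: A_def)
    have "a = descend f i k (descend f (i + k) (K - k) c)" using c(2) that descend_add[of f i k "K - k" c] by simp
    then show "a \<in> A i k" using in01[OF c(1)] unfolding A_def by blast
  qed
  have limit: "\<exists>b. (\<forall>k. b \<in> A i k) \<and> Q b" if avail: "\<And>k. \<exists>b\<in>A i k. Q b" for i Q
  proof (rule ccontr)
    assume no: "\<not> ?thesis"
    obtain k0 where k0: "Q 0 \<Longrightarrow> 0 \<notin> A i k0" using no by blast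
    obtain k1 where k1: "Q 1 \<Longrightarrow> 1 \<notin> A i k1" using no by blast
    obtain b where b: "b \<in> A i (max k0 k1)" "Q b" using avail by blast
    have "b \<in> {0, 1}" using b(1) in01 unfolding A_def by blast
    then show False using b k0 k1 anti[of k0 "max k0 k1" i] anti[of k1 "max k0 k1" i] by auto
  qed
  have "\<exists>e. \<forall>i. (\<forall>k. e i \<in> A i k) \<and> f i (e (Suc i)) = e i"
  proof (rule dependent_nat_choice)
    have "\<exists>b\<in>A 0 k. True" for k by (auto simp: A_def)
    then show "\<exists>x. \<forall>k. x \<in> A 0 k" using limit[of 0 "\<lambda>_. True"] by blast
  next
    fix a i assume a: "\<forall>k. a \<in> A i k"
    have "\<exists>b\<in>A (Suc i) k. f i b = a" for k
    proof -
      have "a \<in> A i (Suc k)" using a by blast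
      then show ?thesis unfolding A_def by auto
    qed
    then show "\<exists>b. (\<forall>k. b \<in> A (Suc i) k) \<and> f i b = a" using limit[of "Suc i" "\<lambda>b. f i b = a"] by blast
  qed
  then obtain e where e: "\<And>i k. e i \<in> A i k" "\<And>i. f i (e (Suc i)) = e i" by blast
  have "e i \<in> {0, 1}" for i using e(1)[of i 0] by (auto simp: A_def)
  then show ?thesis using that e(2) by blast
qed

lemma tent_system:
  assumes f: "\<And>i. open_self_map (f i)" "\<And>i. \<not> homeomorphic_map unit_interval unit_interval (f i)"
  obtains n :: "nat \<Rightarrow> nat" and p :: "nat \<Rightarrow> real \<Rightarrow> real" where
    "\<And>i. 2 \<le> n i" "\<And>i. homeomorphic_map unit_interval unit_interval (p i)"
    "\<And>i x. 0 \<le> x \<Longrightarrow> x \<le> 1 \<Longrightarrow> p i (f i x) = tri (real (n i) * p (Suc i) x)"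
proof -
  obtain e where e: "\<And>i. e i \<in> {0, 1}" "\<And>i. f i (e (Suc i)) = e i" 
    using endpoint_thread[of f] f(1) by blast
  have "\<exists>p. \<forall>i. (homeomorphic_map unit_interval unit_interval (p i) \<and> p i (e i) = 0) \<and>
     (\<exists>n::nat. 2 \<le> n \<and> (\<forall>x. 0 \<le> x \<and> x \<le> 1 \<longrightarrow> p i (f i x) = tri (real n * p (Suc i) x)))"
  proof (rule dependent_nat_choice)
    show "\<exists>p. homeomorphic_map unit_interval unit_interval p \<and> p (e 0) = 0"
    proof (cases "e 0 = 0")
      case True
      then show ?thesis using homeomorphic_map_id[of unit_interval unit_interval] by (intro exI[of _ id]) simp
    next
      case False
      then show ?thesis using e(1)[of 0] reflection_homeo by (intro exI[of _ "\<lambda>x. 1 - x"]) simp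
    qed
  next
    fix p i assume p: "homeomorphic_map unit_interval unit_interval p \<and> p (e i) = 0"
    then obtain n q where "2 \<le> n" "homeomorphic_map unit_interval unit_interval q" "q (e (Suc i)) = 0"
      "\<And>x. 0 \<le> x \<Longrightarrow> x \<le> 1 \<Longrightarrow> p (f i x) = tri (real n * q x)"
      using tent_conjugation[OF f(1)[of i] f(2)[of i], of p "e (Suc i)"] e by metis
    then show "\<exists>q. (homeomorphic_map unit_interval unit_interval q \<and> q (e (Suc i)) = 0) \<and>
       (\<exists>n::nat. 2 \<le> n \<and> (\<forall>x. 0 \<le> x \<and> x \<le> 1 \<longrightarrow> p (f i x) = tri (real n * q x)))" by blast
  qed
  then obtain p where p: "\<And>i. homeomorphic_map unit_interval unit_interval (p i)"
    "\<forall>i. \<exists>n::nat. 2 \<le> n \<and> (\<forall>x. 0 \<le> x \<and> x \<le> 1 \<longrightarrow> p i (f i x) = tri (real n * p (Suc i) x))" by blast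
  from choice[OF p(2)] obtain n :: "nat \<Rightarrow> nat" where
    "\<forall>i. 2 \<le> n i \<and> (\<forall>x. 0 \<le> x \<and> x \<le> 1 \<longrightarrow> p i (f i x) = tri (real (n i) * p (Suc i) x))" by blast
  then show ?thesis using that p(1) by blast
qed

theorem Knaster_tent_coordinates:
  assumes "Knaster_continuum K"
  obtains n :: "nat \<Rightarrow> nat" and u :: "nat \<Rightarrow> 'a \<Rightarrow> real" where
    "\<And>i. 2 \<le> n i" "\<And>i. continuous_map K unit_interval (u i)"
    "\<And>i x. x \<in> topspace K \<Longrightarrow> tri (real (n i) * u (Suc i) x) = u i x"
    "\<And>x y. x \<in> topspace K \<Longrightarrow> y \<in> topspace K \<Longrightarrow> (\<And>i. u i x = u i y) \<Longrightarrow> x = y"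
proof -
  obtain f where f: "\<And>i. continuous_map unit_interval unit_interval (f i)"
     "\<And>i. open_map unit_interval unit_interval (f i)"
     "\<And>i. \<not> homeomorphic_map unit_interval unit_interval (f i)" "K homeomorphic_space interval_inverse_limit f"
    using assms unfolding Knaster_continuum_def by blast
  obtain n p where np: "\<And>i. 2 \<le> n i" "\<And>i. homeomorphic_map unit_interval unit_interval (p i)"
    "\<And>i x. 0 \<le> x \<Longrightarrow> x \<le> 1 \<Longrightarrow> p i (f i x) = tri (real (n i) * p (Suc i) x)"
    using tent_system[of f] f unfolding open_self_map_def by metis
  obtain k where k: "homeomorphic_map K (interval_inverse_limit f) k"
    using f(4) homeomorphic_space by blast
  define u where "u i x = p i (k x i)" for i x
  have kc: "continuous_map K (product_topology (\<lambda>i. unit_interval) UNIV) k"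
    using homeomorphic_imp_continuous_map[OF k] unfolding interval_inverse_limit_def
    by (rule continuous_map_into_fulltopology)
  have kx: "k x i \<in> {0..1}" "f i (k x (Suc i)) = k x i" if "x \<in> topspace K" for x i
  proof -
    have "k x \<in> topspace (interval_inverse_limit f)"
      using homeomorphic_imp_continuous_map[OF k] that by (auto simp: continuous_map_def)
    then show "k x i \<in> {0..1}" "f i (k x (Suc i)) = k x i"
      by (auto simp: interval_inverse_limit_def PiE_iff)
  qed
  show ?thesis
  proof (rule that[of n u])
    show "continuous_map K unit_interval (u i)" for i
    proof -
      have "continuous_map K unit_interval (\<lambda>x. k x i)"
        using kc by (simp add: continuous_map_componentwise_UNIV)
      from continuous_map_compose[OF this homeomorphic_imp_continuous_map[OF np(2)[of i]]]
      show ?thesis by (simp add: u_def[abs_def] o_def)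
    qed
    show "tri (real (n i) * u (Suc i) x) = u i x" if "x \<in> topspace K" for i x
      using np(3)[of "k x (Suc i)" i] kx[OF that] unfolding u_def by simp
    show "x = y" if "x \<in> topspace K" "y \<in> topspace K" "\<And>i. u i x = u i y" for x y
    proof -
      have "k x i = k y i" for i
        using homeomorphic_imp_injective_map[OF np(2)[of i]] kx(1)[OF that(1), of i] kx(1)[OF that(2), of i] that(3)[of i]
        by (auto simp: u_def inj_on_def)
      then have "k x = k y" by (rule ext)
      then show ?thesis using homeomorphic_imp_injective_map[OF k] that(1,2) by (auto simp: inj_on_def)
    qed
  qed (rule np)
qed

section \<open>Laps and distances along a composant\<close>

definition thread :: "(nat \<Rightarrow> nat) \<Rightarrow> (nat \<Rightarrow> real) \<Rightarrow> bool" where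
  "thread n U \<longleftrightarrow> (\<forall>i. 0 \<le> U i \<and> U i \<le> 1 \<and> tri (real (n i) * U (Suc i)) = U i)"

definition laps :: "(nat \<Rightarrow> nat) \<Rightarrow> nat \<Rightarrow> nat \<Rightarrow> nat" where
  "laps n i j = (\<Prod>r\<in>{i..<j}. n r)"

text \<open>
  A difference at level \<open>j\<close> is measured in units of level \<open>0\<close>. For two points on a common arc this is
  eventually the length of the arc between them, so it is bounded exactly within composants.
\<close>
definition close :: "(nat \<Rightarrow> nat) \<Rightarrow> (nat \<Rightarrow> real) \<Rightarrow> (nat \<Rightarrow> real) \<Rightarrow> bool" where
  "close n U V \<longleftrightarrow> (\<exists>B. \<forall>j. real (laps n 0 j) * \<bar>U j - V j\<bar> \<le> B)"

lemma laps_Suc: "i \<le> j \<Longrightarrow> laps n i (Suc j) = laps n i j * n j"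
  by (simp add: laps_def mult.commute)

lemma laps_split: "i \<le> j \<Longrightarrow> j \<le> k \<Longrightarrow> laps n i k = laps n i j * laps n j k"
  by (simp add: laps_def prod.atLeastLessThan_concat)

lemma laps_pos: "(\<And>i. 2 \<le> n i) \<Longrightarrow> 0 < laps n i j"
  unfolding laps_def by (intro prod_pos) (metis less_le_trans zero_less_numeral)

lemma laps_ge: assumes "\<And>i. 2 \<le> n i" shows "2 ^ (j - i) \<le> laps n i j"
proof -
  have "(\<Prod>r\<in>{i..<j}. 2) \<le> laps n i j" unfolding laps_def using assms by (intro prod_mono) auto
  then show ?thesis by simp
qed

lemma threadD: "thread n U \<Longrightarrow> 0 \<le> U i" "thread n U \<Longrightarrow> U i \<le> 1" "thread n U \<Longrightarrow> tri (real (n i) * U (Suc i)) = U i"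
  by (auto simp: thread_def)

lemma thread_laps: assumes "thread n U" "i \<le> j" shows "tri (real (laps n i j) * U j) = U i"
  using assms(2)
proof (induction j rule: dec_induct)
  case base
  then show ?case using threadD[OF assms(1)] tri_id by (simp add: laps_def)
next
  case (step j)
  have "tri (real (laps n i j) * (real (n j) * U (Suc j))) = tri (real (laps n i j) * tri (real (n j) * U (Suc j)))"
    by (simp add: tri_mult)
  then show ?case using step threadD(3)[OF assms(1), of j] by (simp add: laps_Suc mult.assoc)
qed

text \<open>
  The rescaled distance can only grow with the level, because tent maps with \<open>n\<close> laps are
  \<open>n\<close>-Lipschitz.
\<close>
lemma thread_gap_mono:
  assumes "thread n U" "thread n V" "i \<le> j"
  shows "\<bar>U i - V i\<bar> \<le> real (laps n i j) * \<bar>U j - V j\<bar>"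
proof -
  have "\<bar>U i - V i\<bar> \<le> \<bar>real (laps n i j) * U j - real (laps n i j) * V j\<bar>"
    using tri_lipschitz thread_laps[OF assms(1,3)] thread_laps[OF assms(2,3)] by metis
  also have "\<dots> = real (laps n i j) * \<bar>U j - V j\<bar>"
    by (simp add: abs_mult flip: right_diff_distrib)
  finally show ?thesis .
qed

lemma close_sym: "close n U V \<Longrightarrow> close n V U"
  by (simp add: close_def abs_minus_commute)

lemma close_trans:
  assumes "close n U V" "close n V W" shows "close n U W"
proof -
  obtain B C where BC: "\<And>j. real (laps n 0 j) * \<bar>U j - V j\<bar> \<le> B" "\<And>j. real (laps n 0 j) * \<bar>V j - W j\<bar> \<le> C"
    using assms unfolding close_def by blast
  have "real (laps n 0 j) * \<bar>U j - W j\<bar> \<le> B + C" for j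
  proof -
    have "real (laps n 0 j) * \<bar>U j - W j\<bar> \<le> real (laps n 0 j) * (\<bar>U j - V j\<bar> + \<bar>V j - W j\<bar>)"
      by (intro mult_left_mono) auto
    then show ?thesis using BC[of j] by (simp add: distrib_left)
  qed
  then show ?thesis unfolding close_def by blast
qed

lemma not_close_far:
  assumes n: "\<And>i. 2 \<le> n i" and UV: "thread n U" "thread n V" "\<not> close n U V"
  obtains J where "i \<le> J" "\<And>j. J \<le> j \<Longrightarrow> C < real (laps n i j) * \<bar>U j - V j\<bar>"
proof -
  obtain k where k: "C * real (laps n 0 i) < real (laps n 0 k) * \<bar>U k - V k\<bar>"
    using UV(3) unfolding close_def by (meson not_less)
  have "C < real (laps n i j) * \<bar>U j - V j\<bar>" if j: "max i k \<le> j" for j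
  proof -
    have "real (laps n 0 k) * \<bar>U k - V k\<bar> \<le> real (laps n 0 k) * (real (laps n k j) * \<bar>U j - V j\<bar>)"
      using thread_gap_mono[OF UV(1,2), of k j] j by (intro mult_left_mono) auto
    also have "\<dots> = real (laps n 0 i) * (real (laps n i j) * \<bar>U j - V j\<bar>)"
      using laps_split[of 0 k j n] laps_split[of 0 i j n] j by (simp flip: mult.assoc of_nat_mult)
    finally have "real (laps n 0 i) * C < real (laps n 0 i) * (real (laps n i j) * \<bar>U j - V j\<bar>)"
      using k by (simp add: mult.commute)
    then show ?thesis using laps_pos[of n 0 i] n by (simp add: mult_less_cancel_left)
  qed
  then show ?thesis using that[of "max i k"] by simp
qed

text \<open>
  The point \<open>w\<close> lies in lap \<open>l\<close> of the tent map with \<open>N\<close> laps, which sends it to \<open>v\<close>. Even laps are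
  increasing and odd laps decreasing.
\<close>
definition on_lap :: "nat \<Rightarrow> nat \<Rightarrow> real \<Rightarrow> real \<Rightarrow> bool" where
  "on_lap N l v w \<longleftrightarrow> l < N \<and> real N * w = real l + (if even l then v else 1 - v)"

lemma on_lap_exists:
  assumes "1 \<le> N" "0 \<le> w" "w \<le> 1" "tri (real N * w) = v" shows "\<exists>l. on_lap N l v w"
proof (cases "w = 1")
  case True
  have "real (N - 1) \<le> real N * w" "real N * w \<le> real (N - 1) + 1" using True assms by auto
  note tri_lap[OF this]
  then have "on_lap N (N - 1) v w" using assms by (auto simp: on_lap_def)
  then show ?thesis by blast
next
  case False
  define l where "l = nat \<lfloor>real N * w\<rfloor>"
  have 0: "0 \<le> real N * w" using assms by simp
  have l: "real l \<le> real N * w" "real N * w \<le> real l + 1" unfolding l_def using 0 by linarith+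
  have "real N * w < real N * 1" using False assms by (intro mult_strict_left_mono) auto
  then have "l < N" using l by linarith
  then have "on_lap N l v w" using tri_lap[OF l] assms(4) by (auto simp: on_lap_def)
  then show ?thesis by blast
qed

lemma on_lap_near:
  assumes "on_lap N l v w" "0 \<le> v" "v \<le> 1" shows "real l \<le> real N * w" "real N * w \<le> real l + 1"
  using assms by (auto simp: on_lap_def)

text \<open>
  A lap of a composite of tent maps is increasing exactly if it passes an even number of decreasing
  laps, which is the parity of the sum of the single laps.
\<close>
lemma on_lap_block:
  assumes n: "\<And>i. 2 \<le> n i" and g: "\<And>r. on_lap (n r) (g r) (U r) (U (Suc r))" and ij: "i \<le> j"
  shows "\<exists>k. on_lap (laps n i j) k (U i) (U j) \<and> (even k \<longleftrightarrow> even (\<Sum>r\<in>{i..<j}. g r))"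
  using ij
proof (induction j rule: dec_induct)
  case base
  then show ?case by (intro exI[of _ 0]) (simp add: on_lap_def laps_def)
next
  case (step j)
  then obtain k where k: "on_lap (laps n i j) k (U i) (U j)" "even k \<longleftrightarrow> even (\<Sum>r\<in>{i..<j}. g r)" by blast
  define L where "L = laps n i j"
  have kL: "k < L" "real L * U j = real k + (if even k then U i else 1 - U i)" using k(1) by (auto simp: on_lap_def L_def)
  have gl: "g j < n j" "real (n j) * U (Suc j) = real (g j) + (if even (g j) then U j else 1 - U j)"
    using g[of j] by (auto simp: on_lap_def)
  have tot: "real (L * n j) * U (Suc j) = real L * (real (g j) + (if even (g j) then U j else 1 - U j))"
    using gl(2) by (simp add: mult.assoc)
  have le: "L * g j + L \<le> L * n j" using gl(1) by (metis Suc_leI mult_Suc_right mult_le_mono2 add.commute)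
  have sum: "(\<Sum>r\<in>{i..<Suc j}. g r) = (\<Sum>r\<in>{i..<j}. g r) + g j" using step by simp
  show ?case
  proof (cases "even (g j)")
    case True
    then have "real (L * n j) * U (Suc j) = real (L * g j + k) + (if even k then U i else 1 - U i)"
      using tot kL(2) by (simp add: distrib_left)
    then have "on_lap (laps n i (Suc j)) (L * g j + k) (U i) (U (Suc j))"
      using True kL(1) le step by (simp add: on_lap_def laps_Suc L_def)
    moreover have "even (L * g j + k) \<longleftrightarrow> even (\<Sum>r\<in>{i..<Suc j}. g r)" using True k(2) sum by simp
    ultimately show ?thesis by blast
  next
    case False
    \<comment> \<open>On a decreasing lap, the laps of the block are passed in reverse order.\<close>
    define k' where "k' = L * g j + L - 1 - k"
    have k': "real k' = real L * real (g j) + real L - 1 - real k" "k' < L * n j"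
      using kL(1) le by (auto simp: k'_def of_nat_diff)
    have "k' + k + 1 = L * (g j + 1)" using kL(1) by (simp add: k'_def)
    then have par: "even k' \<longleftrightarrow> odd k" using False by (metis even_add even_mult_iff odd_one)
    have "real (L * n j) * U (Suc j) = real L * real (g j) + real L - real L * U j"
      using False tot by (simp add: algebra_simps)
    then have "real (L * n j) * U (Suc j) = real k' + (if even k' then U i else 1 - U i)"
      using kL(2) k'(1) par by auto
    then have "on_lap (laps n i (Suc j)) k' (U i) (U (Suc j))"
      using k'(2) step by (simp add: on_lap_def laps_Suc L_def)
    moreover have "even k' \<longleftrightarrow> even (\<Sum>r\<in>{i..<Suc j}. g r)" using False par k(2) sum by simp
    ultimately show ?thesis by blast
  qed
qed

text \<open>
  Suppose that the laps of \<open>U\<close> and \<open>V\<close> differ at level \<open>j\<close>. Then \<open>U (Suc j)\<close> is close to an interior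
  turning point, and \<open>U i\<close> is close to an end point of \<open>[0,1]\<close> for all \<open>i \<le> j\<close>. If they differed again
  above \<open>j\<close>, then \<open>U (Suc j)\<close> would be close to an end point and an interior turning point at once,
  which is impossible at high levels.
\<close>
lemma close_codes_agree:
  assumes n: "\<And>i. 2 \<le> n i" and UV: "thread n U" "thread n V" "close n U V"
    and g: "\<And>m. on_lap (n m) (g m) (U m) (U (Suc m))" and h: "\<And>m. on_lap (n m) (h m) (V m) (V (Suc m))"
  shows "\<exists>m0. \<forall>m\<ge>m0. g m = h m"
proof -
  obtain B where B: "\<And>j. real (laps n 0 j) * \<bar>U j - V j\<bar> \<le> B" using UV(3) unfolding close_def by blast
  define L where "L j = real (laps n 0 j)" for j
  have Lpos: "0 < L j" for j using laps_pos[OF n] by (simp add: L_def)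
  have near_turn: "\<exists>c\<in>{1..<n j}. \<bar>real (n j) * U (Suc j) - real c\<bar> * L j \<le> B" if "g j \<noteq> h j" for j
  proof -
    note gj = on_lap_near[OF g threadD(1,2)[OF UV(1)], of j]
    note hj = on_lap_near[OF h threadD(1,2)[OF UV(2)], of j]
    \<comment> \<open>The integer \<open>c\<close> lies between the two rescaled coordinates.\<close>
  define c where "c = max (g j) (h j)"
    have c: "c \<in> {1..<n j}" using that g[of j] h[of j] by (auto simp: c_def on_lap_def)
    have "\<bar>real (n j) * U (Suc j) - real c\<bar> \<le> \<bar>real (n j) * U (Suc j) - real (n j) * V (Suc j)\<bar>"
    proof (cases "g j < h j")
      case True
      then have "real (g j) + 1 \<le> real (h j)" by simp
      then show ?thesis using gj hj True by (simp add: c_def)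
    next
      case False
      then have "real (h j) + 1 \<le> real (g j)" using that by simp
      then show ?thesis using gj hj False by (simp add: c_def)
    qed
    also have "\<dots> = real (n j) * \<bar>U (Suc j) - V (Suc j)\<bar>" by (simp add: abs_mult flip: right_diff_distrib)
    finally have "\<bar>real (n j) * U (Suc j) - real c\<bar> * L j \<le> real (n j) * \<bar>U (Suc j) - V (Suc j)\<bar> * L j"
      using Lpos[of j] by (intro mult_right_mono) auto
    also have "\<dots> = real (laps n 0 (Suc j)) * \<bar>U (Suc j) - V (Suc j)\<bar>"
      by (simp add: laps_Suc L_def mult.assoc mult.commute mult.left_commute)
    also have "\<dots> \<le> B" by (rule B)
    finally show ?thesis using c by blast
  qed
  have near_end: "\<exists>e\<in>{0, 1}. \<bar>U i - e\<bar> * L i \<le> B" if ne: "g j \<noteq> h j" and ij: "i \<le> j" for i j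
  proof -
    obtain c where c: "\<bar>real (n j) * U (Suc j) - real c\<bar> * L j \<le> B" using near_turn[OF ne] by blast
    define e where "e = tri (real (laps n i j) * tri (real c))"
    have e: "e = tri (real (laps n i j * c))" by (simp add: e_def tri_mult)
    have "\<bar>U i - e\<bar> \<le> \<bar>real (laps n i j) * U j - real (laps n i j) * tri (real c)\<bar>"
      using tri_lipschitz thread_laps[OF UV(1) ij] e_def by metis
    also have "\<dots> = real (laps n i j) * \<bar>U j - tri (real c)\<bar>" by (simp add: abs_mult flip: right_diff_distrib)
    also have "\<dots> \<le> real (laps n i j) * \<bar>real (n j) * U (Suc j) - real c\<bar>"
      using tri_lipschitz[of "real (n j) * U (Suc j)" "real c"] threadD(3)[OF UV(1), of j]
      by (intro mult_left_mono) auto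
    finally have "\<bar>U i - e\<bar> * L i \<le> real (laps n i j) * \<bar>real (n j) * U (Suc j) - real c\<bar> * L i"
      using Lpos[of i] by (intro mult_right_mono) auto
    also have "\<dots> = \<bar>real (n j) * U (Suc j) - real c\<bar> * L j"
      using laps_split[of 0 i j n] ij by (simp add: L_def mult.commute mult.left_commute)
    finally have "\<bar>U i - e\<bar> * L i \<le> B" using c by linarith
    then show ?thesis using e tri_int by metis
  qed
  obtain k where k: "2 * B < 2 ^ k" using real_arch_pow[of 2 "2 * B"] by auto
  have big: "2 * B < L j" if "k \<le> j" for j
  proof -
    have "(2::nat) ^ k \<le> 2 ^ j" using that by simp
    also have "\<dots> \<le> laps n 0 j" using laps_ge[OF n, where i = 0 and j = j] by simp
    finally have "(2::real) ^ k \<le> L j" unfolding L_def by (metis of_nat_le_iff of_nat_numeral of_nat_power)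
    then show ?thesis using k by linarith
  qed
  have once: "g j' = h j'" if j: "k \<le> j" "g j \<noteq> h j" "j < j'" for j j'
  proof (rule ccontr)
    assume "g j' \<noteq> h j'"
    from near_end[OF this Suc_leI[OF j(3)]]
    obtain e where e: "e \<in> {0, 1}" "\<bar>U (Suc j) - e\<bar> * L (Suc j) \<le> B" by blast
    obtain c where c: "c \<in> {1..<n j}" "\<bar>real (n j) * U (Suc j) - real c\<bar> * L j \<le> B" using near_turn[OF j(2)] by blast
    have "\<bar>real (n j) * U (Suc j) - real (n j) * e\<bar> = real (n j) * \<bar>U (Suc j) - e\<bar>"
      by (simp add: abs_mult flip: right_diff_distrib)
    then have "\<bar>real (n j) * U (Suc j) - real (n j) * e\<bar> * L j = \<bar>U (Suc j) - e\<bar> * L (Suc j)"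
      by (simp add: laps_Suc L_def mult.commute mult.left_commute)
    then have "(\<bar>real (n j) * U (Suc j) - real (n j) * e\<bar> + \<bar>real (n j) * U (Suc j) - real c\<bar>) * L j \<le> 2 * B"
      using e c by (simp add: distrib_right)
    moreover have "1 \<le> \<bar>real (n j) * U (Suc j) - real (n j) * e\<bar> + \<bar>real (n j) * U (Suc j) - real c\<bar>"
    proof -
      have "1 \<le> \<bar>real c - real (n j) * e\<bar>" using e(1) c(1) by auto
      then show ?thesis by linarith
    qed
    then have "1 * L j \<le> (\<bar>real (n j) * U (Suc j) - real (n j) * e\<bar> + \<bar>real (n j) * U (Suc j) - real c\<bar>) * L j"
      using Lpos[of j] by (intro mult_right_mono) auto
    ultimately show False using big[OF j(1)] by linarith
  qed
  show ?thesis
  proof (cases "\<exists>j\<ge>k. g j \<noteq> h j")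
    case True
    then obtain j where "k \<le> j" "g j \<noteq> h j" by blast
    then show ?thesis using once[of j] by (intro exI[of _ "Suc j"]) auto
  qed (auto intro: exI[of _ k])
qed

section \<open>Choosing blocks of bonding maps\<close>

text \<open>
  Nested infinite sets of levels make the parity of the laps of \<open>x s\<close> constant along the chosen
  levels beyond \<open>s\<close>; within them, the next level is taken so high that threads which are not close are
  far apart.
\<close>
lemma block_choice:
  fixes x :: "nat \<Rightarrow> nat \<Rightarrow> real" and g :: "nat \<Rightarrow> nat \<Rightarrow> nat" and C :: "nat \<Rightarrow> real"
  assumes n: "\<And>i. 2 \<le> n i" and x: "\<And>s. thread n (x s)"
  obtains i where "i 0 = 0" "strict_mono i"
    "\<And>m s. s < m \<Longrightarrow> even (\<Sum>r<i m. g s r) \<longleftrightarrow> even (\<Sum>r<i (Suc m). g s r)"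
    "\<And>m s t. s \<le> Suc m \<Longrightarrow> t \<le> Suc m \<Longrightarrow> \<not> close n (x s) (x t) \<Longrightarrow>
       C m \<le> real (laps n (i m) (i (Suc m))) * \<bar>x s (i (Suc m)) - x t (i (Suc m))\<bar>"
proof -
  define par where "par s i = even (\<Sum>r<i. g s r)" for s i
  \<comment> \<open>All levels in \<open>A (Suc s)\<close> have the same parity for \<open>x s\<close>.\<close>
  define A where "A = rec_nat UNIV (\<lambda>s A. if infinite {i \<in> A. par s i} then {i \<in> A. par s i} else {i \<in> A. \<not> par s i})"
  have A0: "A 0 = UNIV" and AS: "A (Suc s) = (if infinite {i \<in> A s. par s i} then {i \<in> A s. par s i} else {i \<in> A s. \<not> par s i})" for s
    by (auto simp: A_def)
  have inf: "infinite (A s)" for s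
  proof (induction s)
    case (Suc s)
    have split: "A s = {i \<in> A s. par s i} \<union> {i \<in> A s. \<not> par s i}" by blast
    show ?case
    proof (cases "infinite {i \<in> A s. par s i}")
      case True
      then show ?thesis unfolding AS by simp
    next
      case False
      then have "infinite {i \<in> A s. \<not> par s i}" using Suc split by (metis finite_UnI)
      then show ?thesis using False unfolding AS by simp
    qed
  qed (simp add: A0)
  have anti: "A t \<subseteq> A s" if "s \<le> t" for s t
    using that
  proof (induction t rule: dec_induct)
    case (step t)
    have "A (Suc t) \<subseteq> A t" unfolding AS by (cases "infinite {i \<in> A t. par t i}") auto
    then show ?case using step.IH by blast
  qed simp
  have const: "par s i = par s j" if "i \<in> A (Suc s)" "j \<in> A (Suc s)" for s i j
    using that unfolding AS by (cases "infinite {i \<in> A s. par s i}") auto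
  have "\<exists>i. \<forall>m. (i m \<in> A m \<and> (m = 0 \<longrightarrow> i m = 0)) \<and> (i m < i (Suc m) \<and>
      (\<forall>s t. s \<le> Suc m \<and> t \<le> Suc m \<and> \<not> close n (x s) (x t) \<longrightarrow>
        C m \<le> real (laps n (i m) (i (Suc m))) * \<bar>x s (i (Suc m)) - x t (i (Suc m))\<bar>))"
  proof (rule dependent_nat_choice)
    show "\<exists>i. i \<in> A 0 \<and> (0 = (0::nat) \<longrightarrow> i = 0)" by (simp add: A0)
  next
    fix i m assume "i \<in> A m \<and> (m = 0 \<longrightarrow> i = 0)"
    have "\<exists>J. \<forall>j\<ge>J. \<not> close n (x (fst p)) (x (snd p)) \<longrightarrow> C m \<le> real (laps n i j) * \<bar>x (fst p) j - x (snd p) j\<bar>" for p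
    proof (cases "close n (x (fst p)) (x (snd p))")
      case False
      then show ?thesis using not_close_far[OF n x x False, of i "C m"] by (metis less_imp_le)
    qed simp
    then obtain J where J: "\<And>p j. J p \<le> j \<Longrightarrow> \<not> close n (x (fst p)) (x (snd p)) \<Longrightarrow>
        C m \<le> real (laps n i j) * \<bar>x (fst p) j - x (snd p) j\<bar>" by metis
    \<comment> \<open>a bound beyond which all pairs that matter at step \<open>m\<close> are far apart\<close>
    define M where "M = Max (insert i (J ` ({..Suc m} \<times> {..Suc m})))"
    obtain j where j: "j \<in> A (Suc m)" "M < j" using inf[of "Suc m"] by (meson infinite_nat_iff_unbounded)
    have iM: "i \<le> M" unfolding M_def by (intro Max_ge) auto
    have JM: "J (s, t) \<le> M" if "s \<le> Suc m" "t \<le> Suc m" for s t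
      unfolding M_def using that by (intro Max_ge) auto
    have spread: "C m \<le> real (laps n i j) * \<bar>x s j - x t j\<bar>"
      if "s \<le> Suc m" "t \<le> Suc m" "\<not> close n (x s) (x t)" for s t
      using J[of "(s, t)" j] JM[OF that(1,2)] j(2) that(3) by simp
    have "i < j" using iM j(2) by linarith
    then show "\<exists>j. (j \<in> A (Suc m) \<and> (Suc m = 0 \<longrightarrow> j = 0)) \<and> i < j \<and>
      (\<forall>s t. s \<le> Suc m \<and> t \<le> Suc m \<and> \<not> close n (x s) (x t) \<longrightarrow>
        C m \<le> real (laps n i j) * \<bar>x s j - x t j\<bar>)"
      using j(1) spread by (intro exI[of _ j] conjI allI impI) blast+
  qed
  then obtain i where i: "\<And>m. i m \<in> A m" "i 0 = 0" "\<And>m. i m < i (Suc m)"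
    "\<And>m s t. s \<le> Suc m \<Longrightarrow> t \<le> Suc m \<Longrightarrow> \<not> close n (x s) (x t) \<Longrightarrow>
        C m \<le> real (laps n (i m) (i (Suc m))) * \<bar>x s (i (Suc m)) - x t (i (Suc m))\<bar>" by blast
  have par: "even (\<Sum>r<i m. g s r) \<longleftrightarrow> even (\<Sum>r<i (Suc m). g s r)" if "s < m" for s m
  proof -
    have "i m \<in> A (Suc s)" using anti[of "Suc s" m] i(1)[of m] that by auto
    moreover have "i (Suc m) \<in> A (Suc s)" using anti[of "Suc s" "Suc m"] i(1)[of "Suc m"] that by auto
    ultimately have "par s (i m) = par s (i (Suc m))" by (rule const)
    then show ?thesis unfolding par_def .
  qed
  show ?thesis
  proof (rule that[of i])
    show "strict_mono i" using i(3) by (simp add: strict_mono_Suc_iff)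
  qed (fact i(2) par i(4))+
qed

section \<open>One level: strands in a star\<close>

text \<open>
  Inside a star with legs \<open>0, \<dots>, R\<close>, the strands \<open>0, \<dots>, R'\<close> are drawn; each consists of \<open>N\<close> laps, which
  run alternately outward (even laps) and inward along the legs. For \<open>s \<in> S\<close>, strand \<open>s\<close> is to be
  exposed from below in leg \<open>s\<close> on its lap \<open>a s\<close>. The distances of \<open>4 * R + 4\<close> leave time to walk
  from leg \<open>0\<close> to leg \<open>s\<close> and back, which takes \<open>2 * s\<close> laps each way.
\<close>
locale strand_level =
  fixes N R R' :: nat and S :: "nat set" and a :: "nat \<Rightarrow> nat"
  assumes R_pos: "1 \<le> R" and R_le: "R \<le> R'" and N_ge: "2 \<le> N"
    and S_sub: "s \<in> S \<Longrightarrow> 1 \<le> s \<and> s \<le> R"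
    and a_less: "s \<in> S \<Longrightarrow> a s < N"
    and a_even: "s \<in> S \<Longrightarrow> even (a s)"
    and a_ge: "s \<in> S \<Longrightarrow> 4 * R + 4 \<le> a s"
    and a_sep: "s \<in> S \<Longrightarrow> t \<in> S \<Longrightarrow> s \<noteq> t \<Longrightarrow> 4 * R + 4 + a s \<le> a t \<or> 4 * R + 4 + a t \<le> a s"
begin

text \<open>
  The laps from \<open>a s - 2 * s + 1\<close> to \<open>a s + 2 * s\<close>, on which strand \<open>s\<close> leaves its base.
\<close>
definition on_finger :: "nat \<Rightarrow> nat \<Rightarrow> bool" where
  "on_finger s l \<longleftrightarrow> s \<in> S \<and> a s < l + 2 * s \<and> l \<le> a s + 2 * s"

text \<open>
  How far along the lanes the common walk is, counted from the tip of leg \<open>0\<close>: depth \<open>0\<close> is leg \<open>0\<close>, and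
  the depths \<open>2 * p - 1\<close> and \<open>2 * p\<close> are the two sides of leg \<open>p\<close>. The walk starts at the end of the
  lanes, goes down to depth \<open>0\<close>, and stays there except for one excursion per target.
\<close>
definition depth :: "nat \<Rightarrow> nat" where
  "depth l =
     (if l \<le> 2 * R then 2 * R - l
      else if \<exists>s. on_finger s l then
        (let s = (THE s. on_finger s l) in if l \<le> a s then l + 2 * s - 1 - a s else a s + 2 * s - l)
      else 0)"

definition leg :: "nat \<Rightarrow> nat" where
  "leg l = (depth l + 1) div 2"

definition width :: int where
  "width = 2 * (int R' + 1) * int N"

definition lane :: "nat \<Rightarrow> nat \<Rightarrow> int" where
  "lane s l = int s * int N + int l"

text \<open>
  The distance of a lap from the middle line of its leg. The lanes of the bases are stacked around that
  line in increasing order; those of the fingers follow further outside in decreasing order, since they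
  arise from the bases by folding at the tip of leg \<open>0\<close>.
\<close>
definition offset :: "nat \<Rightarrow> nat \<Rightarrow> int" where
  "offset s l = (if on_finger s l then width - lane s l else lane s l)"

text \<open>
  The vertical position of a lap: even depths lie above the middle line of the leg and odd depths
  below.
\<close>
definition rank :: "nat \<Rightarrow> nat \<Rightarrow> int" where
  "rank s l = (2 * width + 1) * int (leg l) + (if even (depth l) then offset s l else - offset s l)"

lemma finger_unique: "on_finger s l \<Longrightarrow> on_finger t l \<Longrightarrow> s = t"
  using a_sep[of s t] S_sub[of s] S_sub[of t] unfolding on_finger_def by fastforce

lemma finger_late: "on_finger s l \<Longrightarrow> 2 * R + 3 \<le> l"
  using a_ge[of s] S_sub[of s] unfolding on_finger_def by fastforce

lemma depth_start: "l \<le> 2 * R \<Longrightarrow> depth l = 2 * R - l"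
  by (simp add: depth_def)

lemma depth_finger:
  assumes "on_finger s l"
  shows "depth l = (if l \<le> a s then l + 2 * s - 1 - a s else a s + 2 * s - l)"
proof -
  have "(THE s. on_finger s l) = s" using assms finger_unique by blast
  then show ?thesis using assms finger_late[OF assms] by (auto simp: depth_def)
qed

lemma depth_idle: "2 * R < l \<Longrightarrow> (\<And>s. \<not> on_finger s l) \<Longrightarrow> depth l = 0"
  by (simp add: depth_def)

lemma depth_le: "depth l \<le> 2 * R"
proof (cases "\<exists>s. on_finger s l")
  case True
  then obtain s where s: "on_finger s l" by blast
  then show ?thesis using depth_finger[OF s] S_sub[of s] unfolding on_finger_def by auto
next
  case False
  then show ?thesis using depth_start[of l] depth_idle[of l] by (cases "l \<le> 2 * R") auto
qed

lemma depth_eq_max: "depth l = 2 * R \<longleftrightarrow> l = 0"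
proof (cases "\<exists>s. on_finger s l")
  case True
  then obtain s where s: "on_finger s l" by blast
  have "depth l < 2 * R" using depth_finger[OF s] S_sub[of s] s unfolding on_finger_def by auto
  moreover have "l \<noteq> 0" using finger_late[OF s] by simp
  ultimately show ?thesis by simp
next
  case False
  then show ?thesis using depth_start[of l] depth_idle[of l] R_pos by (cases "l \<le> 2 * R") auto
qed

lemma leg_le: "leg l \<le> R"
  using depth_le[of l] unfolding leg_def by simp

text \<open>
  All ways in which the walk passes from a lap to the next one. Base and finger are exchanged only at
  the tip of leg \<open>0\<close>, after an even lap.
\<close>
lemma consecutive_laps_cases:
  obtains
    (start) "depth l = Suc (depth (Suc l))" "even (depth l) \<longleftrightarrow> even l"
        "\<And>s. \<not> on_finger s l" "\<And>s. \<not> on_finger s (Suc l)"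
  | (idle) "depth l = 0" "depth (Suc l) = 0" "\<And>s. \<not> on_finger s l" "\<And>s. \<not> on_finger s (Suc l)"
  | (enter) t where "depth l = 0" "depth (Suc l) = 0" "\<And>s. \<not> on_finger s l"
      "\<And>s. on_finger s (Suc l) \<longleftrightarrow> s = t" "even l"
  | (leave) t where "depth l = 0" "depth (Suc l) = 0" "\<And>s. on_finger s l \<longleftrightarrow> s = t"
      "\<And>s. \<not> on_finger s (Suc l)" "even l"
  | (outward) t where "depth (Suc l) = Suc (depth l)" "even (depth l) \<longleftrightarrow> odd l"
      "\<And>s. on_finger s l \<longleftrightarrow> s = t" "\<And>s. on_finger s (Suc l) \<longleftrightarrow> s = t"
  | (turn) t where "depth (Suc l) = depth l" "even l"
      "\<And>s. on_finger s l \<longleftrightarrow> s = t" "\<And>s. on_finger s (Suc l) \<longleftrightarrow> s = t"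
  | (inward) t where "depth l = Suc (depth (Suc l))" "even (depth l) \<longleftrightarrow> even l"
      "\<And>s. on_finger s l \<longleftrightarrow> s = t" "\<And>s. on_finger s (Suc l) \<longleftrightarrow> s = t"
proof (cases "\<exists>s. on_finger s l")
  case True
  then obtain t where t: "on_finger t l" by blast
  have ut: "on_finger s l \<longleftrightarrow> s = t" for s using t finger_unique by blast
  have tS: "t \<in> S" "even (a t)" "1 \<le> t" using t a_even S_sub[of t] unfolding on_finger_def by auto
  show ?thesis
  proof (cases "on_finger t (Suc l)")
    case True
    have us: "on_finger s (Suc l) \<longleftrightarrow> s = t" for s using True finger_unique by blast
    note d = depth_finger[OF t] depth_finger[OF True]
    have w: "a t < l + 2 * t" "Suc l \<le> a t + 2 * t" using t True unfolding on_finger_def by auto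
    consider "l < a t" | "l = a t" | "a t < l" by linarith
    then show ?thesis
    proof cases
      case 1
      then have "depth l = l + 2 * t - 1 - a t" "depth (Suc l) = Suc (depth l)" using d w by auto
      moreover have "even (l + 2 * t - 1 - a t) \<longleftrightarrow> odd l"
        using w tS by (auto simp: even_diff_nat)
      ultimately show ?thesis using outward ut us by metis
    next
      case 2
      then have "depth (Suc l) = depth l" using d w tS by auto
      then show ?thesis using turn ut us 2 tS by metis
    next
      case 3
      then have "depth l = a t + 2 * t - l" "depth l = Suc (depth (Suc l))" using d w by auto
      moreover have "even (a t + 2 * t - l) \<longleftrightarrow> even l"
        using w tS by (auto simp: even_diff_nat)
      ultimately show ?thesis using inward ut us by metis
    qed
  next
    case False
    then have l: "l = a t + 2 * t" using t unfolding on_finger_def by auto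
    have n: "\<not> on_finger s (Suc l)" for s
    proof
      assume s: "on_finger s (Suc l)"
      have "s \<noteq> t" using s False by blast
      then show False using a_sep[of s t] S_sub[of s] S_sub[of t] s l tS(1) unfolding on_finger_def by fastforce
    qed
    have "2 * R < Suc l" using finger_late[OF t] by simp
    then have "depth (Suc l) = 0" using depth_idle n by blast
    moreover have "depth l = 0" using depth_finger[OF t] l tS by auto
    moreover have "even l" using l tS by auto
    ultimately show ?thesis using leave ut n by metis
  qed
next
  case False
  then have n: "\<not> on_finger s l" for s by blast
  show ?thesis
  proof (cases "\<exists>s. on_finger s (Suc l)")
    case True
    then obtain t where t: "on_finger t (Suc l)" by blast
    have us: "on_finger s (Suc l) \<longleftrightarrow> s = t" for s using t finger_unique by blast
    have tS: "t \<in> S" "even (a t)" "1 \<le> t" using t a_even S_sub[of t] unfolding on_finger_def by auto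
    have l: "a t = l + 2 * t" using n[of t] t unfolding on_finger_def by auto
    have "2 * R < l" using finger_late[OF t] by simp
    then have "depth l = 0" using depth_idle n by blast
    moreover have "depth (Suc l) = 0" using depth_finger[OF t] l tS by auto
    moreover have "even l" using l tS by auto
    ultimately show ?thesis using enter us n by metis
  next
    case False
    then have n': "\<not> on_finger s (Suc l)" for s by blast
    show ?thesis
    proof (cases "l < 2 * R")
      case True
      then have "depth l = Suc (depth (Suc l))" "even (depth l) \<longleftrightarrow> even l"
        using depth_start[of l] depth_start[of "Suc l"] by (auto simp: even_diff_nat)
      then show ?thesis using start n n' by blast
    next
      case False
      then have "depth l = 0" using depth_idle[of l] depth_start[of l] n by (cases "l = 2 * R") auto
      moreover have "depth (Suc l) = 0" using depth_idle[of "Suc l"] n' False by simp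
      ultimately show ?thesis using idle n n' by metis
    qed
  qed
qed

end

section \<open>Turns do not cross\<close>

lemma adjacent_pairs_ordered:
  fixes u u' w w' :: int
  assumes "\<bar>u' - u\<bar> = 1" "\<bar>w' - w\<bar> = 1" "u \<noteq> w" "u \<noteq> w'" "u' \<noteq> w" "u' \<noteq> w'"
  shows "(u < w \<and> u < w' \<and> u' < w \<and> u' < w') \<or> (w < u \<and> w' < u \<and> w < u' \<and> w' < u')"
  using assms by presburger

lemma nested_arcs_unlinked:
  fixes A B C D P Q x x' y y' :: int
  assumes "(A = P + x \<and> B = Q - x') \<or> (B = P + x \<and> A = Q - x')"
    and "(C = P + y \<and> D = Q - y') \<or> (D = P + y \<and> C = Q - y')"
    and "(x < y \<and> x' < y') \<or> (y < x \<and> y' < x')"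
    and "P + x < Q - y'" "P + y < Q - x'" "P + x < Q - x'" "P + y < Q - y'"
  shows "\<not> (A < C \<and> C < B \<and> B < D)"
  using assms by auto

lemma folded_arcs_unlinked:
  fixes A B C D x y m :: int
  assumes "(A = x \<and> B = m - x - 1) \<or> (B = x \<and> A = m - x - 1) \<or>
           (A = x + 1 \<and> B = m - x) \<or> (B = x + 1 \<and> A = m - x)"
    and "(C = y \<and> D = m - y - 1) \<or> (D = y \<and> C = m - y - 1) \<or>
         (C = y + 1 \<and> D = m - y) \<or> (D = y + 1 \<and> C = m - y)"
    and "x + 1 < y \<or> y + 1 < x" "2 * (x + 1) < m" "2 * (y + 1) < m"
  shows "\<not> (A < C \<and> C < B \<and> B < D)"
  using assms by auto

context strand_level
begin

definition base :: "nat \<Rightarrow> int" where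
  "base p = (2 * width + 1) * int p"

lemma base_Suc: "base (Suc p) = base p + 2 * width + 1"
  by (simp add: base_def algebra_simps)

lemma base_0: "base 0 = 0"
  by (simp add: base_def)

lemma width_nonneg: "0 \<le> width"
  by (simp add: width_def)

lemma base_less:
  assumes "p < q" shows "base p + 2 * width + 1 \<le> base q"
proof -
  have "(2 * width + 1) * int (Suc p) \<le> (2 * width + 1) * int q"
    using assms width_nonneg by (intro mult_left_mono) auto
  then show ?thesis by (simp add: base_def algebra_simps)
qed

lemma rank_base:
  "rank s l = base (leg l) + (if even (depth l) then offset s l else - offset s l)"
  by (simp add: rank_def base_def)

lemma lane_nonneg: "0 \<le> lane s l"
  by (simp add: lane_def)

lemma lane_Suc: "lane s (Suc l) = lane s l + 1"
  by (simp add: lane_def)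

lemma lane_less:
  assumes "s < t" "l < N" shows "lane s l < lane t l'"
proof -
  have "int (Suc s) * int N \<le> int t * int N"
    using assms(1) by (intro mult_right_mono) auto
  then show ?thesis using assms(2) by (simp add: lane_def algebra_simps)
qed

lemma lane_bound:
  assumes "s \<le> R'" "l < N" shows "2 * lane s l < width"
proof -
  have "lane s l < lane (Suc R') 0" using lane_less assms by simp
  then show ?thesis by (simp add: lane_def width_def algebra_simps)
qed

lemma lane_sep:
  assumes "Suc l < N" "Suc l' < N" "even l \<longleftrightarrow> even l'" "(s, l) \<noteq> (t, l')"
  shows "lane s l + 1 < lane t l' \<or> lane t l' + 1 < lane s l"
proof -
  consider "s < t" | "t < s" | "s = t" by linarith
  then show ?thesis
  proof cases
    case 1
    then show ?thesis using lane_less[of s t "Suc l" l'] assms lane_Suc by simp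
  next
    case 2
    then show ?thesis using lane_less[of t s "Suc l'" l] assms lane_Suc by simp
  next
    case 3
    then have "l \<noteq> l'" using assms by simp
    then have "Suc l < l' \<or> Suc l' < l" using assms(3) by presburger
    then show ?thesis using 3 by (auto simp: lane_def)
  qed
qed

lemma offset_bounds:
  assumes "s \<le> R'" "l < N" shows "0 \<le> offset s l" "offset s l \<le> width"
  using lane_bound[OF assms] lane_nonneg[of s l] by (auto simp: offset_def)

lemma lane_inj:
  assumes "l < N" "l' < N" "lane s l = lane t l'" shows "s = t \<and> l = l'"
proof -
  have "s = t" using lane_less[of s t l l'] lane_less[of t s l' l] assms by (metis less_irrefl linorder_neqE_nat)
  then show ?thesis using assms by (simp add: lane_def)
qed

lemma offset_inj:
  assumes "s \<le> R'" "l < N" "t \<le> R'" "l' < N" "offset s l = offset t l'" shows "s = t \<and> l = l'"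
proof -
  have "lane s l = lane t l'"
    using lane_bound[of s l] lane_bound[of t l'] assms by (auto simp: offset_def split: if_splits)
  then show ?thesis using lane_inj assms by blast
qed

lemma offset_turns_disjoint:
  assumes "even l \<longleftrightarrow> even l'" "Suc l < N" "Suc l' < N" "s \<le> R'" "t \<le> R'" "(s, l) \<noteq> (t, l')"
  shows "offset s l \<noteq> offset t l'" "offset s l \<noteq> offset t (Suc l')"
    "offset s (Suc l) \<noteq> offset t l'" "offset s (Suc l) \<noteq> offset t (Suc l')"
proof -
  have l: "l < N" "l' < N" "Suc l \<noteq> l'" "l \<noteq> Suc l'" using assms(1-3) by auto
  show "offset s l \<noteq> offset t l'" using offset_inj[of s l t l'] assms(4-6) l by blast
  show "offset s l \<noteq> offset t (Suc l')" using offset_inj[of s l t "Suc l'"] assms(3-5) l by blast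
  show "offset s (Suc l) \<noteq> offset t l'" using offset_inj[of s "Suc l" t l'] assms(2,4,5) l by blast
  show "offset s (Suc l) \<noteq> offset t (Suc l')"
    using offset_inj[of s "Suc l" t "Suc l'"] assms(2-6) by blast
qed

lemma rank_leg_less:
  assumes "s \<le> R'" "l < N" "t \<le> R'" "l' < N" "leg l < leg l'"
  shows "rank s l < rank t l'"
  using base_less[OF assms(5)] offset_bounds[of s l] offset_bounds[of t l'] assms
  unfolding rank_base by (auto split: if_splits)

lemma offset_zero:
  assumes "s \<le> R'" "l < N" "offset s l = 0" shows "s = 0 \<and> l = 0"
proof -
  have "lane s l = 0" using assms lane_bound[of s l] lane_nonneg[of s l] by (auto simp: offset_def split: if_splits)
  then show ?thesis using N_ge by (simp add: lane_def add_nonneg_eq_0_iff)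
qed

lemma rank_inj:
  assumes "s \<le> R'" "l < N" "t \<le> R'" "l' < N" "rank s l = rank t l'"
  shows "s = t \<and> l = l'"
proof -
  have leg: "leg l = leg l'"
    using rank_leg_less[of s l t l'] rank_leg_less[of t l' s l] assms by (metis less_irrefl linorder_neqE_nat)
  have "offset s l = offset t l'"
  proof (cases "even (depth l) = even (depth l')")
    case True
    then show ?thesis using assms(5) leg unfolding rank_base by (auto split: if_splits)
  next
    case False
    then show ?thesis
      using assms(5) leg offset_bounds[of s l] offset_bounds[of t l'] assms
      unfolding rank_base by (auto split: if_splits)
  qed
  then show ?thesis using offset_inj assms by blast
qed

lemma leg_0: "leg 0 = R"
  using depth_start[of 0] by (simp add: leg_def)

lemma rank_first: "rank s 0 = base R + lane s 0"
  using finger_late[of s 0] depth_start[of 0] by (auto simp: rank_base leg_0 offset_def)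

lemma rank_first_less: "s < t \<Longrightarrow> rank s 0 < rank t 0"
  using lane_less[of s t 0 0] N_ge by (simp add: rank_first)

lemma rank_first_top:
  assumes "t \<le> R'" "l < N" "0 < l" shows "rank t l < rank s 0"
proof (cases "leg l = R")
  case True
  have "depth l \<noteq> 2 * R" using depth_eq_max assms by simp
  then have "odd (depth l)" using True unfolding leg_def by (cases "even (depth l)") (auto elim!: evenE)
  moreover have "0 < offset t l" using offset_zero[of t l] offset_bounds[of t l] assms by fastforce
  ultimately show ?thesis using True lane_nonneg[of s 0] rank_first[of s] by (simp add: rank_base[of t l])
next
  case False
  then have "leg l < R" using leg_le[of l] by simp
  from base_less[OF this] show ?thesis
    using offset_bounds[of t l] assms lane_nonneg[of s 0] rank_first[of s] rank_base[of t l] by (auto split: if_splits)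
qed

lemma leg_outer_turn: "even l \<Longrightarrow> leg (Suc l) = leg l"
  by (cases l rule: consecutive_laps_cases) (auto simp: leg_def)

lemma leg_inner_turn: "odd l \<Longrightarrow> leg (Suc l) \<le> Suc (leg l) \<and> leg l \<le> Suc (leg (Suc l))"
  by (cases l rule: consecutive_laps_cases) (auto simp: leg_def)

lemma offset_Suc:
  "(on_finger s l \<longleftrightarrow> on_finger s (Suc l)) \<Longrightarrow> \<bar>offset s (Suc l) - offset s l\<bar> = 1"
  by (auto simp: offset_def lane_Suc)

lemma finger_inner_turn: "odd l \<Longrightarrow> on_finger s l \<longleftrightarrow> on_finger s (Suc l)"
  by (cases l rule: consecutive_laps_cases) auto

text \<open>
  A turn at the centre of the star either joins neighbouring laps in the same lane or leads from the
  upper side of leg \<open>p\<close> to the lower side of leg \<open>Suc p\<close>. Turns of the second kind are nested around the gap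
  between the two legs.
\<close>
lemma inner_turn_shape:
  assumes "odd l"
  shows "\<bar>rank s (Suc l) - rank s l\<bar> = 1 \<or>
    (\<exists>p. (rank s l = base p + offset s l \<and> rank s (Suc l) = base (Suc p) - offset s (Suc l)) \<or>
         (rank s (Suc l) = base p + offset s (Suc l) \<and> rank s l = base (Suc p) - offset s l))"
proof -
  note o = offset_Suc[OF finger_inner_turn[OF assms, of s]]
  have *: ?thesis if "depth (Suc l) = Suc (depth l)" "even (depth l)"
  proof -
    have "leg (Suc l) = Suc (leg l)" using that by (auto simp: leg_def)
    then have "rank s l = base (leg l) + offset s l \<and> rank s (Suc l) = base (Suc (leg l)) - offset s (Suc l)"
      using that by (simp add: rank_base)
    then show ?thesis by blast
  qed
  have **: ?thesis if "depth l = Suc (depth (Suc l))" "odd (depth l)"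
  proof -
    have "leg l = Suc (leg (Suc l))" using that by (auto simp: leg_def)
    then have "rank s (Suc l) = base (leg (Suc l)) + offset s (Suc l) \<and> rank s l = base (Suc (leg (Suc l))) - offset s l"
      using that by (simp add: rank_base)
    then show ?thesis by blast
  qed
  have ***: ?thesis if "depth l = depth (Suc l)"
    using that o by (auto simp: rank_base leg_def split: if_splits)
  show ?thesis
  proof (cases l rule: consecutive_laps_cases)
    case start
    then show ?thesis using ** assms by blast
  next
    case (outward t)
    then show ?thesis using * assms by blast
  next
    case (inward t)
    then show ?thesis using ** assms by blast
  qed (use *** assms in auto)
qed

text \<open>
  A turn at a tip joins neighbouring laps, goes around the middle line of its leg, or, in leg \<open>0\<close>, goes
  from a base to a finger. In the last case the positions add up to \<open>width\<close> up to \<open>1\<close>, so these turns are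
  nested as well.
\<close>
lemma outer_turn_shape:
  assumes "even l"
  shows "\<bar>rank s (Suc l) - rank s l\<bar> = 1 \<or>
    (1 \<le> leg l \<and> \<bar>offset s (Suc l) - offset s l\<bar> = 1 \<and>
      ((rank s l = base (leg l) - offset s l \<and> rank s (Suc l) = base (leg l) + offset s (Suc l)) \<or>
       (rank s (Suc l) = base (leg l) - offset s (Suc l) \<and> rank s l = base (leg l) + offset s l))) \<or>
    (leg l = 0 \<and> ((rank s l = lane s l \<and> rank s (Suc l) = width - lane s l - 1) \<or>
                   (rank s l = width - lane s l \<and> rank s (Suc l) = lane s l + 1)))"
proof -
  have *: ?thesis if "depth (Suc l) = Suc (depth l)" "odd (depth l)" "on_finger s l \<longleftrightarrow> on_finger s (Suc l)"
    using that offset_Suc[of s l] by (auto simp: rank_base leg_def)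
  have **: ?thesis if "depth l = Suc (depth (Suc l))" "even (depth l)" "on_finger s l \<longleftrightarrow> on_finger s (Suc l)"
    using that offset_Suc[of s l] by (auto simp: rank_base leg_def)
  have ***: ?thesis if "depth l = depth (Suc l)" "on_finger s l \<longleftrightarrow> on_finger s (Suc l)"
    using that offset_Suc[of s l] by (auto simp: rank_base leg_def split: if_splits)
  have ****: ?thesis if "depth l = 0" "depth (Suc l) = 0" "on_finger s l \<noteq> on_finger s (Suc l)"
    using that by (auto simp: rank_base leg_def base_0 offset_def lane_Suc)
  show ?thesis
  proof (cases l rule: consecutive_laps_cases)
    case start
    then show ?thesis using ** assms by auto
  next
    case (outward t)
    then show ?thesis using * assms by blast
  next
    case (inward t)
    then show ?thesis using ** assms by blast
  next
    case (enter t)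
    then show ?thesis using *** **** by metis
  next
    case (leave t)
    then show ?thesis using *** **** by metis
  qed (use *** assms in auto)
qed

lemma inner_turns_unlinked:
  assumes "odd l" "odd l'" "Suc l < N" "Suc l' < N" "s \<le> R'" "t \<le> R'" "(s, l) \<noteq> (t, l')"
    and AB: "(A = rank s l \<and> B = rank s (Suc l)) \<or> (A = rank s (Suc l) \<and> B = rank s l)"
    and CD: "(C = rank t l' \<and> D = rank t (Suc l')) \<or> (C = rank t (Suc l') \<and> D = rank t l')"
  shows "\<not> (A < C \<and> C < B \<and> B < D)"
proof
  assume link: "A < C \<and> C < B \<and> B < D"
  define u where "u = offset s l"
  define u' where "u' = offset s (Suc l)"
  define w where "w = offset t l'"
  define w' where "w' = offset t (Suc l')"
  have bounds: "0 \<le> u" "u \<le> width" "0 \<le> u'" "u' \<le> width" "0 \<le> w" "w \<le> width" "0 \<le> w'" "w' \<le> width"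
    unfolding u_def u'_def w_def w'_def using offset_bounds assms by simp_all
  have adj: "\<bar>u' - u\<bar> = 1" "\<bar>w' - w\<bar> = 1"
    unfolding u_def u'_def w_def w'_def using offset_Suc finger_inner_turn assms by blast+
      have dist: "u \<noteq> w" "u \<noteq> w'" "u' \<noteq> w" "u' \<noteq> w'"
        using offset_turns_disjoint[of l l' s t] assms(1-7) unfolding u_def u'_def w_def w'_def by blast+
  have nadj: "\<bar>rank s (Suc l) - rank s l\<bar> \<noteq> 1" "\<bar>rank t (Suc l') - rank t l'\<bar> \<noteq> 1"
    using AB CD link by auto
  obtain p x x' where p: "x \<in> {u, u'}" "x' \<in> {u, u'}" "x \<noteq> x'"
      "(A = base p + x \<and> B = base (Suc p) - x') \<or> (B = base p + x \<and> A = base (Suc p) - x')"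
    using inner_turn_shape[OF assms(1), of s] nadj AB adj unfolding u_def u'_def by fastforce
  obtain q y y' where q: "y \<in> {w, w'}" "y' \<in> {w, w'}" "y \<noteq> y'"
      "(C = base q + y \<and> D = base (Suc q) - y') \<or> (D = base q + y \<and> C = base (Suc q) - y')"
    using inner_turn_shape[OF assms(2), of t] nadj CD adj unfolding w_def w'_def by fastforce
  have xy: "0 \<le> x" "x \<le> width" "0 \<le> x'" "x' \<le> width" "0 \<le> y" "y \<le> width" "0 \<le> y'" "y' \<le> width"
    using p q bounds by auto
  have sep: "(x < y \<and> x' < y') \<or> (y < x \<and> y' < x')"
    using p(1-3) q(1-3) adjacent_pairs_ordered[OF adj dist] by auto
  have range: "base p \<le> A" "A \<le> base p + 2 * width + 1" "base p \<le> B" "B \<le> base p + 2 * width + 1"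
      "base q \<le> C" "C \<le> base q + 2 * width + 1" "base q \<le> D" "D \<le> base q + 2 * width + 1"
    using p(4) q(4) xy base_Suc[of p] base_Suc[of q] by auto
  consider "p = q" | "p < q" | "q < p" by linarith
  then show False
  proof cases
    case 1
    show ?thesis
      using nested_arcs_unlinked[OF p(4) q(4)[folded 1] sep] base_Suc[of p] xy link by auto
  next
    case 2
    show ?thesis using range link base_less[OF 2] by linarith
  next
    case 3
    show ?thesis using range link base_less[OF 3] by linarith
  qed
qed

lemma outer_turns_unlinked:
  assumes "even l" "even l'" "Suc l < N" "Suc l' < N" "s \<le> R'" "t \<le> R'" "(s, l) \<noteq> (t, l')"
    and AB: "(A = rank s l \<and> B = rank s (Suc l)) \<or> (A = rank s (Suc l) \<and> B = rank s l)"
    and CD: "(C = rank t l' \<and> D = rank t (Suc l')) \<or> (C = rank t (Suc l') \<and> D = rank t l')"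
  shows "\<not> (A < C \<and> C < B \<and> B < D)"
proof
  assume link: "A < C \<and> C < B \<and> B < D"
  have legs: "leg (Suc l) = leg l" "leg (Suc l') = leg l'" using leg_outer_turn assms(1,2) by blast+
  consider "leg l < leg l'" | "leg l' < leg l" | "leg l = leg l'" by linarith
  then show False
  proof cases
    case 1
    have "rank s l < rank t l'" "rank s (Suc l) < rank t l'"
        "rank s l < rank t (Suc l')" "rank s (Suc l) < rank t (Suc l')"
      using 1 rank_leg_less legs assms(3-6) Suc_lessD by metis+
    then show ?thesis using AB CD link by auto
  next
    case 2
    have "rank t l' < rank s l" "rank t l' < rank s (Suc l)"
        "rank t (Suc l') < rank s l" "rank t (Suc l') < rank s (Suc l)"
      using 2 rank_leg_less legs assms(3-6) Suc_lessD by metis+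
    then show ?thesis using AB CD link by auto
  next
    case 3
    have nadj: "\<bar>rank s (Suc l) - rank s l\<bar> \<noteq> 1" "\<bar>rank t (Suc l') - rank t l'\<bar> \<noteq> 1"
      using AB CD link by auto
    show ?thesis
    proof (cases "leg l = 0")
      case True
      have z: "lane s l + 1 < lane t l' \<or> lane t l' + 1 < lane s l"
        using lane_sep assms by blast
      have b: "2 * lane s (Suc l) < width" "2 * lane t (Suc l') < width" using lane_bound assms by simp_all
      define x where "x = lane s l"
      define y where "y = lane t l'"
      have "(A = x \<and> B = width - x - 1) \<or> (B = x \<and> A = width - x - 1) \<or>
            (A = x + 1 \<and> B = width - x) \<or> (B = x + 1 \<and> A = width - x)"
        using outer_turn_shape[OF assms(1), of s] True nadj AB unfolding x_def by fastforce
      moreover have "(C = y \<and> D = width - y - 1) \<or> (D = y \<and> C = width - y - 1) \<or>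
            (C = y + 1 \<and> D = width - y) \<or> (D = y + 1 \<and> C = width - y)"
        using outer_turn_shape[OF assms(2), of t] True 3 nadj CD unfolding y_def by fastforce
      moreover have "x + 1 < y \<or> y + 1 < x" "2 * (x + 1) < width" "2 * (y + 1) < width"
        using z b unfolding x_def y_def lane_Suc by simp_all
      ultimately show ?thesis using link folded_arcs_unlinked[of A x B width C y D] by blast
    next
      case False
      define u where "u = offset s l"
      define u' where "u' = offset s (Suc l)"
      define w where "w = offset t l'"
      define w' where "w' = offset t (Suc l')"
      have bounds: "0 \<le> u" "u \<le> width" "0 \<le> u'" "u' \<le> width" "0 \<le> w" "w \<le> width" "0 \<le> w'" "w' \<le> width"
        unfolding u_def u'_def w_def w'_def using offset_bounds assms by simp_all
      have dist: "u \<noteq> w" "u \<noteq> w'" "u' \<noteq> w" "u' \<noteq> w'"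
        using offset_turns_disjoint[of l l' s t] assms(1-7) unfolding u_def u'_def w_def w'_def by blast+
      have adj: "\<bar>u' - u\<bar> = 1" "\<bar>w' - w\<bar> = 1"
        using outer_turn_shape[OF assms(1), of s] outer_turn_shape[OF assms(2), of t] nadj False 3
        unfolding u_def u'_def w_def w'_def by argo+
      obtain x x' where p: "x \<in> {u, u'}" "x' \<in> {u, u'}" "x \<noteq> x'"
          "(A = base (leg l) - x \<and> B = base (leg l) + x') \<or> (B = base (leg l) - x \<and> A = base (leg l) + x')"
        using outer_turn_shape[OF assms(1), of s] nadj AB adj False unfolding u_def u'_def by fastforce
      obtain y y' where q: "y \<in> {w, w'}" "y' \<in> {w, w'}" "y \<noteq> y'"
          "(C = base (leg l) - y \<and> D = base (leg l) + y') \<or> (D = base (leg l) - y \<and> C = base (leg l) + y')"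
        using outer_turn_shape[OF assms(2), of t] nadj CD adj False 3 unfolding w_def w'_def by fastforce
      have xy: "0 \<le> x" "0 \<le> x'" "0 \<le> y" "0 \<le> y'"
        using p q bounds by auto
      have sep: "(x < y \<and> x' < y') \<or> (y < x \<and> y' < x')"
        using p(1-3) q(1-3) adjacent_pairs_ordered[OF adj dist] by auto
      have "\<not> (- B < - C \<and> - C < - A \<and> - A < - D) \<and> \<not> (A < C \<and> C < B \<and> B < D)"
        using p(4) q(4) xy sep adj by auto
      then show ?thesis using link by blast
    qed
  qed
qed

lemma leg_target:
  assumes "s \<in> S" shows "leg (a s) = s"
proof -
  have s: "1 \<le> s" using S_sub[OF assms] by blast
  then have "on_finger s (a s)" using assms by (simp add: on_finger_def)
  then have "depth (a s) = 2 * s - 1" using depth_finger by simp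
  then show ?thesis using s unfolding leg_def by (cases s) auto
qed

text \<open>
  On the lower side of leg \<open>s\<close>, fingers are below bases, and among the fingers that reach leg \<open>s\<close> the
  one of strand \<open>s\<close> is the lowest. Its end is visited by the laps \<open>a s\<close> and \<open>a s + 1\<close> only, and in a
  finger the earlier lap is the lower one at odd depth.
\<close>
lemma rank_target:
  assumes "s \<in> S" "t \<le> R'" "l < N" "leg l = s"
  shows "rank s (a s) \<le> rank t l"
proof -
  have s: "1 \<le> s" "s \<le> R'" using S_sub[OF assms(1)] R_le by auto
  have vis: "on_finger s (a s)" using assms(1) s by (simp add: on_finger_def)
  have d: "depth (a s) = 2 * s - 1" using depth_finger[OF vis] by simp
  have od: "odd (depth (a s))" using d s(1) by (cases s) auto
  have bs: "2 * lane s (a s) < width" "2 * lane t l < width"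
    using lane_bound[OF s(2) a_less[OF assms(1)]] lane_bound[OF assms(2,3)] by auto
  have r: "rank s (a s) = base s - (width - lane s (a s))"
    using od vis leg_target[OF assms(1)] by (simp add: rank_base offset_def)
  show ?thesis
  proof (cases "even (depth l)")
    case True
    then have "rank t l = base s + offset t l" using assms(4) by (simp add: rank_base)
    then show ?thesis using r bs offset_bounds(1)[OF assms(2,3)] lane_nonneg[of s "a s"] by linarith
  next
    case odd: False
    have "offset t l \<le> width - lane s (a s)"
    proof (cases "on_finger t l")
      case False
      then have "offset t l = lane t l" by (simp add: offset_def)
      then show ?thesis using bs by linarith
    next
      case True
      have dl: "depth l = 2 * s - 1" using assms(4) odd unfolding leg_def by (auto elim!: oddE)
      have dv: "depth l = (if l \<le> a t then l + 2 * t - 1 - a t else a t + 2 * t - l)"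
        using depth_finger[OF True] .
      have w: "a t < l + 2 * t" "l \<le> a t + 2 * t" using True unfolding on_finger_def by auto
      have e: "2 * s - 1 = (if l \<le> a t then l + 2 * t - 1 - a t else a t + 2 * t - l)"
        using dl dv by simp
      have e1: "2 * s + a t = l + 2 * t" if "l \<le> a t"
        using e w s(1) that by simp
      have e2: "2 * s + l = a t + 2 * t + 1" if "\<not> l \<le> a t"
        using e w s(1) that by simp
      have "s \<le> t" using e1 e2 by linarith
      then have "lane s (a s) \<le> lane t l"
      proof (cases "s = t")
        case True
        then have "a s \<le> l" using e1 by (cases "l \<le> a t") auto
        then show ?thesis using True by (simp add: lane_def)
      next
        case False
        then show ?thesis using \<open>s \<le> t\<close> lane_less[of s t "a s" l] a_less[OF assms(1)] by simp
      qed
      then show ?thesis using True by (simp add: offset_def)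
    qed
    moreover have "rank t l = base s - offset t l" using odd assms(4) by (simp add: rank_base)
    ultimately show ?thesis using r by linarith
  qed
qed

end

section \<open>Heights of itineraries\<close>

text \<open>
  What the construction of heights uses of a sequence of levels. The legs of level \<open>m + 1\<close> are the
  strands of level \<open>m\<close>. All strands begin with lap \<open>0\<close> at the very top and in their own order, which
  is what allows them to be glued there in the star of the next level.
\<close>
locale laminated_turns =
  fixes N :: "nat \<Rightarrow> nat" and legs :: "nat \<Rightarrow> nat" and leg :: "nat \<Rightarrow> nat \<Rightarrow> nat"
    and rank :: "nat \<Rightarrow> nat \<Rightarrow> nat \<Rightarrow> int"
  assumes N_ge: "2 \<le> N m"
    and leg_le: "leg m l \<le> legs m"
    and rank_inj: "s \<le> legs (Suc m) \<Longrightarrow> t \<le> legs (Suc m) \<Longrightarrow> l < N m \<Longrightarrow> l' < N m \<Longrightarrow>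
       rank m s l = rank m t l' \<Longrightarrow> s = t \<and> l = l'"
    and rank_leg_less: "s \<le> legs (Suc m) \<Longrightarrow> t \<le> legs (Suc m) \<Longrightarrow> l < N m \<Longrightarrow> l' < N m \<Longrightarrow>
       leg m l < leg m l' \<Longrightarrow> rank m s l < rank m t l'"
    and rank_first_less: "s < t \<Longrightarrow> rank m s 0 < rank m t 0"
    and rank_first_top: "t \<le> legs (Suc m) \<Longrightarrow> l < N m \<Longrightarrow> 0 < l \<Longrightarrow> rank m t l < rank m s 0"
    and leg_outer_turn: "even l \<Longrightarrow> leg m (Suc l) = leg m l"
    and leg_inner_turn: "odd l \<Longrightarrow> leg m (Suc l) \<le> Suc (leg m l) \<and> leg m l \<le> Suc (leg m (Suc l))"
    and turns_unlinked: "even l \<longleftrightarrow> even l' \<Longrightarrow> Suc l < N m \<Longrightarrow> Suc l' < N m \<Longrightarrow>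
       s \<le> legs (Suc m) \<Longrightarrow> t \<le> legs (Suc m) \<Longrightarrow> (s, l) \<noteq> (t, l') \<Longrightarrow>
       (A = rank m s l \<and> B = rank m s (Suc l)) \<or> (A = rank m s (Suc l) \<and> B = rank m s l) \<Longrightarrow>
       (C = rank m t l' \<and> D = rank m t (Suc l')) \<or> (C = rank m t (Suc l') \<and> D = rank m t l') \<Longrightarrow>
       \<not> (A < C \<and> C < B \<and> B < D)"
begin

definition itinerary :: "(nat \<Rightarrow> nat) \<Rightarrow> bool" where
  "itinerary g \<longleftrightarrow> (\<forall>m. g m < N m)"

text \<open>
  The strand of level \<open>m - 1\<close>, or equivalently the leg of level \<open>m\<close>, in which the arc with itinerary \<open>g\<close>
  lies.
\<close>
definition strand :: "(nat \<Rightarrow> nat) \<Rightarrow> nat \<Rightarrow> nat" where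
  "strand g m = leg m (g m)"

definition level :: "(nat \<Rightarrow> nat) \<Rightarrow> nat \<Rightarrow> int" where
  "level g m = rank m (strand g (Suc m)) (g m)"

definition rank_bound :: "nat \<Rightarrow> real" where
  "rank_bound m = (\<Sum>s\<le>legs (Suc m). \<Sum>l<N m. \<bar>real_of_int (rank m s l)\<bar>)"

text \<open>
  Chosen such that everything below a given level contributes at most \<open>1/3\<close> in units of its integer
  ranks.
\<close>
definition shrink :: "nat \<Rightarrow> real" where
  "shrink m = 1 / (3 * (rank_bound (Suc m) + 1))"

text \<open>
  Heights up to \<open>d\<close> levels below level \<open>m\<close>. The sign turns the picture of a level over along inward
  laps: a strand that is traversed backwards is drawn rotated by a half turn.
\<close>
primrec approx :: "nat \<Rightarrow> nat \<Rightarrow> (nat \<Rightarrow> nat) \<Rightarrow> real" where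
  "approx 0 m g = 0"
| "approx (Suc d) m g = real_of_int (level g m) + (-1) ^ g m * shrink m * approx d (Suc m) g"

lemma itineraryD: "itinerary g \<Longrightarrow> g m < N m"
  by (simp add: itinerary_def)

lemma strand_le: "strand g m \<le> legs m"
  by (simp add: strand_def leg_le)

lemma rank_bound_nonneg: "0 \<le> rank_bound m"
  unfolding rank_bound_def by (intro sum_nonneg) auto

lemma level_bound: "itinerary g \<Longrightarrow> \<bar>real_of_int (level g m)\<bar> \<le> rank_bound m"
proof -
  assume g: "itinerary g"
  let ?s = "strand g (Suc m)"
  have "\<bar>real_of_int (rank m ?s (g m))\<bar> \<le> (\<Sum>l<N m. \<bar>real_of_int (rank m ?s l)\<bar>)"
    using itineraryD[OF g] by (intro member_le_sum) auto
  also have "\<dots> \<le> rank_bound m"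
    unfolding rank_bound_def using strand_le[of g "Suc m"]
    by (intro member_le_sum[of ?s _ "\<lambda>s. \<Sum>l<N m. \<bar>real_of_int (rank m s l)\<bar>"]) (auto intro: sum_nonneg)
  finally show ?thesis by (simp add: level_def)
qed

lemma shrink_pos: "0 < shrink m"
  using rank_bound_nonneg[of "Suc m"] by (simp add: shrink_def)

lemma shrink_rank_bound: "shrink m * (rank_bound (Suc m) + 1) = 1 / 3"
  using rank_bound_nonneg[of "Suc m"] by (simp add: shrink_def field_simps)

lemma abs_sign: "\<bar>(-1) ^ k * (x :: real)\<bar> = \<bar>x\<bar>"
  by (cases "even k") auto

lemma approx_bound: "itinerary g \<Longrightarrow> \<bar>approx d m g\<bar> \<le> rank_bound m + 1"
proof (induction d arbitrary: m)
  case 0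
  then show ?case using rank_bound_nonneg[of m] by simp
next
  case (Suc d)
  have "\<bar>(-1) ^ g m * (shrink m * approx d (Suc m) g)\<bar> = shrink m * \<bar>approx d (Suc m) g\<bar>"
    using shrink_pos[of m] by (simp add: abs_sign abs_mult)
  also have "\<dots> \<le> shrink m * (rank_bound (Suc m) + 1)"
    using Suc shrink_pos[of m] by (intro mult_left_mono) auto
  finally show ?case using level_bound[OF Suc.prems, of m] shrink_rank_bound[of m] by (simp add: mult.assoc)
qed

lemma tail_bound: "itinerary g \<Longrightarrow> \<bar>(-1) ^ g m * shrink m * approx d (Suc m) g\<bar> \<le> 1 / 3"
proof -
  assume g: "itinerary g"
  have "\<bar>(-1) ^ g m * (shrink m * approx d (Suc m) g)\<bar> = shrink m * \<bar>approx d (Suc m) g\<bar>"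
    using shrink_pos[of m] by (simp add: abs_sign abs_mult)
  also have "\<dots> \<le> shrink m * (rank_bound (Suc m) + 1)"
    using approx_bound[OF g] shrink_pos[of m] by (intro mult_left_mono) auto
  finally show ?thesis using shrink_rank_bound[of m] by (simp add: mult.assoc)
qed

lemma approx_less:
  assumes "itinerary g" "itinerary h" "level g m < level h m"
  shows "approx (Suc d) m g + 1 / 3 \<le> approx (Suc d) m h"
  using tail_bound[OF assms(1), of m d] tail_bound[OF assms(2), of m d] assms(3) by simp

lemma level_le_if_approx_less:
  assumes "itinerary g" "itinerary h" "approx (Suc d) m g < approx (Suc d) m h"
  shows "level g m \<le> level h m"
  using approx_less[OF assms(2,1), of m d] assms(3) by fastforce

lemma level_eq:
  assumes "itinerary g" "itinerary h" "level g m = level h m"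
  shows "strand g (Suc m) = strand h (Suc m)" "g m = h m"
  using rank_inj[OF strand_le strand_le itineraryD itineraryD] assms unfolding level_def by blast+

text \<open>
  Ends of \<open>[0,1]\<close> are encoded as booleans, with \<open>True\<close> for \<open>1\<close>. If end \<open>e\<close> of level \<open>m\<close> lifted to lap \<open>l\<close>
  is an end of level \<open>m + 1\<close>, the result is that end; otherwise it is a turning point and the result is
  \<open>None\<close>.
\<close>
definition next_end :: "nat \<Rightarrow> bool \<Rightarrow> nat \<Rightarrow> bool option" where
  "next_end m e l =
     (if l = 0 \<and> \<not> e then Some False
      else if l = N m - 1 \<and> (e \<longleftrightarrow> even l) then Some True else None)"

text \<open>
  The other lap that contains the turning point over the end \<open>e\<close>.
\<close>
definition partner :: "bool \<Rightarrow> nat \<Rightarrow> nat" where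
  "partner e l = (if e \<longleftrightarrow> even l then Suc l else l - 1)"

fun end_at :: "nat \<Rightarrow> bool \<Rightarrow> (nat \<Rightarrow> nat) \<Rightarrow> nat \<Rightarrow> bool option" where
  "end_at m e g 0 = Some e"
| "end_at m e g (Suc j) = (case next_end m e (g m) of None \<Rightarrow> None | Some e' \<Rightarrow> end_at (Suc m) e' g j)"

text \<open>
  The itinerary whose arc shares the end \<open>e\<close> of level \<open>m\<close> with the arc of \<open>g\<close>: the digit is changed at the
  first level where the end becomes a turning point.
\<close>
definition flip :: "nat \<Rightarrow> bool \<Rightarrow> (nat \<Rightarrow> nat) \<Rightarrow> nat \<Rightarrow> nat" where
  "flip m e g k =
     (if k < m then g k
      else case end_at m e g (k - m) of None \<Rightarrow> g k
           | Some e' \<Rightarrow> if next_end k e' (g k) = None then partner e' (g k) else g k)"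

lemma flip_continue: "next_end m e (g m) = Some e' \<Longrightarrow> flip m e g = flip (Suc m) e' g"
proof
  fix k assume n: "next_end m e (g m) = Some e'"
  consider "k < m" | "k = m" | "Suc m \<le> k" by linarith
  then show "flip m e g k = flip (Suc m) e' g k"
  proof cases
    case 3
    then have "k - m = Suc (k - Suc m)" by simp
    then show ?thesis using 3 n by (simp add: flip_def)
  qed (use n in \<open>simp_all add: flip_def\<close>)
qed

lemma flip_stop: "next_end m e (g m) = None \<Longrightarrow> flip m e g = g(m := partner e (g m))"
proof
  fix k assume n: "next_end m e (g m) = None"
  consider "k < m" | "k = m" | "Suc m \<le> k" by linarith
  then show "flip m e g k = (g(m := partner e (g m))) k"
  proof cases
    case 3
    then have "k - m = Suc (k - Suc m)" by simp
    then show ?thesis using 3 n by (simp add: flip_def)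
  qed (use n in \<open>simp_all add: flip_def\<close>)
qed

lemma end_at_cong: "(\<And>i. i < m + j \<Longrightarrow> g i = h i) \<Longrightarrow> end_at m e g j = end_at m e h j"
proof (induction j arbitrary: m e)
  case (Suc j)
  have "end_at (Suc m) e' g j = end_at (Suc m) e' h j" for e'
    using Suc.IH[of "Suc m" e'] Suc.prems by simp
  then show ?case using Suc.prems[of m] by (simp split: option.splits)
qed simp

lemma flip_cong: "(\<And>i. i \<le> k \<Longrightarrow> g i = h i) \<Longrightarrow> flip m e g k = flip m e h k"
proof -
  assume gh: "\<And>i. i \<le> k \<Longrightarrow> g i = h i"
  show ?thesis
  proof (cases "k < m")
    case False
    then have "end_at m e g (k - m) = end_at m e h (k - m)"
      using gh by (intro end_at_cong) auto
    then show ?thesis using gh[of k] by (simp add: flip_def split: option.split)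
  qed (use gh[of k] in \<open>simp add: flip_def\<close>)
qed

lemma partner_props:
  assumes "l < N m" "next_end m e l = None"
  shows "partner e l < N m" "next_end m e (partner e l) = None" "partner e (partner e l) = l"
    "partner e l \<noteq> l"
proof -
  have up: "Suc l < N m" if "e \<longleftrightarrow> even l"
  proof -
    have "l \<noteq> N m - 1" using assms(2) that by (auto simp: next_end_def split: if_splits)
    then show ?thesis using assms(1) by linarith
  qed
  have down: "0 < l" if "\<not> (e \<longleftrightarrow> even l)"
    using assms(2) that by (cases l) (auto simp: next_end_def)
  show "partner e l < N m" using up assms(1) by (auto simp: partner_def)
  show "partner e (partner e l) = l" "partner e l \<noteq> l" using down by (auto simp: partner_def)
  show "next_end m e (partner e l) = None"
  proof (cases "e \<longleftrightarrow> even l")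
    case True
    then show ?thesis by (auto simp: partner_def next_end_def)
  next
    case False
    then have "l - 1 \<noteq> N m - 1" "l - 1 = 0 \<longrightarrow> e" using down assms(1) by auto
    then show ?thesis using False by (simp add: partner_def next_end_def)
  qed
qed

lemma flip_itinerary:
  assumes "itinerary g" shows "itinerary (flip m e g)"
  unfolding itinerary_def flip_def
  using itineraryD[OF assms] partner_props(1) by (auto split: option.splits)

lemma end_at_flip:
  assumes "itinerary g" shows "end_at m e (flip m e g) j = end_at m e g j"
proof (induction j arbitrary: m e)
  case (Suc j)
  show ?case
  proof (cases "next_end m e (g m)")
    case None
    then show ?thesis using flip_stop[of m e g, OF None] partner_props[OF itineraryD[OF assms] None] by simp
  next
    case (Some e')
    have "flip m e g m = g m" using Some by (simp add: flip_def)
    then show ?thesis using Some Suc.IH[of "Suc m" e'] flip_continue[of m e g, OF Some] by simp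
  qed
qed simp

lemma flip_flip:
  assumes "itinerary g" shows "flip m e (flip m e g) = g"
proof
  fix k
  show "flip m e (flip m e g) k = g k"
  proof (cases "k < m")
    case False
    show ?thesis
    proof (cases "end_at m e g (k - m)")
      case None
      then show ?thesis using False end_at_flip[OF assms, of m e "k - m"] by (simp add: flip_def[of m e _ k])
    next
      case (Some e')
      note props = partner_props[OF itineraryD[OF assms], of k e']
      show ?thesis using False Some end_at_flip[OF assms, of m e "k - m"] props
        by (simp add: flip_def[of m e _ k])
    qed
  qed (simp add: flip_def)
qed

lemma strand_flip:
  assumes "itinerary g"
  shows "strand (flip m True g) m = strand g m"
    "strand (flip m False g) m \<le> Suc (strand g m) \<and> strand g m \<le> Suc (strand (flip m False g) m)"
proof -
  have *: "strand (flip m e g) m = strand g m" if "next_end m e (g m) = Some e'" for e e'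
    using that by (simp add: strand_def flip_def)
  show "strand (flip m True g) m = strand g m"
  proof (cases "next_end m True (g m)")
    case None
    then have "even (g m) \<or> 0 < g m" by (cases "g m") auto
    then show ?thesis using flip_stop[of m True g, OF None] leg_outer_turn[of "g m" m] leg_outer_turn[of "g m - 1" m]
      by (cases "even (g m)") (auto simp: strand_def partner_def)
  qed (use * in blast)
  show "strand (flip m False g) m \<le> Suc (strand g m) \<and> strand g m \<le> Suc (strand (flip m False g) m)"
  proof (cases "next_end m False (g m)")
    case None
    then have "0 < g m" by (auto simp: next_end_def intro!: Nat.gr0I)
    then show ?thesis using flip_stop[of m False g, OF None] leg_inner_turn[of "g m" m] leg_inner_turn[of "g m - 1" m]
      by (cases "even (g m)") (auto simp: strand_def partner_def)
  qed (use * in force)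
qed

lemma approx_less_tail:
  assumes "approx (Suc d) m g < approx (Suc d) m h" "level g m = level h m" "g m = h m"
  shows "if even (g m) then approx d (Suc m) g < approx d (Suc m) h
         else approx d (Suc m) h < approx d (Suc m) g"
  using assms shrink_pos[of m] by (auto simp: mult_less_cancel_left_pos)

lemma level_flip_stop:
  assumes "next_end m e (g m) = None"
  shows "strand (flip m e g) (Suc m) = strand g (Suc m)"
    "level (flip m e g) m = rank m (strand g (Suc m)) (partner e (g m))"
    "approx d (Suc m) (flip m e g) = approx d (Suc m) g"
proof -
  have f: "flip m e g = g(m := partner e (g m))" using flip_stop[of m e g, OF assms] .
  have s: "strand (flip m e g) k = strand g k" if "m < k" for k
    using that by (simp add: strand_def f)
  then show "strand (flip m e g) (Suc m) = strand g (Suc m)" by simp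
  then show "level (flip m e g) m = rank m (strand g (Suc m)) (partner e (g m))"
    by (simp add: level_def f)
  have l: "level (flip m e g) k = level g k" if "m < k" for k
    using that s[of "Suc k"] by (simp add: level_def f)
  show "approx d (Suc m) (flip m e g) = approx d (Suc m) g"
  proof -
    have "approx d k (flip m e g) = approx d k g" if "m < k" for d k
      using that
    proof (induction d arbitrary: k)
      case (Suc d)
      moreover have "flip m e g k = g k" using Suc.prems by (simp add: f)
      ultimately show ?case using l[of k] by simp
    qed simp
    then show ?thesis by simp
  qed
qed

lemma partner_pair:
  assumes "l < N m" "next_end m e l = None"
  obtains k where "Suc k < N m" "e \<longleftrightarrow> even k" "{l, partner e l} = {k, Suc k}"
proof (cases "e \<longleftrightarrow> even l")
  case True
  then show ?thesis using that[of l] partner_props(1)[OF assms] by (simp add: partner_def)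
next
  case False
  then have "0 < l" using assms by (auto simp: next_end_def intro!: Nat.gr0I)
  then show ?thesis using that[of "l - 1"] False assms by (auto simp: partner_def insert_commute)
qed

text \<open>
  Strands are stacked at their beginnings in the order of the legs of the next level, so heights of arcs
  through lap \<open>0\<close> compare like the heights of their tails.
\<close>
lemma first_tail_less:
  assumes "itinerary g" "itinerary h" "g m = 0" "h m = 0"
    and "approx (Suc (Suc d)) m g < approx (Suc (Suc d)) m h"
  shows "approx (Suc d) (Suc m) g < approx (Suc d) (Suc m) h"
proof (cases "level g m = level h m")
  case True
  then show ?thesis using approx_less_tail[OF assms(5) True] assms(3,4) by simp
next
  case False
  then have "level g m < level h m" using level_le_if_approx_less[OF assms(1,2,5)] by simp
  then have "strand g (Suc m) < strand h (Suc m)"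
    using rank_first_less[of "strand h (Suc m)" "strand g (Suc m)" m] assms(3,4)
    unfolding level_def by (metis less_asym less_irrefl linorder_neqE_nat)
  then have "level g (Suc m) < level h (Suc m)"
    unfolding level_def strand_def[of _ "Suc m"]
    using rank_leg_less[OF strand_le strand_le itineraryD itineraryD] assms(1,2) by blast
  from approx_less[OF assms(1,2) this, of d] show ?thesis by simp
qed

lemma next_end_Some:
  "next_end m e l = Some e' \<longleftrightarrow>
     (l = 0 \<and> \<not> e \<and> \<not> e') \<or> (l = N m - 1 \<and> (e \<longleftrightarrow> even l) \<and> l \<noteq> 0 \<and> e')"
proof -
  obtain k where k: "N m - 1 = k" "k \<noteq> 0" using N_ge[of m] by simp
  then show ?thesis unfolding next_end_def k(1) by (cases "l = 0"; cases e; cases e') auto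
qed

text \<open>
  Induction on the number of levels. If the four laps at the top level belong to two different turns,
  the combinatorics of that level applies. Two arcs in the same turn run in parallel and are nested.
  If a pair makes no turn at this level, it either stays in one position or joins the beginnings of
  strands at the top, and two such pairs are compared one level further down. An odd lap reverses the
  order there, which exchanges the roles of the four arcs.
\<close>
lemma approx_unlinked:
  assumes "itinerary g" "itinerary h"
  shows "\<not> (approx d m g < approx d m h \<and> approx d m h < approx d m (flip m e g) \<and>
            approx d m (flip m e g) < approx d m (flip m e h))"
  using assms
proof (induction d arbitrary: m e g h)
  case 0
  then show ?case by simp
next
  case (Suc d)
  show ?case
  proof
    define g' where "g' = flip m e g"
    define h' where "h' = flip m e h"
    assume "approx (Suc d) m g < approx (Suc d) m h \<and> approx (Suc d) m h < approx (Suc d) m (flip m e g) \<and>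
            approx (Suc d) m (flip m e g) < approx (Suc d) m (flip m e h)"
    then have lt: "approx (Suc d) m g < approx (Suc d) m h" "approx (Suc d) m h < approx (Suc d) m g'"
      "approx (Suc d) m g' < approx (Suc d) m h'" by (auto simp: g'_def h'_def)
    note it = Suc.prems
    have it': "itinerary g'" "itinerary h'" using it flip_itinerary by (auto simp: g'_def h'_def)
    note it = it it'
    note gN = itineraryD[OF it(1), of m] and hN = itineraryD[OF it(2), of m]
    note g'N = itineraryD[OF it(3), of m] and h'N = itineraryD[OF it(4), of m]
    have le: "level g m \<le> level h m" "level h m \<le> level g' m" "level g' m \<le> level h' m"
      using level_le_if_approx_less lt it by blast+
    have cont: "flip m e k m = k m" "flip m e k = flip (Suc m) e' k" if "next_end m e (k m) = Some e'" for k e'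
      using that flip_continue by (auto simp: flip_def)
    have flat: "level (flip m e k) m = level k m" if "next_end m e (k m) = Some True" "itinerary k" for k
      unfolding level_def using cont[of k True, OF that(1)] strand_flip(1)[OF that(2), of "Suc m"] by simp
    have top: "level k m < level k' m" if "itinerary k" "k m > 0" "k' m = 0" for k k'
      unfolding level_def using rank_first_top[OF strand_le itineraryD] that by simp
    show False
    proof (cases "next_end m e (g m)"; cases "next_end m e (h m)")
      assume ng: "next_end m e (g m) = None" and nh: "next_end m e (h m) = None"
      obtain k where k: "Suc k < N m" "e \<longleftrightarrow> even k" "{g m, partner e (g m)} = {k, Suc k}"
        using partner_pair[OF gN ng] by blast
      obtain j where j: "Suc j < N m" "e \<longleftrightarrow> even j" "{h m, partner e (h m)} = {j, Suc j}"
        using partner_pair[OF hN nh] by blast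
      define s where "s = strand g (Suc m)"
      define t where "t = strand h (Suc m)"
      have A: "level g m = rank m s (g m)" by (simp add: level_def s_def)
      have C: "level h m = rank m t (h m)" by (simp add: level_def t_def)
      have B: "level g' m = rank m s (partner e (g m))" "g' m = partner e (g m)" "strand g' (Suc m) = s"
        using level_flip_stop(1,2)[of m e g, OF ng] flip_stop[of m e g, OF ng] by (auto simp: g'_def s_def)
      have D: "level h' m = rank m t (partner e (h m))" "h' m = partner e (h m)" "strand h' (Suc m) = t"
        using level_flip_stop(1,2)[of m e h, OF nh] flip_stop[of m e h, OF nh] by (auto simp: h'_def t_def)
      have gg: "g m \<noteq> partner e (g m)" using partner_props(4)[OF gN ng] by simp
      \<comment> \<open>Either both pairs run through the same turn, or they use two different turns of this level.\<close>
      show False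
      proof (cases "s = t \<and> k = j")
        case True
        then consider "h m = g m" | "h m = partner e (g m)" using j(3) k(3) by blast
        then show ?thesis
        proof cases
          case 1
          then have p: "partner e (h m) = partner e (g m)" by simp
          have "level g m = level h m" "level g' m = level h' m" "g' m = h' m"
            using A B C D True 1 p by auto
          moreover have "even (g' m) \<longleftrightarrow> odd (g m)" proof -
            have "(g m = k \<and> partner e (g m) = Suc k) \<or> (g m = Suc k \<and> partner e (g m) = k)"
              using k(3) by (auto simp: doubleton_eq_iff)
            then show ?thesis unfolding B(2) by (elim disjE conjE) simp_all
          qed
          moreover have "approx d (Suc m) g' = approx d (Suc m) g" "approx d (Suc m) h' = approx d (Suc m) h"
            using level_flip_stop(3)[of m e g d, OF ng] level_flip_stop(3)[of m e h d, OF nh] by (auto simp: g'_def h'_def)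
          ultimately show ?thesis
            using approx_less_tail[OF lt(1)] approx_less_tail[OF lt(3)] 1 by (auto split: if_splits)
        next
          case 2
          then have "partner e (h m) = g m" using partner_props(3)[OF gN ng] by simp
          then have "level g m = level g' m" using le A B C D True 2 by simp
          then have "g m = g' m" by (rule level_eq(2)[OF it(1,3)])
          then show ?thesis using B(2) gg by metis
        qed
      next
        case False
        have ne: "rank m s x \<noteq> rank m t y" if "x \<in> {k, Suc k}" "y \<in> {j, Suc j}" for x y
        proof
          assume r: "rank m s x = rank m t y"
          have "s = t \<and> x = y"
            using rank_inj[OF _ _ _ _ r] that strand_le k(1) j(1) unfolding s_def t_def by auto
          moreover have "even k \<longleftrightarrow> even j" using k(2) j(2) by simp
          ultimately show False using that False by auto
        qed
        have mem: "g m \<in> {k, Suc k}" "partner e (g m) \<in> {k, Suc k}" "h m \<in> {j, Suc j}" "partner e (h m) \<in> {j, Suc j}"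
          using k(3) j(3) by blast+
        have "level g m < level h m" "level h m < level g' m" "level g' m < level h' m"
          using le ne[OF mem(1,3)] ne[OF mem(2,3)] ne[OF mem(2,4)] A B(1) C D(1) by auto
        moreover have "\<not> (level g m < level h m \<and> level h m < level g' m \<and> level g' m < level h' m)"
        proof (rule turns_unlinked[of k j m s t])
          show "even k \<longleftrightarrow> even j" using k(2) j(2) by simp
          show "s \<le> legs (Suc m)" "t \<le> legs (Suc m)" using strand_le s_def t_def by auto
          show "(s, k) \<noteq> (t, j)" using False by simp
          show "(level g m = rank m s k \<and> level g' m = rank m s (Suc k)) \<or>
                (level g m = rank m s (Suc k) \<and> level g' m = rank m s k)"
            using A B(1) k(3) by (auto simp: doubleton_eq_iff)
          show "(level h m = rank m t j \<and> level h' m = rank m t (Suc j)) \<or>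
                (level h m = rank m t (Suc j) \<and> level h' m = rank m t j)"
            using C D(1) j(3) by (auto simp: doubleton_eq_iff)
        qed (use k(1) j(1) in auto)
        ultimately show ?thesis by blast
      qed
    next
      fix e' assume ng: "next_end m e (g m) = None" and nh: "next_end m e (h m) = Some e'"
      have g'n: "next_end m e (g' m) = None"
        using partner_props(2)[OF gN ng] flip_stop[of m e g, OF ng] by (simp add: g'_def)
      show False
      proof (cases e')
        case True
        then have "level h' m = level h m" using flat[of h] nh it by (auto simp: h'_def)
        then have "level h m = level g' m" using le by simp
        then show False using level_eq(2)[OF it(2,3)] nh g'n by simp
      next
        case False
        then have "h m = 0" "\<not> e" using nh by (auto simp: next_end_Some)
        moreover have "g' m > 0" using g'n \<open>\<not> e\<close> by (auto simp: next_end_def intro!: Nat.gr0I)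
        ultimately have "level g' m < level h m" using top[of g' h] it(3) by blast
        then show False using le(2) by simp
      qed
    next
      fix e' assume ng: "next_end m e (g m) = Some e'" and nh: "next_end m e (h m) = None"
      show False
      proof (cases e')
        case True
        then have "level g' m = level g m" using flat[of g] ng it by (auto simp: g'_def)
        then have "level h m = level g m" using le by simp
        then show False using level_eq(2)[OF it(2,1)] nh ng by simp
      next
        case False
        then have "g m = 0" "\<not> e" using ng by (auto simp: next_end_Some)
        moreover have "h m > 0" using nh \<open>\<not> e\<close> by (auto simp: next_end_def intro!: Nat.gr0I)
        ultimately have "level h m < level g m" using top[of h g] it(2) by blast
        then show False using le(1) by simp
      qed
    next
      fix e1 e2 assume ng: "next_end m e (g m) = Some e1" and nh: "next_end m e (h m) = Some e2"
      have same: "g' m = g m" "h' m = h m" using cont[of g e1, OF ng] cont[of h e2, OF nh] by (auto simp: g'_def h'_def)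
      have fl: "g' = flip (Suc m) e1 g" "h' = flip (Suc m) e2 h"
        using cont[of g e1, OF ng] cont[of h e2, OF nh] by (auto simp: g'_def h'_def)
      show False
      proof (cases e1; cases e2)
        assume e: e1 e2
        have "level g' m = level g m" "level h' m = level h m"
          using flat[of g] flat[of h] ng nh it e by (auto simp: g'_def h'_def)
        then have lev: "level g m = level h m" "level h m = level g' m" "level g' m = level h' m"
          using le by auto
        have eq: "g m = h m" using level_eq(2)[OF it(1,2) lev(1)] .
        note t = approx_less_tail[OF lt(1) lev(1) eq]
          approx_less_tail[OF lt(2) lev(2)] approx_less_tail[OF lt(3) lev(3)]
        show False
        proof (cases "even (g m)")
          case True
          then have "approx d (Suc m) g < approx d (Suc m) h" "approx d (Suc m) h < approx d (Suc m) g'"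
            "approx d (Suc m) g' < approx d (Suc m) h'" using t same eq by auto
          then show False using Suc.IH[OF it(1,2), of "Suc m" True] fl e by simp
        next
          case False
          then have "approx d (Suc m) h' < approx d (Suc m) g'" "approx d (Suc m) g' < approx d (Suc m) h"
            "approx d (Suc m) h < approx d (Suc m) g" using t same eq by auto
          moreover have "flip (Suc m) True h' = h" "flip (Suc m) True g' = g"
            using fl e flip_flip it by auto
          ultimately show False using Suc.IH[OF it(4,3), of "Suc m" True] by simp
        qed
      next
        assume e: e1 "\<not> e2"
        have "level g' m = level g m" using flat[of g] ng it e by (auto simp: g'_def)
        then have "level h m = level g m" using le by simp
        then have "h m = g m" using level_eq(2)[OF it(2,1)] by simp
        then show False using ng nh e by simp
      next
        assume e: "\<not> e1" e2
        then have "g m = 0" "h m > 0" using ng nh by (auto simp: next_end_Some)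
        then have "level h m < level g m" using top[of h g] it(2) by blast
        then show False using le(1) by simp
      next
        assume e: "\<not> e1" "\<not> e2"
        then have z: "g m = 0" "h m = 0" "g' m = 0" "h' m = 0" using ng nh same by (auto simp: next_end_Some)
        show False
        proof (cases d)
          case 0
          \<comment> \<open>Nothing lies strictly between two adjacent strands.\<close>
        have "level g m < level h m" "level h m < level g' m" using lt 0 by auto
          then have "strand g (Suc m) < strand h (Suc m)" "strand h (Suc m) < strand g' (Suc m)"
            using rank_first_less z unfolding level_def
            by (metis less_asym less_irrefl linorder_neqE_nat)+
          then show False using strand_flip(2)[OF it(1), of "Suc m"] fl e by simp
        next
          case (Suc d')
          have "approx d (Suc m) g < approx d (Suc m) h" "approx d (Suc m) h < approx d (Suc m) g'"
            "approx d (Suc m) g' < approx d (Suc m) h'"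
            using first_tail_less z lt it unfolding Suc by blast+
          then show False using Suc.IH[OF it(1,2), of "Suc m" False] fl e by simp
        qed
      qed
    qed
  qed
qed

section \<open>Limits of the approximate heights\<close>

definition height :: "(nat \<Rightarrow> nat) \<Rightarrow> real" where
  "height g = lim (\<lambda>d. approx d 0 g)"

lemma approx_step:
  "itinerary g \<Longrightarrow> \<bar>approx (Suc d) m g - approx d m g\<bar> \<le> (1 / 3) ^ d * (rank_bound m + 1)"
proof (induction d arbitrary: m)
  case 0
  then show ?case using level_bound[of g m] by simp
next
  case (Suc d)
  have e: "approx (Suc (Suc d)) m g - approx (Suc d) m g =
      (-1) ^ g m * (shrink m * (approx (Suc d) (Suc m) g - approx d (Suc m) g))"
    by (simp add: algebra_simps)
  have "\<bar>approx (Suc (Suc d)) m g - approx (Suc d) m g\<bar> = shrink m * \<bar>approx (Suc d) (Suc m) g - approx d (Suc m) g\<bar>"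
    using shrink_pos[of m] unfolding e abs_sign abs_mult by simp
  also have "\<dots> \<le> shrink m * ((1 / 3) ^ d * (rank_bound (Suc m) + 1))"
    by (rule mult_left_mono[OF Suc.IH[OF Suc.prems] less_imp_le[OF shrink_pos]])
  also have "\<dots> = (1 / 3) ^ d * (shrink m * (rank_bound (Suc m) + 1))"
    by (simp only: mult.left_commute)
  also have "\<dots> = (1 / 3) ^ Suc d * 1"
    unfolding shrink_rank_bound by simp
  also have "\<dots> \<le> (1 / 3) ^ Suc d * (rank_bound m + 1)"
    using rank_bound_nonneg[of m] by (intro mult_left_mono) auto
  finally show ?case .
qed

lemma approx_Cauchy:
  assumes "itinerary g"
  shows "\<bar>approx (d + k) m g - approx d m g\<bar> \<le> (1 / 3) ^ d * (rank_bound m + 1) * (3 / 2) * (1 - (1 / 3) ^ k)"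
proof (induction k)
  case (Suc k)
  have "\<bar>approx (d + Suc k) m g - approx d m g\<bar> \<le>
     (1 / 3) ^ (d + k) * (rank_bound m + 1) + (1 / 3) ^ d * (rank_bound m + 1) * (3 / 2) * (1 - (1 / 3) ^ k)"
    using Suc approx_step[OF assms, of "d + k" m] unfolding add_Suc_right by linarith
  also have "\<dots> = (1 / 3) ^ d * (rank_bound m + 1) * (3 / 2) * (1 - (1 / 3) ^ Suc k)"
    by (simp add: power_add field_simps)
  finally show ?case .
qed simp

lemma approx_Cauchy':
  assumes "itinerary g"
  shows "\<bar>approx (d + k) m g - approx d m g\<bar> \<le> 2 * (1 / 3) ^ d * (rank_bound m + 1)"
proof -
  have "(1 / 3) ^ d * (rank_bound m + 1) * (3 / 2) * (1 - (1 / 3) ^ k) \<le> (1 / 3) ^ d * (rank_bound m + 1) * (3 / 2) * 1"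
    using rank_bound_nonneg[of m] by (intro mult_left_mono) auto
  moreover have "0 \<le> (1 / 3) ^ d * (rank_bound m + 1)" using rank_bound_nonneg[of m] by simp
  ultimately show ?thesis using approx_Cauchy[OF assms, of d k m] by linarith
qed

lemma geometric_small:
  fixes c r :: real assumes "0 < r" "0 \<le> c" shows "\<exists>d. 2 * (1 / 3) ^ d * c < r"
proof -
  have "(\<lambda>d. 2 * (1 / 3 :: real) ^ d * c) \<longlonglongrightarrow> 2 * 0 * c"
    by (intro tendsto_intros LIMSEQ_realpow_zero) auto
  then have "eventually (\<lambda>d. 2 * (1 / 3 :: real) ^ d * c < r) sequentially"
    using assms by (intro order_tendstoD) auto
  then show ?thesis by (rule eventually_happens'[rotated]) simp
qed

lemma approx_height:
  assumes "itinerary g" shows "(\<lambda>d. approx d 0 g) \<longlonglongrightarrow> height g"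
proof -
  have "Cauchy (\<lambda>d. approx d 0 g)"
  proof (rule metric_CauchyI)
    fix r :: real assume "0 < r"
    then obtain d where d: "2 * (1 / 3) ^ d * (rank_bound 0 + 1) < r / 2"
      using geometric_small[of "r / 2" "rank_bound 0 + 1"] rank_bound_nonneg[of 0] by auto
    have "\<bar>approx n 0 g - approx d 0 g\<bar> < r / 2" if "d \<le> n" for n
      using approx_Cauchy'[OF assms, of d "n - d" 0] that d by simp
    then have "dist (approx n 0 g) (approx n' 0 g) < r" if "d \<le> n" "d \<le> n'" for n n'
      using that unfolding dist_real_def by (smt (verit) field_sum_of_halves)
    then show "\<exists>M. \<forall>m\<ge>M. \<forall>n\<ge>M. dist (approx m 0 g) (approx n 0 g) < r" by blast
  qed
  then show ?thesis by (simp add: height_def Cauchy_convergent_iff convergent_LIMSEQ_iff)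
qed

lemma height_approx:
  assumes "itinerary g" shows "\<bar>height g - approx d 0 g\<bar> \<le> 2 * (1 / 3) ^ d * (rank_bound 0 + 1)"
proof -
  have "(\<lambda>k. \<bar>approx (k + d) 0 g - approx d 0 g\<bar>) \<longlonglongrightarrow> \<bar>height g - approx d 0 g\<bar>"
    by (intro tendsto_intros LIMSEQ_ignore_initial_segment approx_height assms)
  then show ?thesis
    using approx_Cauchy'[OF assms, of d _ 0] by (intro LIMSEQ_le_const2) (auto simp: add.commute)
qed

lemma approx_cong: "(\<And>i. i \<le> m + d \<Longrightarrow> g i = h i) \<Longrightarrow> approx d m g = approx d m h"
proof (induction d arbitrary: m)
  case (Suc d)
  have "approx d (Suc m) g = approx d (Suc m) h" using Suc by simp
  moreover have "level g m = level h m" using Suc.prems[of m] Suc.prems[of "Suc m"]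
    by (simp add: level_def strand_def)
  ultimately show ?case using Suc.prems[of m] by simp
qed simp

lemma height_uniform:
  assumes "0 < r"
  shows "\<exists>n. \<forall>g h. itinerary g \<longrightarrow> itinerary h \<longrightarrow> (\<forall>i<n. g i = h i) \<longrightarrow> \<bar>height g - height h\<bar> < r"
proof -
  obtain d where d: "2 * (1 / 3) ^ d * (rank_bound 0 + 1) < r / 2"
    using geometric_small[of "r / 2" "rank_bound 0 + 1"] rank_bound_nonneg[of 0] assms by auto
  have "\<bar>height g - height h\<bar> < r" if "itinerary g" "itinerary h" "\<forall>i<Suc d. g i = h i" for g h
    using height_approx[OF that(1), of d] height_approx[OF that(2), of d] d approx_cong[of 0 d g h] that(3)
    by simp
  then show ?thesis by blast
qed

lemma height_flip_uniform:
  assumes "0 < r"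
  shows "\<exists>n. \<forall>g h. itinerary g \<longrightarrow> itinerary h \<longrightarrow> (\<forall>i<n. g i = h i) \<longrightarrow>
           \<bar>height (flip 0 e g) - height (flip 0 e h)\<bar> < r"
proof -
  obtain n where n: "\<And>g h. itinerary g \<Longrightarrow> itinerary h \<Longrightarrow> (\<forall>i<n. g i = h i) \<Longrightarrow> \<bar>height g - height h\<bar> < r"
    using height_uniform[OF assms] by blast
  have "\<bar>height (flip 0 e g) - height (flip 0 e h)\<bar> < r"
    if "itinerary g" "itinerary h" "\<forall>i<n. g i = h i" for g h
    using that by (intro n flip_itinerary) (auto intro!: flip_cong)
  then show ?thesis by blast
qed

lemma height_unlinked:
  assumes "itinerary g" "itinerary h"
  shows "\<not> (height g < height h \<and> height h < height (flip 0 e g) \<and> height (flip 0 e g) < height (flip 0 e h))"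
proof
  assume lt: "height g < height h \<and> height h < height (flip 0 e g) \<and> height (flip 0 e g) < height (flip 0 e h)"
  have ev: "eventually (\<lambda>d. approx d 0 a < approx d 0 b) sequentially"
    if "itinerary a" "itinerary b" "height a < height b" for a b
  proof -
    have "(\<lambda>d. approx d 0 b - approx d 0 a) \<longlonglongrightarrow> height b - height a"
      by (intro tendsto_intros approx_height that)
    then have "eventually (\<lambda>d. 0 < approx d 0 b - approx d 0 a) sequentially"
      using that(3) by (intro order_tendstoD) auto
    then show ?thesis by simp
  qed
  have "eventually (\<lambda>d. approx d 0 g < approx d 0 h \<and> approx d 0 h < approx d 0 (flip 0 e g) \<and>
            approx d 0 (flip 0 e g) < approx d 0 (flip 0 e h)) sequentially"
    using lt assms flip_itinerary by (intro eventually_conj ev) auto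
  then show False using approx_unlinked[OF assms] by simp
qed

definition scale :: "nat \<Rightarrow> real" where
  "scale i = (\<Prod>r<i. shrink r)"

definition orient :: "(nat \<Rightarrow> nat) \<Rightarrow> nat \<Rightarrow> real" where
  "orient g i = (-1) ^ (\<Sum>r<i. g r)"

lemma scale_pos: "0 < scale i"
  unfolding scale_def using shrink_pos by (intro prod_pos) auto

lemma scale_antimono: "i \<le> j \<Longrightarrow> scale j \<le> scale i"
proof (induction j rule: dec_induct)
  case (step j)
  have "shrink j \<le> 1" using rank_bound_nonneg[of "Suc j"] by (simp add: shrink_def)
  then have "scale j * shrink j \<le> scale j * 1" using scale_pos[of j] by (intro mult_left_mono) auto
  then show ?case using step.IH by (simp add: scale_def)
qed simp

lemma orient_cases: "orient g i = 1 \<or> orient g i = -1"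
  unfolding orient_def by (cases "even (\<Sum>r<i. g r)") auto

lemma approx_diff:
  assumes "itinerary g" "itinerary h"
  shows "(\<And>r. r < i \<Longrightarrow> level g r = level h r) \<Longrightarrow>
    approx (i + d) 0 g - approx (i + d) 0 h = orient g i * scale i * (approx d i g - approx d i h)"
proof (induction i arbitrary: d)
  case 0
  then show ?case by (simp add: orient_def scale_def)
next
  case (Suc i)
  have eq: "level g i = level h i" "g i = h i" using Suc.prems[of i] level_eq(2)[OF assms] by auto
  have "approx (Suc i + d) 0 g - approx (Suc i + d) 0 h =
      orient g i * scale i * (approx (Suc d) i g - approx (Suc d) i h)"
    using Suc.IH[of "Suc d"] Suc.prems by simp
  also have "approx (Suc d) i g - approx (Suc d) i h =
      (-1) ^ g i * shrink i * (approx d (Suc i) g - approx d (Suc i) h)"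
    using eq by (simp add: algebra_simps)
  finally show ?case by (simp add: orient_def scale_def power_add mult.assoc mult.left_commute)
qed

lemma height_diff_tendsto:
  assumes "itinerary g" "itinerary h" "\<And>r. r < i \<Longrightarrow> level g r = level h r"
  shows "(\<lambda>d. orient g i * scale i * (approx d i g - approx d i h)) \<longlonglongrightarrow> height g - height h"
proof -
  have "(\<lambda>d. approx (d + i) 0 g - approx (d + i) 0 h) \<longlonglongrightarrow> height g - height h"
    by (intro tendsto_intros LIMSEQ_ignore_initial_segment approx_height assms)
  moreover have "approx (d + i) 0 g - approx (d + i) 0 h = orient g i * scale i * (approx d i g - approx d i h)" for d
    using approx_diff[OF assms(1,2), of i d] assms(3) by (simp add: add.commute)
  ultimately show ?thesis by simp
qed

text \<open>
  At the first difference the ranks differ by at least \<open>1\<close>, and the tails change this by at most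
  \<open>2/3\<close>.
\<close>
lemma height_gap:
  assumes "itinerary g" "itinerary h" "\<And>r. r < i \<Longrightarrow> level g r = level h r" "level g i \<noteq> level h i"
  shows "scale i / 3 \<le> \<bar>height g - height h\<bar>"
proof -
  have *: "(\<lambda>d. \<bar>orient g i * scale i * (approx (d + 1) i g - approx (d + 1) i h)\<bar>) \<longlonglongrightarrow> \<bar>height g - height h\<bar>"
    by (intro tendsto_rabs LIMSEQ_ignore_initial_segment[of "\<lambda>d. orient g i * scale i * (approx d i g - approx d i h)"]
        height_diff_tendsto assms)
  have "scale i / 3 \<le> \<bar>orient g i * scale i * (approx (d + 1) i g - approx (d + 1) i h)\<bar>" for d
  proof -
    have "1 / 3 \<le> \<bar>approx (d + 1) i g - approx (d + 1) i h\<bar>"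
      using approx_less[OF assms(1,2), of i d] approx_less[OF assms(2,1), of i d] assms(4) by fastforce
    then have "scale i * (1 / 3) \<le> scale i * \<bar>approx (d + 1) i g - approx (d + 1) i h\<bar>"
      using scale_pos[of i] by (intro mult_left_mono) auto
    also have "\<dots> = \<bar>orient g i * scale i * (approx (d + 1) i g - approx (d + 1) i h)\<bar>"
      using orient_cases[of g i] scale_pos[of i] by (auto simp: abs_mult)
    finally show ?thesis by simp
  qed
  then show ?thesis using * by (intro LIMSEQ_le_const) auto
qed

lemma first_difference:
  assumes "P (r :: nat)" obtains i where "i \<le> r" "P i" "\<And>j. j < i \<Longrightarrow> \<not> P j"
  using assms by (metis LeastI Least_le not_less_Least)

lemma height_inj:
  assumes "itinerary g" "itinerary h" "height g = height h" shows "g = h"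
proof (rule ccontr)
  assume "g \<noteq> h"
  then obtain k where "g k \<noteq> h k" by blast
  then have "level g k \<noteq> level h k" using level_eq(2)[OF assms(1,2)] by blast
  then obtain i where "level g i \<noteq> level h i" "\<And>j. j < i \<Longrightarrow> level g j = level h j"
    using first_difference[of "\<lambda>i. level g i \<noteq> level h i"] by metis
  then have "scale i / 3 \<le> 0" using height_gap[OF assms(1,2)] assms(3) by fastforce
  then show False using scale_pos[of i] by simp
qed

text \<open>
  For \<open>c = 1\<close> the lap of \<open>g\<close> is the lowest one in its leg, for \<open>c = -1\<close> the highest one.
\<close>
definition extreme :: "int \<Rightarrow> (nat \<Rightarrow> nat) \<Rightarrow> nat \<Rightarrow> bool" where
  "extreme c g m \<longleftrightarrow> (\<forall>s l. s \<le> legs (Suc m) \<longrightarrow> l < N m \<longrightarrow> leg m l = strand g m \<longrightarrow>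
     c * level g m \<le> c * rank m s l)"

text \<open>
  Since the laps of \<open>g\<close> are even, their signs are positive, and being extreme is not turned over between
  levels.
\<close>
lemma approx_extreme:
  assumes c: "c = 1 \<or> c = -1" and g: "itinerary g" and h: "itinerary h"
    and "\<And>k. m \<le> k \<Longrightarrow> even (g k) \<and> extreme c g k" "strand h m = strand g m"
  shows "of_int c * approx d m g \<le> of_int c * approx d m h"
  using assms(4,5)
proof (induction d arbitrary: m)
  case (Suc d)
  have ev: "even (g m)" "extreme c g m" using Suc.prems by auto
  then have le: "c * level g m \<le> c * level h m"
    using Suc.prems(2) strand_le[of h "Suc m"] itineraryD[OF h, of m]
    unfolding extreme_def by (simp add: level_def[of h] strand_def[of h m])
  show ?case
  proof (cases "level g m = level h m")
    case False
    then show ?thesis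
      using c le approx_less[OF g h, of m d] approx_less[OF h g, of m d] by (elim disjE) simp_all
  next
    case True
    then have eq: "strand h (Suc m) = strand g (Suc m)" "g m = h m" using level_eq[OF g h] by auto
    then have "of_int c * approx d (Suc m) g \<le> of_int c * approx d (Suc m) h"
      using Suc.IH[of "Suc m"] Suc.prems by simp
    then have "shrink m * (of_int c * approx d (Suc m) g) \<le> shrink m * (of_int c * approx d (Suc m) h)"
      by (rule mult_left_mono[OF _ less_imp_le[OF shrink_pos]])
    moreover have "of_int c * approx (Suc d) m k =
        of_int c * of_int (level k m) + shrink m * (of_int c * approx d (Suc m) k)" if "even (k m)" for k
      using that by (simp add: algebra_simps)
    from this[of g] this[of h] have "of_int c * approx (Suc d) m h - of_int c * approx (Suc d) m g =
        shrink m * (of_int c * approx d (Suc m) h) - shrink m * (of_int c * approx d (Suc m) g)"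
      using True ev(1) eq(2) by simp
    ultimately show ?thesis by linarith
  qed
qed simp

definition isolated :: "(nat \<Rightarrow> nat) \<Rightarrow> bool" where
  "isolated g \<longleftrightarrow> (\<exists>r>0. (\<forall>h. itinerary h \<longrightarrow> \<not> (height g - r < height h \<and> height h < height g)) \<or>
                         (\<forall>h. itinerary h \<longrightarrow> \<not> (height g < height h \<and> height h < height g + r)))"

text \<open>
  If the ranks of \<open>g\<close> and \<open>h\<close> differ at one of the levels \<open>0, \<dots>, m\<close>, the heights differ by at least
  a fixed amount. Otherwise \<open>h\<close> lies in the same leg of level \<open>m + 1\<close> as \<open>g\<close>, hence on a fixed side of \<open>g\<close>.
\<close>
lemma isolatedI:
  assumes g: "itinerary g" and c: "c = 1 \<or> c = -1" and ext: "\<And>k. m \<le> k \<Longrightarrow> even (g k) \<and> extreme c g k"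
  shows "isolated g"
proof -
  define i where "i = Suc m"
  define r where "r = scale i / 3"
  have r: "0 < r" using scale_pos by (simp add: r_def)
  define o' where "o' = - of_int c * orient g i"
  have o': "o' = 1 \<or> o' = -1" using orient_cases[of g i] c by (auto simp: o'_def)
  have key: "r \<le> \<bar>height g - height h\<bar> \<or> 0 \<le> o' * (height g - height h)" if h: "itinerary h" for h
  proof (cases "\<exists>j<i. level g j \<noteq> level h j")
    case True
    then obtain j' where "j' < i" "level g j' \<noteq> level h j'" by blast
    then obtain j where "j < i" "level g j \<noteq> level h j" "\<And>k. k < j \<Longrightarrow> level g k = level h k"
      using first_difference[of "\<lambda>i. level g i \<noteq> level h i" j'] by (metis le_less_trans)
    then show ?thesis using height_gap[OF g h, of j] scale_antimono[of j i] by (simp add: r_def)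
  next
    case False
    then have eq: "level g j = level h j" if "j < i" for j using that by blast
    have st: "strand h i = strand g i" using level_eq(1)[OF g h eq[of m]] by (simp add: i_def)
    have sgn: "0 \<le> o' * (orient g i * scale i * (approx d i g - approx d i h))" for d
    proof -
      have "of_int c * approx d i g \<le> of_int c * approx d i h"
        using ext by (intro approx_extreme c g h st) (auto simp: i_def)
      then have "0 \<le> scale i * (of_int c * approx d i h - of_int c * approx d i g)"
        using scale_pos[of i] by simp
      also have "\<dots> = o' * (orient g i * scale i * (approx d i g - approx d i h))"
        using orient_cases[of g i] by (auto simp: o'_def algebra_simps)
      finally show ?thesis .
    qed
    have "(\<lambda>d. o' * (orient g i * scale i * (approx d i g - approx d i h))) \<longlonglongrightarrow> o' * (height g - height h)"
      by (intro tendsto_intros height_diff_tendsto g h eq)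
    then have "0 \<le> o' * (height g - height h)" using sgn by (intro LIMSEQ_le_const) auto
    then show ?thesis by blast
  qed
  show ?thesis
    unfolding isolated_def
  proof (intro exI[of _ r] conjI r)
    from o' show "(\<forall>h. itinerary h \<longrightarrow> \<not> (height g - r < height h \<and> height h < height g)) \<or>
        (\<forall>h. itinerary h \<longrightarrow> \<not> (height g < height h \<and> height h < height g + r))"
    proof
      assume "o' = 1"
      then have "\<forall>h. itinerary h \<longrightarrow> \<not> (height g < height h \<and> height h < height g + r)"
        using key by fastforce
      then show ?thesis by blast
    next
      assume "o' = -1"
      then have "\<forall>h. itinerary h \<longrightarrow> \<not> (height g - r < height h \<and> height h < height g)"
        using key by fastforce
      then show ?thesis by blast
    qed
  qed
qed

end

section \<open>Drawing an unlinked matching\<close>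

text \<open>
  The half arc at height \<open>a\<close> whose end is joined to the one at height \<open>b\<close> runs one unit horizontally and
  then along a line of slope \<open>1\<close> or \<open>-1\<close> to the tip of a wedge. After time \<open>t\<close> it is at horizontal distance
  \<open>reach a b t\<close> and at height \<open>a - bend a b t\<close>. The initial unit keeps the curve injective when \<open>a = b\<close>,
  which happens at an end point of the continuum. The two maxima make \<open>bend\<close> continuous where the
  sign of \<open>a - b\<close> changes.
\<close>
definition reach :: "real \<Rightarrow> real \<Rightarrow> real \<Rightarrow> real" where
  "reach a b t = (1 + \<bar>a - b\<bar> / 2) * t"

definition bend :: "real \<Rightarrow> real \<Rightarrow> real \<Rightarrow> real" where
  "bend a b t = max 0 ((1 + max 0 ((a - b) / 2)) * t - 1) - max 0 ((1 + max 0 ((b - a) / 2)) * t - 1)"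

lemma bend_eq:
  assumes "0 \<le> t" "t \<le> 1"
  shows "bend a b t = (if b \<le> a then max 0 (reach a b t - 1) else - max 0 (reach a b t - 1))"
  using assms by (auto simp: bend_def reach_def)

lemma reach_nonneg: "0 \<le> t \<Longrightarrow> 0 \<le> reach a b t"
  by (simp add: reach_def)

lemma reach_le: "0 \<le> t \<Longrightarrow> t \<le> 1 \<Longrightarrow> reach a b t \<le> 1 + \<bar>a - b\<bar> / 2"
  unfolding reach_def by (rule mult_left_le) auto

lemma reach_sym: "reach b a t = reach a b t"
  by (simp add: reach_def abs_minus_commute)

lemma reach_inj: "reach a b t = reach a b s \<longleftrightarrow> t = s"
proof -
  have "1 + \<bar>a - b\<bar> / 2 \<noteq> 0" by (smt (verit) abs_ge_zero divide_nonneg_pos)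
  then show ?thesis by (simp add: reach_def)
qed

lemma reach_pos: "0 < reach a b t \<longleftrightarrow> 0 < t"
  unfolding reach_def by (smt (verit) abs_ge_zero divide_nonneg_pos zero_less_mult_iff)

definition hits :: "(real \<times> real) set \<Rightarrow> real \<Rightarrow> real \<Rightarrow> bool" where
  "hits E x y \<longleftrightarrow> (\<exists>a b t. (a, b) \<in> E \<and> 0 \<le> t \<and> t \<le> 1 \<and> x = reach a b t \<and> y = a - bend a b t)"

lemma hitsE:
  assumes "hits E x y"
  obtains a b where "(a, b) \<in> E" "0 \<le> x" "x \<le> 1 + \<bar>a - b\<bar> / 2"
    "y = (if b \<le> a then a - max 0 (x - 1) else a + max 0 (x - 1))"
proof -
  obtain a b t where *: "(a, b) \<in> E" "0 \<le> t" "t \<le> 1" "x = reach a b t" "y = a - bend a b t"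
    using assms unfolding hits_def by blast
  show ?thesis
    using that[of a b] * reach_nonneg[of t a b] reach_le[of t a b] bend_eq[of t a b] by simp
qed

locale planar_matching =
  fixes E :: "(real \<times> real) set"
  assumes sym: "(a, b) \<in> E \<Longrightarrow> (b, a) \<in> E"
    and single: "(a, b) \<in> E \<Longrightarrow> (a, c) \<in> E \<Longrightarrow> b = c"
    and unlinked: "(a, b) \<in> E \<Longrightarrow> (c, d) \<in> E \<Longrightarrow> \<not> (a < c \<and> c < b \<and> b < d)"
begin

lemma arcs_meet_aux:
  assumes "(a, b) \<in> E" "(c, d) \<in> E" "c < d" "0 < w" "a - w = c + w" "w \<le> (a - b) / 2" "w \<le> (d - c) / 2"
  shows "b = c \<and> a = d"
proof -
  have le: "b \<le> c" "c < a" "a \<le> d" using assms by auto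
  have "\<not> (b < c \<and> c < a \<and> a < d)" using unlinked[OF sym[OF assms(1)] assms(2)] .
  then consider "b = c" | "a = d" using le by linarith
  then show ?thesis
  proof cases
    case 1
    then show ?thesis using single[OF sym[OF assms(1)], of d] assms(2) by simp
  next
    case 2
    then show ?thesis using single[OF assms(1), of c] sym[OF assms(2)] by simp
  qed
qed

text \<open>
  At horizontal distance \<open>1 + w\<close>, a wedge meets a given height only if the interval that it spans
  contains the interval of radius \<open>w\<close> about this height and has an end in common with it. Two
  different unlinked intervals without a common end cannot both do so.
\<close>
lemma arcs_meet:
  assumes E: "(a, b) \<in> E" "(c, d) \<in> E" and t: "0 \<le> t" "t \<le> 1" and s: "0 \<le> s" "s \<le> 1"
    and x: "reach a b t = reach c d s" and y: "a - bend a b t = c - bend c d s"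
  shows "(c = a \<and> s = t) \<or> (c = b \<and> t = 1 \<and> s = 1)"
proof -
  have same: ?thesis if "a = c"
    using that single[OF E(1), of d] E(2) x reach_inj[of a b t s] by simp
  define w where "w = reach a b t - 1"
  have w: "reach a b t = 1 + w" "reach c d s = 1 + w" using x by (auto simp: w_def)
  have wle: "w \<le> \<bar>a - b\<bar> / 2" "w \<le> \<bar>c - d\<bar> / 2"
    using reach_le[OF t, of a b] reach_le[OF s, of c d] w by auto
  have y': "(if b \<le> a then a - max 0 w else a + max 0 w) = (if d \<le> c then c - max 0 w else c + max 0 w)"
    using y bend_eq[OF t, of a b] bend_eq[OF s, of c d] w by (simp split: if_splits)
  show ?thesis
  proof (cases "0 < w")
    case False
    then show ?thesis using y' same by (simp split: if_splits)
  next
    case True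
    have full: "t = 1 \<and> s = 1" if "c = b" "d = a" "2 * w = \<bar>a - b\<bar>"
    proof -
      have "reach a b t = reach a b 1" "reach a b s = reach a b 1"
        using that w reach_sym[of a b s] by (auto simp: reach_def)
      then show ?thesis using reach_inj by blast
    qed
    consider "b \<le> a \<longleftrightarrow> d \<le> c" | "b \<le> a" "c < d" | "a < b" "d \<le> c" by linarith
    then show ?thesis
    proof cases
      case 1
      then show ?thesis using y' same by (simp split: if_splits)
    next
      case 2
      have "b = c \<and> a = d" using arcs_meet_aux[OF E 2(2) True] y' 2 wle True by simp
      then show ?thesis using full y' 2 True by simp
    next
      case 3
      have "d = a \<and> c = b" using arcs_meet_aux[OF E(2,1) 3(1) True] y' 3 wle True by simp
      then show ?thesis using full y' 3 True by simp
    qed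
  qed
qed

text \<open>
  There are three cases: on the horizontal part, and on the outer side of a wedge, one moves straight
  down; on the inner side of a wedge one moves horizontally into it. The last direction also serves
  at the tip, where a vertical segment could run into neighbouring wedges. A step \<open>(dx, dy)\<close> describes the
  segment.
\<close>
lemma access_below:
  assumes E: "(a, b) \<in> E" and t: "0 \<le> t" "t \<le> 1" and r: "0 < r"
    and iso: "\<And>c d. (c, d) \<in> E \<Longrightarrow> \<not> (a - r < c \<and> c < a)"
  shows "\<exists>dx dy. (dx, dy) \<noteq> (0, 0) \<and> (\<forall>s. 0 < s \<and> s \<le> 1 \<longrightarrow>
     \<not> hits E (reach a b t + s * dx) (a - bend a b t + s * dy) \<and>
     (if t = 0 then dx = 0 else 0 < reach a b t + s * dx))"
proof -
  define x where "x = reach a b t"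
  define y where "y = a - bend a b t"
  have x0: "0 \<le> x" "x \<le> 1 + \<bar>a - b\<bar> / 2" using reach_nonneg reach_le t by (auto simp: x_def)
  have y: "y = (if b \<le> a then a - max 0 (x - 1) else a + max 0 (x - 1))"
    using bend_eq[OF t, of a b] by (simp add: x_def y_def)
  have tx: "t = 0 \<longleftrightarrow> x = 0" "t \<noteq> 0 \<Longrightarrow> 0 < x" using reach_pos[of a b t] t x0 by (auto simp: x_def reach_def)
  consider (flat) "x \<le> 1" | (outer) "1 < x" "a < b" | (inner) "1 < x" "b \<le> a" by linarith
  then have "\<exists>dx dy. (dx, dy) \<noteq> (0, 0) \<and> (\<forall>s. 0 < s \<and> s \<le> 1 \<longrightarrow>
     \<not> hits E (x + s * dx) (y + s * dy) \<and> (if t = 0 then dx = 0 else 0 < x + s * dx))"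
  proof cases
    case flat
    have "\<not> hits E x (y + s * (- r / 2))" if s: "0 < s" "s \<le> 1" for s
    proof
      assume "hits E x (y + s * (- r / 2))"
      then obtain c d where cd: "(c, d) \<in> E" "y + s * (- r / 2) = (if d \<le> c then c - max 0 (x - 1) else c + max 0 (x - 1))"
        by (elim hitsE) blast
      define p where "p = s * r / 2"
      have p: "0 < p" "p \<le> r / 2" using s r by (auto simp: p_def mult_left_le_one_le)
      have "a - p = c" using cd(2) flat y by (simp add: p_def split: if_splits)
      then have "a - r < c \<and> c < a" using p r by simp
      then show False using iso[OF cd(1)] by blast
    qed
    then show ?thesis using r tx by (intro exI[of _ 0] exI[of _ "- r / 2"]) auto
  next
    case outer
    define w where "w = x - 1"
    \<comment> \<open>Up to \<open>r\<close> no arc parallel to this one interferes, up to \<open>2 * w\<close> no arc from the opposite side.\<close>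
    define q where "q = min r (2 * w)"
    have w: "0 < w" "x = 1 + w" "w \<le> (b - a) / 2" "y = a + w" and q: "0 < q" "q \<le> r" "q \<le> 2 * w"
      using outer x0 y r by (auto simp: w_def q_def field_simps)
    have "\<not> hits E x (y + s * (- q / 2))" if s: "0 < s" "s \<le> 1" for s
    proof
      assume "hits E x (y + s * (- q / 2))"
      then obtain c d where cd: "(c, d) \<in> E" "x \<le> 1 + \<bar>c - d\<bar> / 2"
          "y + s * (- q / 2) = (if d \<le> c then c - max 0 (x - 1) else c + max 0 (x - 1))"
        by (elim hitsE) blast
      define p where "p = s * q / 2"
      have p: "0 < p" "p \<le> q / 2" using s q by (auto simp: p_def mult_left_le_one_le)
      have e: "a + w - p = (if d \<le> c then c - w else c + w)" using cd(3) w by (simp add: p_def)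
      show False
      proof (cases "d \<le> c")
        case False
        then show False using e p q iso[OF cd(1)] by simp
      next
        case True
        then have c: "c = a + 2 * w - p" "d \<le> c - 2 * w" using e cd(2) w by auto
        have "\<not> (d < a \<and> a < c \<and> c < b)" using unlinked[OF sym[OF cd(1)] E] .
        moreover have "d < a" "a < c" "c < b" using c p q w by auto
        ultimately show False by blast
      qed
    qed
    moreover have "q / 2 \<noteq> 0" using q by simp
    ultimately show ?thesis using tx outer by (intro exI[of _ 0] exI[of _ "- q / 2"]) auto
  next
    case inner
    define w where "w = x - 1"
    \<comment> \<open>Staying within \<open>w\<close> keeps the segment inside the wedge.\<close>
    define q where "q = min r w"
    have w: "0 < w" "x = 1 + w" "w \<le> (a - b) / 2" "y = a - w" and q: "0 < q" "q \<le> r" "q \<le> w"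
      using inner x0 y r by (auto simp: w_def q_def field_simps)
    have "\<not> hits E (x + s * (- q / 2)) y \<and> 0 < x + s * (- q / 2)" if s: "0 < s" "s \<le> 1" for s
    proof
      define p where "p = s * q / 2"
      have p: "0 < p" "p \<le> q / 2" using s q by (auto simp: p_def mult_left_le_one_le)
      have xp: "x + s * (- q / 2) = 1 + (w - p)" using w by (simp add: p_def)
      show "0 < x + s * (- q / 2)" using xp p q by simp
      show "\<not> hits E (x + s * (- q / 2)) y"
      proof
        assume "hits E (x + s * (- q / 2)) y"
        then obtain c d where cd: "(c, d) \<in> E" "1 + (w - p) \<le> 1 + \<bar>c - d\<bar> / 2"
            "y = (if d \<le> c then c - max 0 (w - p) else c + max 0 (w - p))"
          unfolding xp by (elim hitsE) simp
        have e: "a - w = (if d \<le> c then c - (w - p) else c + (w - p))" using cd(3) w p q by (simp split: if_splits)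
        show False
        proof (cases "d \<le> c")
          case True
          then have "c = a - p" using e by simp
          then show False using p q iso[OF cd(1)] by simp
        next
          case False
          then have c: "c = a - 2 * w + p" "c + 2 * (w - p) \<le> d" using e cd(2) by auto
          have "\<not> (a - r < d \<and> d < a)" using iso[OF sym[OF cd(1)]] .
          then have ad: "a \<le> d" using c p q by simp
          have bc: "b < c" using c w p by simp
          show False
          proof (cases "a = d")
            case True
            then show False using single[OF E, of c] sym[OF cd(1)] bc by simp
          next
            case False
            have "\<not> (b < c \<and> c < a \<and> a < d)" using unlinked[OF sym[OF E] cd(1)] .
            then show False using bc False ad c p q w by simp
          qed
        qed
      qed
    qed
    moreover have "q / 2 \<noteq> 0" using q by simp
    ultimately show ?thesis using tx inner by (intro exI[of _ "- q / 2"] exI[of _ 0]) auto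
  qed
  then show ?thesis unfolding x_def y_def .
qed

end

lemma planar_matching_reflect:
  assumes "planar_matching E" shows "planar_matching {(- a, - b) |a b. (a, b) \<in> E}"
proof -
  interpret planar_matching E by fact
  show ?thesis
  proof
    fix a b c d :: real
    assume ab: "(a, b) \<in> {(- a, - b) |a b. (a, b) \<in> E}"
    then have ab': "(- a, - b) \<in> E" by auto
    show "(b, a) \<in> {(- a, - b) |a b. (a, b) \<in> E}" using sym[OF ab'] by force
    show "b = c" if "(a, c) \<in> {(- a, - b) |a b. (a, b) \<in> E}" using that single[OF ab', of "- c"] by auto
    assume "(c, d) \<in> {(- a, - b) |a b. (a, b) \<in> E}"
    then have cd': "(- c, - d) \<in> E" by auto
    show "\<not> (a < c \<and> c < b \<and> b < d)"
      using unlinked[OF sym[OF cd'] sym[OF ab']] by auto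
  qed
qed

lemma hits_reflect:
  assumes "hits E x y" shows "hits {(- a, - b) |a b. (a, b) \<in> E} x (- y)"
proof -
  obtain a b t where *: "(a, b) \<in> E" "0 \<le> t" "t \<le> 1" "x = reach a b t" "y = a - bend a b t"
    using assms unfolding hits_def by blast
  have "reach (- a) (- b) t = reach a b t" by (simp add: reach_def abs_minus_commute)
  moreover have "bend (- a) (- b) t = - bend a b t" by (simp add: bend_def)
  ultimately show ?thesis using * unfolding hits_def
    by (intro exI[of _ "- a"] exI[of _ "- b"] exI[of _ t]) auto
qed

context planar_matching
begin

lemma access:
  assumes E: "(a, b) \<in> E" and t: "0 \<le> t" "t \<le> 1" and r: "0 < r"
    and iso: "(\<forall>(c, d)\<in>E. \<not> (a - r < c \<and> c < a)) \<or> (\<forall>(c, d)\<in>E. \<not> (a < c \<and> c < a + r))"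
  shows "\<exists>dx dy. (dx, dy) \<noteq> (0, 0) \<and> (\<forall>s. 0 < s \<and> s \<le> 1 \<longrightarrow>
     \<not> hits E (reach a b t + s * dx) (a - bend a b t + s * dy) \<and>
     (if t = 0 then dx = 0 else 0 < reach a b t + s * dx))"
  using iso
proof
  assume "\<forall>(c, d)\<in>E. \<not> (a - r < c \<and> c < a)"
  then show ?thesis using access_below[OF E t r] by blast
next
  assume up: "\<forall>(c, d)\<in>E. \<not> (a < c \<and> c < a + r)"
  let ?E = "{(- a, - b) |a b. (a, b) \<in> E}"
  interpret M: planar_matching ?E by (rule planar_matching_reflect) (rule planar_matching_axioms)
  have E': "(- a, - b) \<in> ?E" using E by auto
  have iso': "\<not> (- a - r < c \<and> c < - a)" if "(c, d) \<in> ?E" for c d using that up by auto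
  have eq: "reach (- a) (- b) t = reach a b t" "- a - bend (- a) (- b) t = - (a - bend a b t)"
    by (auto simp: reach_def abs_minus_commute bend_def)
  obtain dx dy where *: "(dx, dy) \<noteq> (0, 0)" "\<And>s. 0 < s \<and> s \<le> 1 \<Longrightarrow>
     \<not> hits ?E (reach a b t + s * dx) (- (a - bend a b t) + s * dy) \<and>
     (if t = 0 then dx = 0 else 0 < reach a b t + s * dx)"
  proof -
    have "\<exists>dx dy. (dx, dy) \<noteq> (0, 0) \<and> (\<forall>s. 0 < s \<and> s \<le> 1 \<longrightarrow>
      \<not> hits ?E (reach a b t + s * dx) (- (a - bend a b t) + s * dy) \<and>
      (if t = 0 then dx = 0 else 0 < reach a b t + s * dx))"
      by (rule M.access_below[OF E' t r, unfolded eq]) (rule iso')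
    then show ?thesis using that by blast
  qed
  have "\<not> hits E (reach a b t + s * dx) (a - bend a b t + s * (- dy))" if "0 < s \<and> s \<le> 1" for s
  proof
    assume h: "hits E (reach a b t + s * dx) (a - bend a b t + s * (- dy))"
    have e: "- (a - bend a b t + s * (- dy)) = - (a - bend a b t) + s * dy" by simp
    have "hits ?E (reach a b t + s * dx) (- (a - bend a b t) + s * dy)"
      using hits_reflect[OF h] unfolding e .
    then show False using *(2)[OF that] by blast
  qed
  then show ?thesis using * by (intro exI[of _ dx] exI[of _ "- dy"]) auto
qed

end

section \<open>Heights that isolate given composants\<close>

lemma laps_blocks:
  assumes "i 0 = 0" "strict_mono i"
  shows "laps (\<lambda>m. laps n (i m) (i (Suc m))) 0 m = laps n 0 (i m)"
proof (induction m)
  case (Suc m)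
  have "i m \<le> i (Suc m)" using assms(2) by (simp add: strict_mono_less_eq)
  then show ?case using Suc laps_split[of 0 "i m" "i (Suc m)" n] by (simp add: laps_Suc)
qed (simp add: laps_def assms(1))

lemma laps_ge2:
  assumes n: "\<And>i. 2 \<le> n i" and ij: "i < j" shows "2 \<le> laps n i j"
proof -
  have "(2::nat) ^ 1 \<le> 2 ^ (j - i)" using ij by (intro power_increasing) auto
  also have "\<dots> \<le> laps n i j" by (rule laps_ge) (rule n)
  finally show ?thesis by simp
qed

lemma thread_block:
  assumes "thread n U" "strict_mono i"
  shows "thread (\<lambda>m. laps n (i m) (i (Suc m))) (\<lambda>m. U (i m))"
  unfolding thread_def using threadD(1,2)[OF assms(1)] thread_laps[OF assms(1)] assms(2)
  by (simp add: strict_mono_less_eq)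

lemma close_block:
  assumes "close n U V" "i 0 = 0" "strict_mono i"
  shows "close (\<lambda>m. laps n (i m) (i (Suc m))) (\<lambda>m. U (i m)) (\<lambda>m. V (i m))"
  using assms(1) unfolding close_def laps_blocks[of i n, OF assms(2,3)] by blast

lemma laminated_turnsI:
  assumes lev: "\<And>m. strand_level (N m) (R m) (R (Suc m)) (S m) (a m)"
  shows "laminated_turns N R (\<lambda>m. strand_level.leg (R m) (S m) (a m))
     (\<lambda>m. strand_level.rank (N m) (R m) (R (Suc m)) (S m) (a m))"
proof
  fix m
  interpret strand_level "N m" "R m" "R (Suc m)" "S m" "a m" by (rule lev)
  show "2 \<le> N m" by (rule N_ge)
  show "leg l \<le> R m" for l by (rule leg_le)
  show "s = t \<and> l = l'" if "s \<le> R (Suc m)" "t \<le> R (Suc m)" "l < N m" "l' < N m" "rank s l = rank t l'" for s t l l'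
    using rank_inj that by blast
  show "rank s l < rank t l'" if "s \<le> R (Suc m)" "t \<le> R (Suc m)" "l < N m" "l' < N m" "leg l < leg l'" for s t l l'
    using rank_leg_less that by blast
  show "rank s 0 < rank t 0" if "s < t" for s t using rank_first_less that by blast
  show "rank t l < rank s 0" if "t \<le> R (Suc m)" "l < N m" "0 < l" for s t l using rank_first_top that by blast
  show "leg (Suc l) = leg l" if "even l" for l using leg_outer_turn that by blast
  show "leg (Suc l) \<le> Suc (leg l) \<and> leg l \<le> Suc (leg (Suc l))" if "odd l" for l using leg_inner_turn that by blast
  show "\<not> (A < C \<and> C < B \<and> B < D)"
    if "even l \<longleftrightarrow> even l'" "Suc l < N m" "Suc l' < N m" "s \<le> R (Suc m)" "t \<le> R (Suc m)" "(s, l) \<noteq> (t, l')"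
      "(A = rank s l \<and> B = rank s (Suc l)) \<or> (A = rank s (Suc l) \<and> B = rank s l)"
      "(C = rank t l' \<and> D = rank t (Suc l')) \<or> (C = rank t (Suc l') \<and> D = rank t l')"
    for l l' s t A B C D
    using inner_turns_unlinked[of l l' s t A B C D] outer_turns_unlinked[of l l' s t A B C D] that by argo
qed

text \<open>
  The threads \<open>x s\<close> represent the composants. Only the first representative in each class of close
  threads becomes a target, as the others would ask for the same laps. Target \<open>s\<close> is served from level
  \<open>s + 1\<close> on, because its parity has settled by then. The thread \<open>x 0 = 0\<close> has lap \<open>0\<close> throughout and is
  extreme at the top.
\<close>
theorem isolating_system:
  fixes n :: "nat \<Rightarrow> nat" and x :: "nat \<Rightarrow> nat \<Rightarrow> real"
  assumes n: "\<And>i. 2 \<le> n i" and x: "\<And>s. thread n (x s)" and x0: "x 0 = (\<lambda>_. 0)"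
  obtains i legs leg rank where "i 0 = 0" "strict_mono i"
    "laminated_turns (\<lambda>m. laps n (i m) (i (Suc m))) legs leg rank"
    "\<forall>U s g. thread n U \<longrightarrow> close n (x s) U \<longrightarrow>
       (\<forall>m. on_lap (laps n (i m) (i (Suc m))) (g m) (U (i m)) (U (i (Suc m)))) \<longrightarrow>
       laminated_turns.isolated (\<lambda>m. laps n (i m) (i (Suc m))) legs leg rank g"
proof -
  have "\<exists>G. \<forall>r. on_lap (n r) (G r) (x s r) (x s (Suc r))" for s
  proof -
    have "\<exists>l. on_lap (n r) l (x s r) (x s (Suc r))" for r
      using n[of r] threadD[OF x[of s]] by (intro on_lap_exists) auto
    then show ?thesis by metis
  qed
  then obtain G where G: "\<And>s r. on_lap (n r) (G s r) (x s r) (x s (Suc r))" by metis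
  obtain i where i: "i 0 = 0" "strict_mono i"
    "\<And>m s. s < m \<Longrightarrow> even (\<Sum>r<i m. G s r) \<longleftrightarrow> even (\<Sum>r<i (Suc m). G s r)"
    "\<And>m s t. s \<le> Suc m \<Longrightarrow> t \<le> Suc m \<Longrightarrow> \<not> close n (x s) (x t) \<Longrightarrow>
       real (4 * Suc m + 6) \<le> real (laps n (i m) (i (Suc m))) * \<bar>x s (i (Suc m)) - x t (i (Suc m))\<bar>"
    using block_choice[of n x G "\<lambda>m. real (4 * Suc m + 6)"] n x by blast
  have ile: "i m < i (Suc m)" for m using i(2) by (simp add: strict_mono_less)
  define N where "N m = laps n (i m) (i (Suc m))" for m
  \<comment> \<open>the lap of the block that starts at level \<open>i m\<close> in which \<open>x s\<close> lies\<close>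
  define a where "a m s = (SOME k. on_lap (N m) k (x s (i m)) (x s (i (Suc m))) \<and>
      (even k \<longleftrightarrow> even (\<Sum>r\<in>{i m..<i (Suc m)}. G s r)))" for m s
  have a: "on_lap (N m) (a m s) (x s (i m)) (x s (i (Suc m)))"
    "even (a m s) \<longleftrightarrow> even (\<Sum>r\<in>{i m..<i (Suc m)}. G s r)" for m s
    using someI_ex[OF on_lap_block[of n "G s" "x s" "i m" "i (Suc m)"]] n G ile[of m]
    unfolding a_def N_def by (auto simp: less_imp_le)
  have even_a: "even (a m s)" if "s < m" for m s
  proof -
    have "(\<Sum>r<i (Suc m). G s r) = (\<Sum>r<i m. G s r) + (\<Sum>r\<in>{i m..<i (Suc m)}. G s r)"
      using sum.atLeastLessThan_concat[of 0 "i m" "i (Suc m)" "G s"] ile[of m] by (simp add: lessThan_atLeast0)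
    then have "even (\<Sum>r\<in>{i m..<i (Suc m)}. G s r)" using i(3)[OF that] by (metis even_add)
    then show ?thesis using a(2) by simp
  qed
  define act where "act s \<longleftrightarrow> (\<forall>t<s. \<not> close n (x t) (x s))" for s
  define S where "S m = {s. 1 \<le> s \<and> s < m \<and> act s}" for m
  have near: "real (a m s) \<le> real (N m) * x s (i (Suc m))" "real (N m) * x s (i (Suc m)) \<le> real (a m s) + 1" for m s
    using on_lap_near[OF a(1)] threadD[OF x[of s]] by auto
  \<comment> \<open>Passing from coordinates to laps costs at most \<open>1\<close> for each of the two threads.\<close>
  have sep: "4 * Suc m + 4 + a m s \<le> a m t \<or> 4 * Suc m + 4 + a m t \<le> a m s"
    if "s \<le> Suc m" "t \<le> Suc m" "\<not> close n (x s) (x t)" for m s t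
  proof -
    have "real (4 * Suc m + 6) \<le> real (N m) * \<bar>x s (i (Suc m)) - x t (i (Suc m))\<bar>"
      using i(4)[OF that] by (simp add: N_def)
    also have "\<dots> = \<bar>real (N m) * x s (i (Suc m)) - real (N m) * x t (i (Suc m))\<bar>"
      by (simp add: abs_mult flip: right_diff_distrib)
    finally show ?thesis using near[of m s] near[of m t] by linarith
  qed
  have N2: "2 \<le> N m" for m unfolding N_def by (rule laps_ge2[of n, OF n ile])
  have a0: "a m 0 = 0" for m
  proof -
    have z: "on_lap (N m) (a m 0) 0 0" using a(1)[of m 0] x0 by simp
    then show ?thesis by (auto simp: on_lap_def split: if_splits)
  qed
  have lev: "strand_level (N m) (Suc m) (Suc (Suc m)) (S m) (a m)" for m
  proof
    fix s assume s: "s \<in> S m"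
    then have s': "1 \<le> s" "s < m" "act s" by (auto simp: S_def)
    show "1 \<le> s \<and> s \<le> Suc m" using s' by simp
    show "a m s < N m" using a(1) by (simp add: on_lap_def)
    show "even (a m s)" using even_a s' by simp
    have "\<not> close n (x 0) (x s)" using s' unfolding act_def by simp
    then show "4 * Suc m + 4 \<le> a m s" using sep[of 0 m s] s' a0[of m] by simp
    fix t assume t: "t \<in> S m" "s \<noteq> t"
    then have "\<not> close n (x s) (x t)" using s t(2) close_sym unfolding S_def act_def
      by (metis (mono_tags, lifting) linorder_neqE_nat mem_Collect_eq)
    then show "4 * Suc m + 4 + a m s \<le> a m t \<or> 4 * Suc m + 4 + a m t \<le> a m s"
      using sep[of s m t] s' t by (simp add: S_def)
  qed (use N2 in auto)
  define legs where "legs m = Suc m" for m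
  define leg where "leg m = strand_level.leg (legs m) (S m) (a m)" for m
  define rank where "rank m = strand_level.rank (N m) (legs m) (legs (Suc m)) (S m) (a m)" for m
  have lev': "strand_level (N m) (legs m) (legs (Suc m)) (S m) (a m)" for m
    using lev by (simp add: legs_def)
  interpret laminated_turns N legs leg rank
    using laminated_turnsI[of N legs S a, OF lev'] unfolding leg_def[abs_def] rank_def[abs_def] .
  have iso: "isolated g" if U: "thread n U" "close n (x s) U"
      and g: "\<And>m. on_lap (N m) (g m) (U (i m)) (U (i (Suc m)))" for U s g
  proof -
    \<comment> \<open>the index of the target in the class of \<open>U\<close>\<close>
    define t where "t = (LEAST t. close n (x t) U)"
    have tU: "close n (x t) U" unfolding t_def using U(2) by (rule LeastI)
    have act: "act t" unfolding act_def
    proof (intro allI impI notI)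
      fix t' assume "t' < t" "close n (x t') (x t)"
      then show False using not_less_Least[of t' "\<lambda>t. close n (x t) U"] close_trans tU unfolding t_def by blast
    qed
    have itg: "itinerary g" using g by (simp add: itinerary_def on_lap_def)
    obtain m0 where m0: "\<And>m. m0 \<le> m \<Longrightarrow> a m t = g m"
    proof -
      have "\<exists>m0. \<forall>m\<ge>m0. a m t = g m"
        using close_codes_agree[of N "\<lambda>m. x t (i m)" "\<lambda>m. U (i m)" "\<lambda>m. a m t" g]
          N2 thread_block[OF x i(2)] thread_block[OF U(1) i(2)] close_block[OF tU i(1,2)] a(1) g
        unfolding N_def by blast
      then show ?thesis using that by blast
    qed
    show ?thesis
    proof (cases "t = 0")
      case True
      have g0: "g m = 0" if "m0 \<le> m" for m using m0[OF that] a0 True by simp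
      have "even (g k) \<and> extreme (-1) g k" if k: "m0 \<le> k" for k
      proof -
        have "strand g (Suc k) = legs (Suc k)"
          using strand_level.leg_0[OF lev', of "Suc k"] g0[of "Suc k"] k by (simp add: strand_def leg_def)
        then have lv: "level g k = rank k (legs (Suc k)) 0" using g0[OF k] by (simp add: level_def)
        have "rank k s l \<le> level g k" if "s \<le> legs (Suc k)" "l < N k" for s l
        proof (cases "l = 0")
          case True
          then show ?thesis using rank_first_less[of s "legs (Suc k)" k] that lv by (cases "s = legs (Suc k)") auto
        next
          case False
          then show ?thesis using rank_first_top[OF that, of "legs (Suc k)"] lv by simp
        qed
        then show ?thesis using g0[OF k] by (simp add: extreme_def)
      qed
      then show ?thesis by (intro isolatedI[OF itg, of "-1" m0]) auto
    next
      case False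
      define m1 where "m1 = max m0 (Suc t)"
      have tS: "t \<in> S m" if "m1 \<le> m" for m using that False act by (simp add: S_def m1_def)
      have gt: "g m = a m t" if "m1 \<le> m" for m using m0[of m] that by (simp add: m1_def)
      have st: "strand g m = t" if "m1 \<le> m" for m
        using strand_level.leg_target[OF lev' tS[OF that]] gt[OF that] by (simp add: strand_def leg_def)
      have "even (g k) \<and> extreme 1 g k" if k: "m1 \<le> k" for k
      proof -
        have lv: "level g k = rank k t (a k t)" using st[of "Suc k"] gt[OF k] k by (simp add: level_def)
        have "level g k \<le> rank k s l" if "s \<le> legs (Suc k)" "l < N k" "leg k l = t" for s l
          using strand_level.rank_target[OF lev' tS[OF k] that[unfolded leg_def]] lv by (simp add: rank_def)
        then show ?thesis using st[OF k] gt[OF k] even_a[of t k] k by (simp add: extreme_def m1_def)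
      qed
      then show ?thesis by (intro isolatedI[OF itg, of 1 m1]) auto
    qed
  qed
  show ?thesis
  proof (rule that[of i legs leg rank])
    have N: "N = (\<lambda>m. laps n (i m) (i (Suc m)))" by (simp add: N_def[abs_def])
    show "laminated_turns (\<lambda>m. laps n (i m) (i (Suc m))) legs leg rank"
      using laminated_turns_axioms unfolding N .
    show "\<forall>U s g. thread n U \<longrightarrow> close n (x s) U \<longrightarrow>
       (\<forall>m. on_lap (laps n (i m) (i (Suc m))) (g m) (U (i m)) (U (i (Suc m)))) \<longrightarrow>
       laminated_turns.isolated (\<lambda>m. laps n (i m) (i (Suc m))) legs leg rank g"
      using iso unfolding N by blast
  qed (fact i(1) i(2))+
qed

section \<open>Drawing a system of tent maps\<close>

context laminated_turns
begin

definition val :: "bool \<Rightarrow> real" where "val e = (if e then 1 else 0)"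

definition codes :: "(nat \<Rightarrow> nat) \<Rightarrow> (nat \<Rightarrow> real) \<Rightarrow> bool" where
  "codes g V \<longleftrightarrow> (\<forall>m. 0 \<le> V m \<and> V m \<le> 1 \<and> on_lap (N m) (g m) (V m) (V (Suc m)))"

lemma codesD:
  assumes "codes g V"
  shows "0 \<le> V m" "V m \<le> 1" "g m < N m"
    "real (N m) * V (Suc m) = real (g m) + (if even (g m) then V m else 1 - V m)"
  using assms by (auto simp: codes_def on_lap_def)

lemma codes_itinerary: "codes g V \<Longrightarrow> itinerary g"
  by (auto simp: itinerary_def dest: codesD(3))

lemma N_real: "0 < real (N m)" "2 \<le> real (N m)"
  using N_ge[of m] by linarith+

lemma codes_determine:
  assumes "codes g V" "codes g W" "V 0 = W 0" shows "V = W"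
proof
  fix m show "V m = W m"
  proof (induction m)
    case (Suc m)
    then have "real (N m) * V (Suc m) = real (N m) * W (Suc m)" using codesD(4) assms by presburger
    then show ?case using N_real(1)[of m] by simp
  qed (rule assms)
qed

text \<open>
  A coordinate at an end of \<open>[0,1]\<close> forces all lower coordinates to be at ends.
\<close>
lemma end_below:
  assumes "codes g V" "V (Suc m) = val e"
  obtains d where "V m = val d" "next_end m d (g m) = Some e"
proof (cases e)
  case False
  then have s: "real (g m) + (if even (g m) then V m else 1 - V m) = 0"
    using codesD(4)[OF assms(1), of m] assms(2) by (simp add: val_def)
  have "real (g m) = 0" using s codesD(1,2)[OF assms(1), of m] by (auto split: if_splits)
  then have "g m = 0" "V m = val False" using s by (auto simp: val_def)
  then show ?thesis using that[of False] False by (simp add: next_end_def)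
next
  case True
  then have s: "real (g m) + (if even (g m) then V m else 1 - V m) = real (N m)"
    using codesD(4)[OF assms(1), of m] assms(2) by (simp add: val_def)
  have g: "real (g m) + 1 \<le> real (N m)" using codesD(3)[OF assms(1), of m] by linarith
  then have gm: "real (g m) + 1 = real (N m)" using s codesD(1,2)[OF assms(1), of m] by (auto split: if_splits)
  then have "g m = N m - 1" by linarith
  moreover have "g m \<noteq> 0" using gm N_real(2)[of m] by auto
  moreover have "V m = val (even (g m))" using s gm by (auto simp: val_def split: if_splits)
  ultimately show ?thesis using that[of "even (g m)"] True by (simp add: next_end_def)
qed

lemma end_all_below:
  assumes "codes g V" "V k = val e" "j \<le> k"
  shows "\<exists>d. V j = val d \<and> flip j d g = flip k e g"
  using assms(3)
proof (induction j rule: inc_induct)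
  case base
  then show ?case using assms(2) by blast
next
  case (step j)
  then obtain d where d: "V (Suc j) = val d" "flip (Suc j) d g = flip k e g" by blast
  obtain c where "V j = val c" "next_end j c (g j) = Some d" using end_below[OF assms(1) d(1)] by blast
  then show ?case using flip_continue[of j c g d] d(2) by auto
qed

lemma itinerary_change:
  assumes g: "codes g V" and h: "codes h V" and ne: "g k \<noteq> h k"
  obtains e where "V k = val e" "next_end k e (g k) = None" "h k = partner e (g k)"
    "V (Suc k) \<noteq> 0" "V (Suc k) \<noteq> 1"
proof -
  define x where "x = (if even (g k) then V k else 1 - V k)"
  define y where "y = (if even (h k) then V k else 1 - V k)"
  have xy: "0 \<le> x" "x \<le> 1" "0 \<le> y" "y \<le> 1" using codesD(1,2)[OF g, of k] by (auto simp: x_def y_def)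
  have eq: "real (g k) + x = real (h k) + y" "real (N k) * V (Suc k) = real (g k) + x"
    using codesD(4)[OF g, of k] codesD(4)[OF h, of k] by (simp_all add: x_def y_def)
  consider "g k < h k" | "h k < g k" using ne by linarith
  then show ?thesis
  proof cases
    case 1
    then have "real (g k) + 1 \<le> real (h k)" by linarith
    then have x1: "x = 1" "real (h k) = real (g k) + 1" using eq xy by linarith+
    have hk: "h k = Suc (g k)" using x1(2) by linarith
    have "V k = val (even (g k))" using x1(1) by (auto simp: x_def val_def split: if_splits)
    moreover have "next_end k (even (g k)) (g k) = None"
      using hk codesD(3)[OF h, of k] by (auto simp: next_end_def odd_pos)
    moreover have "h k = partner (even (g k)) (g k)" using hk by (simp add: partner_def)
    moreover have "real (N k) * V (Suc k) = real (h k)" using eq(2) x1 by simp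
    then have "V (Suc k) \<noteq> 0" "V (Suc k) \<noteq> 1" using hk codesD(3)[OF h, of k] by auto
    ultimately show ?thesis using that by blast
  next
    case 2
    then have "real (h k) + 1 \<le> real (g k)" by linarith
    then have x0: "x = 0" "real (g k) = real (h k) + 1" using eq xy by linarith+
    have gk: "g k = Suc (h k)" using x0(2) by linarith
    have "V k = val (odd (g k))" using x0(1) by (auto simp: x_def val_def split: if_splits)
    moreover have "next_end k (odd (g k)) (g k) = None"
      using gk by (auto simp: next_end_def)
    moreover have "h k = partner (odd (g k)) (g k)" using gk by (simp add: partner_def)
    moreover have "real (N k) * V (Suc k) = real (g k)" using eq(2) x0 by simp
    then have "V (Suc k) \<noteq> 0" "V (Suc k) \<noteq> 1" using gk codesD(3)[OF g, of k] by auto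
    ultimately show ?thesis using that by blast
  qed
qed

text \<open>
  At the first difference the point is at a turning point, hence it has no choice at higher levels,
  while all lower coordinates are ends.
\<close>
lemma two_codes:
  assumes g: "codes g V" and h: "codes h V" and ne: "g \<noteq> h"
  obtains e where "V 0 = val e" "h = flip 0 e g"
proof -
  obtain r where "g r \<noteq> h r" using ne by blast
  then obtain k where k: "g k \<noteq> h k" "\<And>j. j < k \<Longrightarrow> g j = h j"
    using first_difference[of "\<lambda>i. g i \<noteq> h i"] by metis
  obtain e where e: "V k = val e" "next_end k e (g k) = None" "h k = partner e (g k)"
    "V (Suc k) \<noteq> 0" "V (Suc k) \<noteq> 1" using itinerary_change[OF g h k(1)] by blast
  have after: "g j = h j" if kj: "k < j" for j
  proof (rule ccontr)
    assume "g j \<noteq> h j"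
    then obtain d where "V j = val d" using itinerary_change[OF g h] by metis
    then obtain c where "V (Suc k) = val c" using end_all_below[OF g, of j d "Suc k"] kj by auto
    then show False using e(4,5) by (auto simp: val_def split: if_splits)
  qed
  have "flip k e g = h"
    using flip_stop[of k e g, OF e(2)] e(3) k(2) after by (auto simp: fun_eq_iff nat_neq_iff)
  then show ?thesis using end_all_below[OF g e(1), of 0] that by auto
qed

lemma flip_same_point:
  assumes g: "codes g V" and h: "codes h W" and hf: "h = flip 0 e g" and V0: "V 0 = val e" and W0: "W 0 = val e"
  shows "V = W"
proof -
  have "(\<exists>c. V m = val c \<and> W m = val c \<and> (\<forall>i\<ge>m. h i = flip m c g i)) \<or> (V m = W m \<and> (\<forall>i\<ge>m. h i = g i))" for m
  proof (induction m)
    case 0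
    then show ?case using hf V0 W0 by blast
  next
    case (Suc m)
    note V = codesD(4)[OF g, of m] and W = codesD(4)[OF h, of m]
    have cancel: "V (Suc m) = W (Suc m)" if "real (N m) * V (Suc m) = real (N m) * W (Suc m)"
      using that N_real(1)[of m] by simp
    from Suc show ?case
    proof (elim disjE exE conjE)
      fix c assume c: "V m = val c" "W m = val c" "\<forall>i\<ge>m. h i = flip m c g i"
      show ?thesis
      proof (cases "next_end m c (g m)")
        case (Some d)
        have fl: "flip m c g = flip (Suc m) d g" "flip m c g m = g m"
          using Some flip_continue[of m c g, OF Some] by (auto simp: flip_def)
        have hm: "h m = g m" using c(3) fl(2) by simp
        have "real (g m) + (if even (g m) then val c else 1 - val c) = real (N m) * val d"
        proof -
          have "(g m = 0 \<and> \<not> c \<and> \<not> d) \<or> (g m = N m - 1 \<and> (c \<longleftrightarrow> even (g m)) \<and> g m \<noteq> 0 \<and> d)"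
            using Some by (simp add: next_end_Some)
          then show ?thesis
          proof
            assume "g m = 0 \<and> \<not> c \<and> \<not> d"
            then show ?thesis by (simp add: val_def)
          next
            assume *: "g m = N m - 1 \<and> (c \<longleftrightarrow> even (g m)) \<and> g m \<noteq> 0 \<and> d"
            then have "real (g m) + 1 = real (N m)" using N_ge[of m] by linarith
            then show ?thesis using * by (simp add: val_def)
          qed
        qed
        then have "real (N m) * V (Suc m) = real (N m) * val d" "real (N m) * W (Suc m) = real (N m) * val d"
          using V W c(1,2) hm by auto
        then have "V (Suc m) = val d" "W (Suc m) = val d" using N_real(1)[of m] by auto
        then show ?thesis using c(3) fl(1) by auto
      next
        case None
        have fl: "flip m c g = g(m := partner c (g m))" using flip_stop[of m c g, OF None] .
        have hm: "h m = partner c (g m)" using c(3) fl by simp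
        have "real (g m) + (if even (g m) then val c else 1 - val c) = real (h m) + (if even (h m) then val c else 1 - val c)"
        proof (cases "c \<longleftrightarrow> even (g m)")
          case True
          then show ?thesis using hm by (auto simp: partner_def val_def)
        next
          case False
          then obtain l where "g m = Suc l" using None by (cases "g m") (auto simp: next_end_def)
          then show ?thesis using hm False by (auto simp: partner_def val_def)
        qed
        then have "V (Suc m) = W (Suc m)" by (intro cancel) (unfold V W c(1,2))
        moreover have "\<forall>i\<ge>Suc m. h i = g i" using c(3) fl by simp
        ultimately show ?thesis by blast
      qed
    next
      assume eq: "V m = W m" "\<forall>i\<ge>m. h i = g i"
      then have "V (Suc m) = W (Suc m)" using V W by (intro cancel) simp
      then show ?thesis using eq(2) by simp
    qed
  qed
  then have "V m = W m" for m by metis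
  then show ?thesis by blast
qed

definition matching :: "bool \<Rightarrow> (real \<times> real) set" where
  "matching e = {(height g, height (flip 0 e g)) |g. itinerary g}"

lemma matching_planar: "planar_matching (matching e)"
proof
  fix a b c d :: real
  assume ab: "(a, b) \<in> matching e"
  then obtain g where g: "itinerary g" "a = height g" "b = height (flip 0 e g)" by (auto simp: matching_def)
  show "(b, a) \<in> matching e"
    using g flip_itinerary[OF g(1)] flip_flip[OF g(1)] unfolding matching_def by force
  show "b = c" if "(a, c) \<in> matching e"
  proof -
    obtain h where h: "itinerary h" "a = height h" "c = height (flip 0 e h)" using \<open>(a, c) \<in> matching e\<close> by (auto simp: matching_def)
    then show ?thesis using height_inj[OF g(1) h(1)] g by simp
  qed
  assume "(c, d) \<in> matching e"
  then obtain h where h: "itinerary h" "c = height h" "d = height (flip 0 e h)" by (auto simp: matching_def)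
  show "\<not> (a < c \<and> c < b \<and> b < d)" using height_unlinked[OF g(1) h(1), of e] g h by blast
qed

text \<open>
  The arc is drawn from its middle \<open>x\<^sub>0 = 1/2\<close>: the half towards \<open>x\<^sub>0 = 0\<close> runs to the left and the half
  towards \<open>x\<^sub>0 = 1\<close> to the right. At any time, one of the two times is \<open>0\<close>, and its terms vanish.
\<close>
definition left_time :: "real \<Rightarrow> real" where "left_time t = max 0 (1 - 2 * t)"
definition right_time :: "real \<Rightarrow> real" where "right_time t = max 0 (2 * t - 1)"

definition draw_x :: "real \<Rightarrow> (nat \<Rightarrow> nat) \<Rightarrow> real" where
  "draw_x t g = reach (height g) (height (flip 0 True g)) (right_time t)
              - reach (height g) (height (flip 0 False g)) (left_time t)"

definition draw_y :: "real \<Rightarrow> (nat \<Rightarrow> nat) \<Rightarrow> real" where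
  "draw_y t g = height g - bend (height g) (height (flip 0 False g)) (left_time t)
              - bend (height g) (height (flip 0 True g)) (right_time t)"

lemma bend_1: "bend a b 1 = (a - b) / 2" by (simp add: bend_def max_def field_simps)

text \<open>
  The time on the half that leads to the end \<open>e\<close>, and the direction in which this half is drawn; they let
  both halves be treated at once.
\<close>
definition side :: "bool \<Rightarrow> real \<Rightarrow> real" where
  "side e t = (if e then 2 * t - 1 else 1 - 2 * t)"

definition dir :: "bool \<Rightarrow> real" where
  "dir e = (if e then 1 else -1)"

lemma draw_side:
  assumes "0 \<le> side e t"
  shows "draw_x t g = dir e * reach (height g) (height (flip 0 e g)) (side e t)"
    "draw_y t g = height g - bend (height g) (height (flip 0 e g)) (side e t)"
proof -
  have "left_time t = (if e then 0 else side e t)" "right_time t = (if e then side e t else 0)"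
    using assms by (auto simp: left_time_def right_time_def side_def)
  then show "draw_x t g = dir e * reach (height g) (height (flip 0 e g)) (side e t)"
    "draw_y t g = height g - bend (height g) (height (flip 0 e g)) (side e t)"
    by (auto simp: draw_x_def draw_y_def dir_def reach_def bend_def)
qed

lemma dir_cases: "dir e = 1 \<or> dir e = -1"
  by (simp add: dir_def)

lemma side_inj: "side e t = side e s \<longleftrightarrow> t = s"
  by (simp add: side_def)

lemma side_end: "side e t = 1 \<longleftrightarrow> t = val e"
  by (auto simp: side_def val_def)

lemma side_le: "0 \<le> t \<Longrightarrow> t \<le> 1 \<Longrightarrow> side e t \<le> 1"
  by (simp add: side_def)

lemma draw_well_defined:
  assumes g: "codes g V" and h: "codes h V"
  shows "draw_x (V 0) g = draw_x (V 0) h \<and> draw_y (V 0) g = draw_y (V 0) h"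
proof (cases "g = h")
  case False
  obtain e where e: "V 0 = val e" "h = flip 0 e g" using two_codes[OF g h False] by blast
  have fh: "flip 0 e h = g" using e(2) flip_flip[OF codes_itinerary[OF g]] by simp
  have s: "side e (V 0) = 1" using e(1) side_end by blast
  have "draw_x (V 0) k = dir e * reach (height k) (height (flip 0 e k)) 1"
    "draw_y (V 0) k = (height k + height (flip 0 e k)) / 2" for k
    using draw_side[of e "V 0" k] s by (auto simp: bend_1 field_simps)
  from this[of g] this[of h] show ?thesis
    unfolding fh e(2)[symmetric] using reach_sym[of "height h" "height g" 1] by (simp add: add.commute)
qed simp

lemma draw_x_sign: "0 \<le> dir e * draw_x t g \<longleftrightarrow> 0 \<le> side e t"
proof -
  have pos: "0 < dir c * draw_x t g" if "0 < side c t" for c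
  proof -
    have "draw_x t g = dir c * reach (height g) (height (flip 0 c g)) (side c t)"
      using that by (intro draw_side) simp
    moreover have "0 < reach (height g) (height (flip 0 c g)) (side c t)" using that reach_pos by blast
    ultimately show ?thesis using dir_cases[of c] by auto
  qed
  have "side (\<not> e) t = - side e t" "dir (\<not> e) = - dir e" by (auto simp: side_def dir_def)
  then consider "0 < side e t" | "0 < side (\<not> e) t" | "side e t = 0" by linarith
  then show ?thesis
  proof cases
    case 3
    then show ?thesis using draw_side(1)[of e t g] by (simp add: reach_def)
  qed (use pos[of e] pos[of "\<not> e"] \<open>side (\<not> e) t = - side e t\<close> \<open>dir (\<not> e) = - dir e\<close> in auto)
qed

lemma side_exists: obtains e where "0 \<le> side e t"
  by (cases "1 / 2 \<le> t") (auto simp: side_def intro: that[of True] that[of False])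

lemma in_matching: "itinerary g \<Longrightarrow> (height g, height (flip 0 e g)) \<in> matching e"
  unfolding matching_def by blast

lemma draw_injective:
  assumes g: "codes g V" and h: "codes h W"
    and eq: "draw_x (V 0) g = draw_x (W 0) h" "draw_y (V 0) g = draw_y (W 0) h"
  shows "V = W"
proof -
  note V0 = codesD(1,2)[OF g, of 0] and W0 = codesD(1,2)[OF h, of 0]
  note it = codes_itinerary[OF g] codes_itinerary[OF h]
  obtain e where e: "0 \<le> side e (V 0)" by (rule side_exists)
  have e': "0 \<le> side e (W 0)" using e draw_x_sign[of e] eq(1) by metis
  interpret planar_matching "matching e" by (rule matching_planar)
  have "reach (height g) (height (flip 0 e g)) (side e (V 0)) = reach (height h) (height (flip 0 e h)) (side e (W 0))"
    using eq(1) draw_side(1)[OF e, of g] draw_side(1)[OF e', of h] dir_cases[of e] by auto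
  moreover have "height g - bend (height g) (height (flip 0 e g)) (side e (V 0)) =
      height h - bend (height h) (height (flip 0 e h)) (side e (W 0))"
    using eq(2) draw_side(2)[OF e, of g] draw_side(2)[OF e', of h] by simp
  ultimately have "(height h = height g \<and> side e (W 0) = side e (V 0)) \<or>
      (height h = height (flip 0 e g) \<and> side e (V 0) = 1 \<and> side e (W 0) = 1)"
    using e e' side_le V0 W0 by (intro arcs_meet[OF in_matching[OF it(1)] in_matching[OF it(2)]]) auto
  then show ?thesis
  proof
    assume *: "height h = height g \<and> side e (W 0) = side e (V 0)"
    then have "h = g" using height_inj it by blast
    then show ?thesis using codes_determine[OF g] h * side_inj by auto
  next
    assume *: "height h = height (flip 0 e g) \<and> side e (V 0) = 1 \<and> side e (W 0) = 1"
    then have "h = flip 0 e g" using height_inj[OF it(2) flip_itinerary[OF it(1)]] by blast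
    then show ?thesis using flip_same_point[OF g h] * side_end by blast
  qed
qed

lemma draw_hits:
  assumes h: "codes h W" and s: "0 \<le> dir e * draw_x (W 0) h"
  shows "hits (matching e) (dir e * draw_x (W 0) h) (draw_y (W 0) h)"
proof -
  have t: "0 \<le> side e (W 0)" "side e (W 0) \<le> 1" using s draw_x_sign side_le codesD(1,2)[OF h, of 0] by auto
  have "dir e * draw_x (W 0) h = reach (height h) (height (flip 0 e h)) (side e (W 0))"
    using draw_side(1)[OF t(1), of h] dir_cases[of e] by auto
  then show ?thesis
    unfolding hits_def using in_matching[OF codes_itinerary[OF h], of e] draw_side(2)[OF t(1), of h] t by blast
qed

lemma draw_access:
  assumes g: "codes g V" and iso: "isolated g"
  shows "\<exists>dx dy. (dx, dy) \<noteq> (0, 0) \<and> (\<forall>s h W. 0 < s \<and> s \<le> 1 \<and> codes h W \<longrightarrow>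
     \<not> (draw_x (W 0) h = draw_x (V 0) g + s * dx \<and> draw_y (W 0) h = draw_y (V 0) g + s * dy))"
proof -
  note it = codes_itinerary[OF g]
  obtain r where r: "0 < r" "(\<forall>h. itinerary h \<longrightarrow> \<not> (height g - r < height h \<and> height h < height g)) \<or>
      (\<forall>h. itinerary h \<longrightarrow> \<not> (height g < height h \<and> height h < height g + r))"
    using iso unfolding isolated_def by blast
  obtain e where e: "0 \<le> side e (V 0)" by (rule side_exists)
  define t where "t = side e (V 0)"
  have t: "0 \<le> t" "t \<le> 1" using e side_le codesD(1,2)[OF g, of 0] by (auto simp: t_def)
  have iso': "(\<forall>(c, d)\<in>matching e. \<not> (height g - r < c \<and> c < height g)) \<or>
      (\<forall>(c, d)\<in>matching e. \<not> (height g < c \<and> c < height g + r))"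
    using r(2) unfolding matching_def by auto
  have P: "reach (height g) (height (flip 0 e g)) t = dir e * draw_x (V 0) g"
    "height g - bend (height g) (height (flip 0 e g)) t = draw_y (V 0) g"
    using draw_side[OF e, of g] dir_cases[of e] by (auto simp: t_def)
  interpret planar_matching "matching e" by (rule matching_planar)
  have "\<exists>dx dy. (dx, dy) \<noteq> (0, 0) \<and> (\<forall>s. 0 < s \<and> s \<le> 1 \<longrightarrow>
     \<not> hits (matching e) (dir e * draw_x (V 0) g + s * dx) (draw_y (V 0) g + s * dy) \<and>
     (if t = 0 then dx = 0 else 0 < dir e * draw_x (V 0) g + s * dx))"
    using access[OF in_matching[OF it] t r(1) iso'] unfolding P .
  then obtain dx dy where d: "(dx, dy) \<noteq> (0, 0)" "\<And>s. 0 < s \<and> s \<le> 1 \<Longrightarrow>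
     \<not> hits (matching e) (dir e * draw_x (V 0) g + s * dx) (draw_y (V 0) g + s * dy) \<and>
     (if t = 0 then dx = 0 else 0 < dir e * draw_x (V 0) g + s * dx)" by blast
  have "\<not> (draw_x (W 0) h = draw_x (V 0) g + s * (dir e * dx) \<and> draw_y (W 0) h = draw_y (V 0) g + s * dy)"
    if s: "0 < s" "s \<le> 1" and h: "codes h W" for s h W
  proof
    assume eq: "draw_x (W 0) h = draw_x (V 0) g + s * (dir e * dx) \<and> draw_y (W 0) h = draw_y (V 0) g + s * dy"
    then have x: "dir e * draw_x (W 0) h = dir e * draw_x (V 0) g + s * dx" using dir_cases[of e] by auto
    have "0 \<le> dir e * draw_x (V 0) g"
      using reach_nonneg[OF t(1), of "height g" "height (flip 0 e g)"] unfolding P(1) .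
    then have "0 \<le> dir e * draw_x (V 0) g + s * dx" using d(2)[of s] s by (cases "t = 0") auto
    then have "0 \<le> dir e * draw_x (W 0) h" using x by linarith
    from draw_hits[OF h this] show False using d(2)[of s] s eq x by simp
  qed
  moreover have "(dir e * dx, dy) \<noteq> (0, 0)" using d(1) dir_cases[of e] by auto
  ultimately show ?thesis by blast
qed

end

section \<open>The embedding\<close>

definition pt :: "real \<Rightarrow> real \<Rightarrow> real^2" where
  "pt a b = a *\<^sub>R axis 1 1 + b *\<^sub>R axis 2 1"

lemma pt_component: "pt a b $ 1 = a" "pt a b $ 2 = b"
  by (simp_all add: pt_def axis_def)

lemma pt_eq_iff: "pt a b = pt c d \<longleftrightarrow> a = c \<and> b = d"
  by (metis pt_component)

lemma pt_segment: "(1 - s) *\<^sub>R pt a b + s *\<^sub>R pt (a + dx) (b + dy) = pt (a + s * dx) (b + s * dy)"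
  by (simp add: pt_def algebra_simps)

lemma continuous_map_pt:
  assumes "continuous_map X euclideanreal f" "continuous_map X euclideanreal g"
  shows "continuous_map X euclidean (\<lambda>z. pt (f z) (g z))"
proof -
  have "continuous_map X euclidean (\<lambda>z. (f z, g z))"
    using continuous_map_pairedI[OF assms] by (simp add: prod_topology_euclidean)
  moreover have "continuous_map euclidean euclidean (\<lambda>p. pt (fst p) (snd p))"
    by (auto simp: pt_def intro!: continuous_intros)
  ultimately have "continuous_map X euclidean ((\<lambda>p. pt (fst p) (snd p)) \<circ> (\<lambda>z. (f z, g z)))"
    by (rule continuous_map_compose)
  then show ?thesis by (simp add: o_def)
qed

context laminated_turns
begin

definition itinerary_space :: "(nat \<Rightarrow> nat) topology" where
  "itinerary_space = product_topology (\<lambda>m. discrete_topology {..<N m}) UNIV"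

lemma topspace_itinerary_space: "topspace itinerary_space = {g. itinerary g}"
  by (auto simp: itinerary_space_def itinerary_def PiE_iff)

lemma compact_itinerary_space: "compact_space itinerary_space"
  unfolding itinerary_space_def by (simp add: compact_space_product_topology compact_space_discrete_topology)

lemma continuous_digit: "continuous_map itinerary_space euclideanreal (\<lambda>g. \<phi> (g m))"
proof -
  have "continuous_map itinerary_space (discrete_topology {..<N m}) (\<lambda>g. g m)"
    unfolding itinerary_space_def by (rule continuous_map_product_projection) simp
  moreover have "continuous_map (discrete_topology {..<N m}) euclideanreal \<phi>" by simp
  ultimately have "continuous_map itinerary_space euclideanreal (\<phi> \<circ> (\<lambda>g. g m))" by (rule continuous_map_compose)
  then show ?thesis by (simp add: o_def)
qed

lemma openin_cylinder:
  assumes "itinerary g" shows "openin itinerary_space {h. itinerary h \<and> (\<forall>i<n. h i = g i)}"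
proof -
  define A where "A i = (if i < n then {g i} else {..<N i})" for i
  have "{h. itinerary h \<and> (\<forall>i<n. h i = g i)} = PiE UNIV A"
    using itineraryD[OF assms] by (auto simp: A_def itinerary_def PiE_iff Pi_iff split: if_splits)
  moreover have "{i. A i \<noteq> topspace (discrete_topology {..<N i})} \<subseteq> {..<n}" by (auto simp: A_def)
  then have "finite {i. A i \<noteq> topspace (discrete_topology {..<N i})}" by (rule finite_subset) simp
  ultimately show ?thesis
    unfolding itinerary_space_def using itineraryD[OF assms] by (simp add: openin_PiE_gen) (auto simp: A_def)
qed

text \<open>
  Cylinders given by finitely many digits are a neighbourhood basis of an itinerary.
\<close>
lemma continuous_if_uniform:
  assumes "\<And>r. 0 < r \<Longrightarrow> \<exists>n. \<forall>g h. itinerary g \<longrightarrow> itinerary h \<longrightarrow> (\<forall>i<n. g i = h i) \<longrightarrow> \<bar>F g - F h\<bar> < r"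
  shows "continuous_map itinerary_space euclideanreal F"
  unfolding continuous_map_atin limitin_canonical_iff tendsto_iff
proof (intro ballI allI impI)
  fix g and r :: real assume g: "g \<in> topspace itinerary_space" and r: "0 < r"
  have itg: "itinerary g" using g by (simp add: topspace_itinerary_space)
  obtain n where n: "\<And>h. itinerary h \<Longrightarrow> (\<forall>i<n. h i = g i) \<Longrightarrow> \<bar>F h - F g\<bar> < r"
    using assms[OF r] itg by blast
  show "\<forall>\<^sub>F h in atin itinerary_space g. dist (F h) (F g) < r"
    unfolding eventually_atin dist_real_def
    using openin_cylinder[OF itg, of n] n itg
    by (intro disjI2 exI[of _ "{h. itinerary h \<and> (\<forall>i<n. h i = g i)}"]) auto
qed

lemma continuous_height: "continuous_map itinerary_space euclideanreal height"
  by (rule continuous_if_uniform) (rule height_uniform)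

lemma continuous_height_flip: "continuous_map itinerary_space euclideanreal (\<lambda>g. height (flip 0 e g))"
  by (rule continuous_if_uniform) (rule height_flip_uniform)

text \<open>
  Itineraries do not depend continuously on the point. However, the pairs of a point and one of its
  itineraries form a compact space that maps onto \<open>K\<close>, and the drawing is continuous there and
  constant on fibres.
\<close>
theorem drawing_embedding:
  fixes K :: "'a topology" and v :: "nat \<Rightarrow> 'a \<Rightarrow> real"
  assumes K: "compact_space K" "Hausdorff_space K"
    and cont: "\<And>m. continuous_map K euclideanreal (v m)"
    and bounds: "\<And>m x. x \<in> topspace K \<Longrightarrow> 0 \<le> v m x \<and> v m x \<le> 1"
    and tents: "\<And>m x. x \<in> topspace K \<Longrightarrow> tri (real (N m) * v (Suc m) x) = v m x"
    and inj: "\<And>x y. x \<in> topspace K \<Longrightarrow> y \<in> topspace K \<Longrightarrow> (\<And>m. v m x = v m y) \<Longrightarrow> x = y"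
  obtains \<Omega> :: "'a \<Rightarrow> real^2" where "embedding_map K euclidean \<Omega>"
    "\<forall>x g. x \<in> topspace K \<longrightarrow> codes g (\<lambda>m. v m x) \<longrightarrow> isolated g \<longrightarrow>
       accessible_point (\<Omega> ` topspace K) (\<Omega> x)"
proof -
  define V where "V x m = v m x" for x m
  have ex: "\<exists>g. codes g (V x)" if x: "x \<in> topspace K" for x
  proof -
    have "\<exists>l. on_lap (N m) l (v m x) (v (Suc m) x)" for m
      using N_ge[of m] bounds[OF x, of "Suc m"] tents[OF x, of m] by (intro on_lap_exists) auto
    then obtain g where "\<And>m. on_lap (N m) (g m) (v m x) (v (Suc m) x)" by metis
    then show ?thesis using bounds[OF x] by (auto simp: codes_def V_def)
  qed
  define lap_eq where "lap_eq m z \<longleftrightarrow> real (N m) * v (Suc m) (fst z) =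
      real (snd z m) + ((if even (snd z m) then 0 else 1) + (if even (snd z m) then 1 else -1) * v m (fst z))" for m z
  define Gr where "Gr = {z \<in> topspace (prod_topology K itinerary_space). \<forall>m. lap_eq m z}"
  have lap_eq: "lap_eq m z \<longleftrightarrow>
      real (N m) * v (Suc m) (fst z) = real (snd z m) + (if even (snd z m) then v m (fst z) else 1 - v m (fst z))" for m z
    by (simp add: lap_eq_def)
  have Gr: "z \<in> Gr \<longleftrightarrow> fst z \<in> topspace K \<and> codes (snd z) (V (fst z))" for z
    using bounds by (auto simp: Gr_def lap_eq topspace_itinerary_space codes_def on_lap_def V_def itinerary_def mem_Times_iff)
  let ?P = "prod_topology K itinerary_space"
  have cfst: "continuous_map ?P euclideanreal (\<lambda>z. v m (fst z))" for m
    using continuous_map_compose[OF continuous_map_fst cont[of m]] by (simp add: o_def)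
  have csnd: "continuous_map ?P euclideanreal (\<lambda>z. F (snd z))" if "continuous_map itinerary_space euclideanreal F" for F
    using continuous_map_compose[OF continuous_map_snd that] by (simp add: o_def)
  have "closedin ?P {z \<in> topspace ?P. lap_eq m z}" for m
    unfolding lap_eq_def
    by (intro closedin_continuous_maps_eq[of euclideanreal] continuous_map_add continuous_map_real_mult cfst
        csnd continuous_digit[where \<phi> = real] continuous_digit[where \<phi> = "\<lambda>l. if even l then 0 else 1"]
        continuous_digit[where \<phi> = "\<lambda>l. if even l then 1 else -1"]) auto
  then have "closedin ?P (\<Inter>m. {z \<in> topspace ?P. lap_eq m z})" by (intro closedin_Inter) auto
  moreover have "(\<Inter>m. {z \<in> topspace ?P. lap_eq m z}) = Gr" unfolding Gr_def by blast
  ultimately have "closedin ?P Gr" by simp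
  moreover have "compact_space ?P" using K compact_itinerary_space by (simp add: compact_space_prod_topology)
  ultimately have comp: "compact_space (subtopology ?P Gr)"
    by (simp add: closedin_compact_space compact_space_subtopology)
  have top: "topspace (subtopology ?P Gr) = Gr" by (auto simp: Gr_def)
  have quot: "quotient_map (subtopology ?P Gr) K fst"
  proof (rule continuous_imp_quotient_map[OF _ comp K(2)])
    show "continuous_map (subtopology ?P Gr) K fst"
      by (rule continuous_map_from_subtopology) (rule continuous_map_fst)
    show "fst ` topspace (subtopology ?P Gr) = topspace K"
    proof
      show "topspace K \<subseteq> fst ` topspace (subtopology ?P Gr)"
      proof
        fix x assume x: "x \<in> topspace K"
        then obtain g where "codes g (V x)" using ex by blast
        then have "(x, g) \<in> Gr" using x Gr[of "(x, g)"] by simp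
        then show "x \<in> fst ` topspace (subtopology ?P Gr)" unfolding top by force
      qed
    qed (auto simp: top Gr)
  qed
  \<comment> \<open>Any itinerary of the point may be chosen, by \<open>draw_well_defined\<close>.\<close>
  define \<Omega> where "\<Omega> x = (let g = SOME g. codes g (V x) in pt (draw_x (v 0 x) g) (draw_y (v 0 x) g))" for x
  have \<Omega>: "\<Omega> x = pt (draw_x (v 0 x) g) (draw_y (v 0 x) g)" if g: "codes g (V x)" for x g
  proof -
    have "codes (SOME g. codes g (V x)) (V x)" using g by (rule someI[where P = "\<lambda>g. codes g (V x)"])
    from draw_well_defined[OF this g] show ?thesis by (simp add: \<Omega>_def V_def)
  qed
  have "continuous_map (subtopology ?P Gr) euclidean (\<Omega> \<circ> fst)"
  proof (rule continuous_map_eq)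
    have "continuous_map ?P euclideanreal (\<lambda>z. draw_x (v 0 (fst z)) (snd z))"
      unfolding draw_x_def reach_def left_time_def right_time_def
      by (intro continuous_intros cfst csnd[OF continuous_height] csnd[OF continuous_height_flip] continuous_map_real_divide) auto
    moreover have "continuous_map ?P euclideanreal (\<lambda>z. draw_y (v 0 (fst z)) (snd z))"
      unfolding draw_y_def bend_def left_time_def right_time_def
      by (intro continuous_intros cfst csnd[OF continuous_height] csnd[OF continuous_height_flip] continuous_map_real_divide) auto
    ultimately show "continuous_map (subtopology ?P Gr) euclidean
        (\<lambda>z. pt (draw_x (v 0 (fst z)) (snd z)) (draw_y (v 0 (fst z)) (snd z)))"
      by (intro continuous_map_from_subtopology continuous_map_pt)
  qed (use \<Omega> Gr top in auto)
  then have cO: "continuous_map K euclidean \<Omega>" by (rule continuous_compose_quotient_map[OF quot])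
  have injO: "inj_on \<Omega> (topspace K)"
  proof (rule inj_onI)
    fix x y assume x: "x \<in> topspace K" and y: "y \<in> topspace K" and eq: "\<Omega> x = \<Omega> y"
    obtain g where g: "codes g (V x)" using ex[OF x] by blast
    obtain h where h: "codes h (V y)" using ex[OF y] by blast
    have "V x = V y"
      using draw_injective[OF g h] eq \<Omega>[OF g] \<Omega>[OF h] by (simp add: pt_eq_iff V_def)
    then show "x = y" using inj[OF x y] by (metis V_def)
  qed
  show ?thesis
  proof (rule that)
    show "embedding_map K euclidean \<Omega>"
      by (rule continuous_imp_embedding_map(1)[OF cO K(1) _ injO]) simp
    show "\<forall>x g. x \<in> topspace K \<longrightarrow> codes g (\<lambda>m. v m x) \<longrightarrow> isolated g \<longrightarrow>
       accessible_point (\<Omega> ` topspace K) (\<Omega> x)"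
    proof (intro allI impI)
      fix x g assume x: "x \<in> topspace K" and g: "codes g (\<lambda>m. v m x)" and iso: "isolated g"
      have gV: "codes g (V x)" using g by (simp add: V_def[abs_def])
      obtain dx dy where d: "(dx, dy) \<noteq> (0, 0)" "\<And>s h W. 0 < s \<and> s \<le> 1 \<and> codes h W \<Longrightarrow>
         \<not> (draw_x (W 0) h = draw_x (V x 0) g + s * dx \<and> draw_y (W 0) h = draw_y (V x 0) g + s * dy)"
        using draw_access[OF gV iso] by blast
      define Q where "Q = pt (draw_x (v 0 x) g + dx) (draw_y (v 0 x) g + dy)"
      have PQ: "\<Omega> x \<noteq> Q" using d(1) by (auto simp: Q_def \<Omega>[OF gV] pt_eq_iff)
      have "closed_segment (\<Omega> x) Q homeomorphic {0..1::real}"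
        using homeomorphic_arc_image_interval[OF arc_linepath[OF PQ], of 0 1] by simp
      moreover have "closed_segment (\<Omega> x) Q \<inter> \<Omega> ` topspace K = {\<Omega> x}"
      proof
        show "closed_segment (\<Omega> x) Q \<inter> \<Omega> ` topspace K \<subseteq> {\<Omega> x}"
        proof
          fix p assume p: "p \<in> closed_segment (\<Omega> x) Q \<inter> \<Omega> ` topspace K"
          then obtain s where s: "0 \<le> s" "s \<le> 1" "p = (1 - s) *\<^sub>R \<Omega> x + s *\<^sub>R Q"
            by (auto simp: closed_segment_def)
          then have ps: "p = pt (draw_x (v 0 x) g + s * dx) (draw_y (v 0 x) g + s * dy)"
            unfolding Q_def \<Omega>[OF gV] pt_segment by simp
          obtain y where y: "y \<in> topspace K" "p = \<Omega> y" using p by blast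
          obtain h where h: "codes h (V y)" using ex[OF y(1)] by blast
          have "\<not> 0 < s" using d(2)[of s h "V y"] h s(2) ps y(2) \<Omega>[OF h] by (auto simp: pt_eq_iff V_def)
          then show "p \<in> {\<Omega> x}" using s by simp
        qed
      qed (use x in auto)
      ultimately show "accessible_point (\<Omega> ` topspace K) (\<Omega> x)"
        unfolding accessible_point_def by blast
    qed
  qed
qed

end

section \<open>Composants\<close>

lemma continuum_homeomorphic: "X homeomorphic_space Y \<Longrightarrow> continuum X \<longleftrightarrow> continuum Y"
  by (simp add: continuum_def homeomorphic_compact_space homeomorphic_connected_space homeomorphic_metrizable_space)

lemma composant_image_subset:
  assumes f: "homeomorphic_map X Y f" and x: "x \<in> topspace X"
  shows "f ` composant_of X x \<subseteq> composant_of Y (f x)"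
proof
  fix p assume "p \<in> f ` composant_of X x"
  then obtain C y where C: "C \<subset> topspace X" "continuum (subtopology X C)" "x \<in> C" "y \<in> C" "p = f y"
    unfolding composant_of_def by blast
  have inj: "inj_on f (topspace X)" and im: "f ` topspace X = topspace Y"
    using homeomorphic_imp_injective_map[OF f] homeomorphic_imp_surjective_map[OF f] .
  have "f ` C \<subset> topspace Y" using C(1) im inj_on_image_eq_iff[OF inj, of C "topspace X"] by blast
  moreover have "homeomorphic_map (subtopology X C) (subtopology Y (f ` C)) f"
    using C(1) im by (intro homeomorphic_map_subtopologies[OF f]) (auto simp: Int_absorb1)
  then have "continuum (subtopology Y (f ` C))"
    using C(2) continuum_homeomorphic homeomorphic_space by blast
  ultimately show "p \<in> composant_of Y (f x)" unfolding composant_of_def using C by blast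
qed

lemma composant_subset: "composant_of X x \<subseteq> topspace X"
  unfolding composant_of_def by blast

lemma composant_image:
  assumes f: "homeomorphic_map X Y f" and x: "x \<in> topspace X"
  shows "f ` composant_of X x = composant_of Y (f x)"
proof
  show "f ` composant_of X x \<subseteq> composant_of Y (f x)" by (rule composant_image_subset[OF f x])
  obtain g where g: "homeomorphic_maps X Y f g" using f homeomorphic_map_maps by blast
  have gh: "homeomorphic_map Y X g" using g homeomorphic_maps_map by blast
  have fx: "f x \<in> topspace Y" using homeomorphic_imp_surjective_map[OF f] x by blast
  have "g ` composant_of Y (f x) \<subseteq> composant_of X x"
    using composant_image_subset[OF gh fx] g x by (simp add: homeomorphic_maps_def)
  then have "f ` g ` composant_of Y (f x) \<subseteq> f ` composant_of X x" by (rule image_mono)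
  moreover have "f ` g ` composant_of Y (f x) = composant_of Y (f x)"
    using g composant_subset[of Y "f x"] by (force simp: homeomorphic_maps_def image_image)
  ultimately show "composant_of Y (f x) \<subseteq> f ` composant_of X x" by simp
qed

text \<open>
  Let \<open>C\<close> be a subcontinuum that contains \<open>x\<close> and \<open>y\<close>. If these are not close, the coordinate \<open>u j\<close> maps
  \<open>C\<close> onto a set that contains a full lap of the tent map from level \<open>j\<close> to \<open>i\<close> for some \<open>j \<ge> i\<close>, so \<open>u i\<close>
  maps \<open>C\<close> onto \<open>[0,1]\<close>. As this holds for all \<open>i\<close>, compactness gives \<open>C = K\<close>.
\<close>
lemma composant_close:
  fixes K :: "'a topology"
  assumes K: "compact_space K" "Hausdorff_space K" and n: "\<And>i. 2 \<le> n i"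
    and cont: "\<And>i. continuous_map K unit_interval (u i)"
    and thr: "\<And>x. x \<in> topspace K \<Longrightarrow> thread n (\<lambda>i. u i x)"
    and inj: "\<And>x y. x \<in> topspace K \<Longrightarrow> y \<in> topspace K \<Longrightarrow> (\<And>i. u i x = u i y) \<Longrightarrow> x = y"
    and y: "y \<in> composant_of K x"
  shows "close n (\<lambda>i. u i x) (\<lambda>i. u i y)"
proof (rule ccontr)
  assume far: "\<not> ?thesis"
  obtain C where C: "C \<subset> topspace K" "continuum (subtopology K C)" "x \<in> C" "y \<in> C"
    using y unfolding composant_of_def by blast
  have CK: "C \<subseteq> topspace K" using C(1) by blast
  have comp: "compactin K C" and conn: "connectedin K C"
    using C(2) CK unfolding continuum_def compactin_subspace connectedin_def by auto
  have cr: "continuous_map K euclideanreal (u i)" for i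
    using cont[of i] by (rule continuous_map_into_fulltopology)
  have onto: "\<exists>c\<in>C. u i c = t" if t: "0 \<le> t" "t \<le> 1" for i t
  proof -
    obtain j where j: "i \<le> j" "2 < real (laps n i j) * \<bar>u j x - u j y\<bar>"
      using not_close_far[OF n thr thr far, of i 2] C CK by (metis order_refl subsetD)
    define L where "L = real (laps n i j)"
    have L: "0 < L" using laps_pos[of n i j] n by (simp add: L_def)
    define a where "a = min (u j x) (u j y)"
    define b where "b = max (u j x) (u j y)"
    have ab: "2 < L * b - L * a" "a \<in> u j ` C" "b \<in> u j ` C"
      using j(2) C(3,4) by (auto simp: a_def b_def L_def min_def max_def abs_if algebra_simps split: if_splits)
    have a0: "0 \<le> a" using thr[of x] thr[of y] C CK threadD(1) by (auto simp: a_def)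
    define k where "k = nat \<lceil>L * a\<rceil>"
    have k: "L * a \<le> real k" "real k + 1 \<le> L * b"
      using ab(1) a0 L mult_nonneg_nonneg[of L a] unfolding k_def by linarith+
    \<comment> \<open>the point over \<open>t\<close> in lap \<open>k\<close>\<close>
    define z where "z = real k + (if even k then t else 1 - t)"
    have z: "real k \<le> z" "z \<le> real k + 1" using t by (auto simp: z_def)
    have "connected (u j ` C)"
      using connectedin_continuous_map_image[OF cr conn, of j] by simp
    then have "{a..b} \<subseteq> u j ` C" using ab(2,3) by (rule connected_contains_Icc)
    moreover have "a \<le> z / L" "z / L \<le> b" using k z L by (auto simp: field_simps)
    ultimately have "z / L \<in> u j ` C" by auto
    then obtain c where c: "c \<in> C" "u j c = z / L" by auto
    have "u i c = tri (L * u j c)" using thread_laps[OF thr j(1), of c] c(1) CK by (auto simp: L_def)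
    also have "\<dots> = t" using c(2) L tri_lap[OF z] by (simp add: z_def)
    finally show ?thesis using c(1) by blast
  qed
  have "topspace K \<subseteq> C"
  proof
    fix z assume z: "z \<in> topspace K"
    define F where "F i = C \<inter> {c \<in> topspace K. u i c = u i z}" for i
    have "(\<Inter>i. F i) \<noteq> {}"
    proof (rule compact_space_imp_nest[OF K(1)])
      show "closedin K (F i)" for i
        unfolding F_def using compactin_imp_closedin[OF K(2) comp]
        by (intro closedin_Int closedin_continuous_maps_eq[of euclideanreal] cr) auto
      show "F i \<noteq> {}" for i
        using onto[of "u i z" i] threadD(1,2)[OF thr[OF z]] CK by (fastforce simp: F_def)
      show "decseq F"
        unfolding decseq_Suc_iff
      proof
        fix i
        have "u i c = u i z" if "u (Suc i) c = u (Suc i) z" "c \<in> topspace K" for c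
          using threadD(3)[OF thr[OF that(2)], of i] threadD(3)[OF thr[OF z], of i] that(1) by simp
        then show "F (Suc i) \<subseteq> F i" by (auto simp: F_def)
      qed
    qed
    then obtain c where c: "\<And>i. c \<in> F i" by blast
    then have "c \<in> C" "\<And>i. u i c = u i z" by (auto simp: F_def)
    then show "z \<in> C" using inj[of c z] z CK by auto
  qed
  then show False using C(1) by blast
qed

theorem theorem17:
  fixes K :: "'a topology" and \<K> :: "'a set set"
  assumes "Knaster_continuum K"
    and "countable \<K>"
    and "\<And>\<kappa>. \<kappa> \<in> \<K> \<Longrightarrow> is_composant K \<kappa>"
  shows "\<exists>\<Omega> :: 'a \<Rightarrow> real^2.
           embedding_map K euclidean \<Omega> \<and>
           (\<forall>\<kappa>\<in>\<K>. fully_accessible_composant (\<Omega> ` topspace K) (\<Omega> ` \<kappa>))"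
proof -
  obtain n u where n: "\<And>i. 2 \<le> n i" and cont: "\<And>i. continuous_map K unit_interval (u i)"
    and tents: "\<And>i x. x \<in> topspace K \<Longrightarrow> tri (real (n i) * u (Suc i) x) = u i x"
    and inj: "\<And>x y. x \<in> topspace K \<Longrightarrow> y \<in> topspace K \<Longrightarrow> (\<And>i. u i x = u i y) \<Longrightarrow> x = y"
    using Knaster_tent_coordinates[OF assms(1)] by metis
  have K: "compact_space K" "Hausdorff_space K"
    using assms(1) by (auto simp: Knaster_continuum_def continuum_def metrizable_imp_Hausdorff_space)
  have bounds: "0 \<le> u i x \<and> u i x \<le> 1" if "x \<in> topspace K" for i x
    using cont[of i] that by (auto simp: continuous_map_def Pi_iff)
  have thr: "thread n (\<lambda>i. u i x)" if "x \<in> topspace K" for x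
    using that bounds tents by (simp add: thread_def)
  have "\<forall>\<kappa>\<in>\<K>. \<exists>b. b \<in> topspace K \<and> \<kappa> = composant_of K b" using assms(3) unfolding is_composant_def by blast
  then obtain b where b: "\<And>\<kappa>. \<kappa> \<in> \<K> \<Longrightarrow> b \<kappa> \<in> topspace K \<and> \<kappa> = composant_of K (b \<kappa>)" by metis
  \<comment> \<open>The zero thread is needed as number \<open>0\<close>, whether or not its composant is among the given ones.\<close>
  define T where "T = insert (\<lambda>_. 0) ((\<lambda>\<kappa> i. u i (b \<kappa>)) ` \<K>)"
  have T: "countable T" "T \<noteq> {}" using assms(2) by (auto simp: T_def)
  have thrT: "thread n U" if "U \<in> T" for U
  proof -
    have "thread n (\<lambda>_. 0)" using tri_id[of 0] by (simp add: thread_def)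
    then show ?thesis using that thr b unfolding T_def by blast
  qed
  define x where "x s = (case s of 0 \<Rightarrow> (\<lambda>_. 0) | Suc s \<Rightarrow> from_nat_into T s)" for s
  have x0: "x 0 = (\<lambda>_. 0)" by (simp add: x_def)
  have "x s \<in> T" for s using from_nat_into[OF T(2)] by (cases s) (auto simp: x_def T_def)
  then have x: "thread n (x s)" for s using thrT by blast
  obtain i legs leg rank where i: "i 0 = 0" "strict_mono i"
    and lam: "laminated_turns (\<lambda>m. laps n (i m) (i (Suc m))) legs leg rank"
    and iso: "\<forall>U s g. thread n U \<longrightarrow> close n (x s) U \<longrightarrow>
       (\<forall>m. on_lap (laps n (i m) (i (Suc m))) (g m) (U (i m)) (U (i (Suc m)))) \<longrightarrow>
       laminated_turns.isolated (\<lambda>m. laps n (i m) (i (Suc m))) legs leg rank g"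
    by (rule isolating_system[of n x, OF n x x0])
  interpret laminated_turns "\<lambda>m. laps n (i m) (i (Suc m))" legs leg rank by (rule lam)
  define v where "v m p = u (i m) p" for m p
  have vcont: "continuous_map K euclideanreal (v m)" for m
    using cont[of "i m"] unfolding v_def[abs_def] by (rule continuous_map_into_fulltopology)
  have vbounds: "0 \<le> v m p \<and> v m p \<le> 1" if "p \<in> topspace K" for m p
    using bounds[OF that] by (simp add: v_def)
  have vtents: "tri (real (laps n (i m) (i (Suc m))) * v (Suc m) p) = v m p" if "p \<in> topspace K" for m p
    using thread_laps[OF thr[OF that], of "i m" "i (Suc m)"] i(2) by (simp add: v_def strict_mono_less_eq)
  have vinj: "p = q" if "p \<in> topspace K" "q \<in> topspace K" "\<And>m. v m p = v m q" for p q
  proof (rule inj[OF that(1,2)])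
    fix j
    have "j \<le> i j" using i(2) by (rule strict_mono_imp_increasing)
    from thread_laps[OF thr[OF that(1)] this] thread_laps[OF thr[OF that(2)] this] that(3)[of j]
    show "u j p = u j q" by (simp add: v_def)
  qed
  obtain \<Omega> :: "'a \<Rightarrow> real^2" where \<Omega>: "embedding_map K euclidean \<Omega>"
    "\<forall>p g. p \<in> topspace K \<longrightarrow> codes g (\<lambda>m. v m p) \<longrightarrow> isolated g \<longrightarrow>
       accessible_point (\<Omega> ` topspace K) (\<Omega> p)"
    by (rule drawing_embedding[OF K vcont vbounds vtents vinj])
  have homeo: "homeomorphic_map K (top_of_set (\<Omega> ` topspace K)) \<Omega>"
    using \<Omega>(1) by (simp add: embedding_map_def)
  have "fully_accessible_composant (\<Omega> ` topspace K) (\<Omega> ` \<kappa>)" if \<kappa>: "\<kappa> \<in> \<K>" for \<kappa>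
    unfolding fully_accessible_composant_def
  proof
    define c where "c = b \<kappa>"
    have bk: "c \<in> topspace K" "\<kappa> = composant_of K c" using b[OF \<kappa>] by (auto simp: c_def)
    show "is_composant (top_of_set (\<Omega> ` topspace K)) (\<Omega> ` \<kappa>)"
      unfolding is_composant_def using composant_image[OF homeo bk(1)] bk by (metis image_eqI topspace_euclidean_subtopology)
    show "\<forall>p\<in>\<Omega> ` \<kappa>. accessible_point (\<Omega> ` topspace K) p"
    proof
      fix p assume "p \<in> \<Omega> ` \<kappa>"
      then obtain y where y: "y \<in> \<kappa>" "p = \<Omega> y" by blast
      have yc: "y \<in> composant_of K c" using y(1) unfolding bk(2) .
      then have yK: "y \<in> topspace K" using composant_subset[of K c] by blast
      have cl: "close n (\<lambda>i. u i c) (\<lambda>i. u i y)"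
        using composant_close[of K n u y c, OF K n cont thr inj yc] .
      have "(\<lambda>i. u i c) \<in> T" using \<kappa> by (simp add: T_def c_def)
      then obtain s where s: "x (Suc s) = (\<lambda>i. u i c)"
        using from_nat_into_surj[OF T(1)] by (auto simp: x_def)
      have "\<exists>l. on_lap (laps n (i m) (i (Suc m))) l (v m y) (v (Suc m) y)" for m
        using N_ge[of m] vbounds[OF yK, of "Suc m"] by (intro on_lap_exists vtents[OF yK]) auto
      then obtain g where g: "\<And>m. on_lap (laps n (i m) (i (Suc m))) (g m) (v m y) (v (Suc m) y)" by metis
      have "isolated g"
        using iso[rule_format, OF thr[OF yK], of "Suc s" g] cl g unfolding s v_def by blast
      moreover have "codes g (\<lambda>m. v m y)" using g vbounds[OF yK] by (simp add: codes_def)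
      ultimately show "accessible_point (\<Omega> ` topspace K) p" using \<Omega>(2) yK y(2) by blast
    qed
  qed
  then show ?thesis using \<Omega>(1) by blast
qed

end
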